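(* Let $q>2$ be a prime power, $G=\mathbf{GL}(2,\mathbb{F}_q)$, $E=\mathbb{F}_{q^2}$, and write $\overline{x}=x^q$ for $x\in E$. Let $x\in E\setminus\mathbb{F}_q$ and $g=c_4(x)=\begin{pmatrix}0&-x\overline{x}\\1&x+\overline{x}\end{pmatrix}$, whose centralizer $\mathcal{Z}_g$ in $G$ is cyclic, and let $\chi$ be a character of $\mathcal{Z}_g$ with values in $k^\times$. Let $T=\left\{c_4(x),\begin{pmatrix}x+\overline{x}&x\overline{x}\\-1&0\end{pmatrix}\right\}$ (two commuting elements that are conjugate in $G$). If $\dim\mathfrak{B}(V(g,\chi))<\infty$, then $\mathbf{q}_T$ is either $\begin{pmatrix}-1&-1\\-1&-1\end{pmatrix}$ or $\begin{pmatrix}\omega&\omega\\\omega&\omega\end{pmatrix}$, where $\omega\in k$ is a primitive cube root of unity.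
   Context: $k$ is an algebraically closed field of characteristic $0$. For a finite group $G$, a Yetter-Drinfeld module over $kG$ is a $G$-graded $k$-vector space $V=\bigoplus_{h\in G}V_h$ with a linear $G$-action such that $g\cdot V_h\subseteq V_{ghg^{-1}}$. It is a braided vector space with braiding $c(v\otimes w)=h\cdot w\otimes v$ for $v\in V_h$, $w\in V$. For $g\in G$, $\mathcal{Z}_g$ is the centralizer of $g$ in $G$. For a character $\chi$ of $\mathcal{Z}_g$, $V(g,\chi)=\mathrm{Ind}_{\mathcal{Z}_g}^G\chi=kG\otimes_{k\mathcal{Z}_g}k_\chi$, graded so that $h\otimes w$ has degree $hgh^{-1}$. If $T=\{g_i\}$ is a set of pairwise commuting elements of the conjugacy class of $g$ that contains $g$, with $g_i=x_igx_i^{-1}$, then $\mathbf{q}_T=(\mathbf{q}_{ij})$ is the matrix with $\mathbf{q}_{ij}=\chi(x_j^{-1}g_ix_j)$ (independent of the choice of the $x_j$). On the span of the vectors $v_i=x_i\otimes1$ the braiding is $c(v_i\otimes v_j)=\mathbf{q}_{ij}v_j\otimes v_i$. The Nichols algebra of a braided vector space $(V,c)$ is $\mathfrak{B}(V)=T(V)/\bigoplus_{n\ge2}\ker(\mathfrak{S}_n)$, where $\mathfrak{S}_n=\sum_{\sigma\in\mathbb{S}_n}c_\sigma$ acts on $V^{\otimes n}$ and $c_\sigma$ is obtained from a reduced expression of $\sigma$ by replacing each transposition $(i\ i{+}1)$ with $c$ acting on the factors $i,i+1$. *)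

theory Defs
  imports
    "HOL-Analysis.Cartesian_Space"
    "HOL-Library.Poly_Mapping"
    "HOL-Algebra.Module"
    "HOL-Combinatorics.Permutations"
    "HOL-Computational_Algebra.Polynomial"
    "HOL-Number_Theory.Prime_Powers"
begin

section \<open>Free vector spaces\<close>

text \<open>The free vector space on a set \<open>A\<close> is the set of all \<open>f :: 'a \<Rightarrow>\<^sub>0 'k\<close> with
  \<open>Poly_Mapping.keys f \<subseteq> A\<close>; its standard basis consists of the vectors \<open>basis_vec a\<close>.\<close>

definition free_scale :: "'k::field \<Rightarrow> ('a \<Rightarrow>\<^sub>0 'k) \<Rightarrow> ('a \<Rightarrow>\<^sub>0 'k)" where
  "free_scale c = Poly_Mapping.map ((*) c)"

lemma lookup_free_scale [simp]: "Poly_Mapping.lookup (free_scale c f) a = c * Poly_Mapping.lookup f a"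
  by (auto simp: free_scale_def Poly_Mapping.map.rep_eq when_def)

interpretation free_vs: vector_space "free_scale :: 'k::field \<Rightarrow> ('a \<Rightarrow>\<^sub>0 'k) \<Rightarrow> ('a \<Rightarrow>\<^sub>0 'k)"
  by unfold_locales (auto intro!: poly_mapping_eqI simp: lookup_add algebra_simps)

abbreviation basis_vec :: "'a \<Rightarrow> ('a \<Rightarrow>\<^sub>0 'k::field)" where
  "basis_vec a \<equiv> Poly_Mapping.single a 1"

definition free_extend :: "('a \<Rightarrow> ('b \<Rightarrow>\<^sub>0 'k)) \<Rightarrow> ('a \<Rightarrow>\<^sub>0 'k::field) \<Rightarrow> ('b \<Rightarrow>\<^sub>0 'k)" where
  "free_extend \<phi> f = (\<Sum>a\<in>Poly_Mapping.keys f. free_scale (Poly_Mapping.lookup f a) (\<phi> a))"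

definition coset_of :: "('a \<Rightarrow>\<^sub>0 'k::field) set \<Rightarrow> ('a \<Rightarrow>\<^sub>0 'k) \<Rightarrow> ('a \<Rightarrow>\<^sub>0 'k) set" where
  "coset_of R f = {f + r |r. r \<in> R}"

text \<open>If \<open>\<phi>\<close> is linear and maps \<open>R\<close> into \<open>R\<close>, this is the map induced by \<open>\<phi>\<close> on the cosets
  of \<open>R\<close>.\<close>

definition coset_map ::
    "('a \<Rightarrow>\<^sub>0 'k::field) set \<Rightarrow> (('a \<Rightarrow>\<^sub>0 'k) \<Rightarrow> ('a \<Rightarrow>\<^sub>0 'k)) \<Rightarrow> ('a \<Rightarrow>\<^sub>0 'k) set \<Rightarrow> ('a \<Rightarrow>\<^sub>0 'k) set"
  where "coset_map R \<phi> C = {\<phi> f + r |f r. f \<in> C \<and> r \<in> R}"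


section \<open>The Nichols algebra of a braided vector space\<close>

text \<open>The tensor algebra \<open>T(V)\<close> is the free algebra on the underlying set of \<open>V\<close> modulo the
  multilinearity relations.  The word \<open>[v\<^sub>1, \<dots>, v\<^sub>n]\<close> represents \<open>v\<^sub>1 \<otimes> \<dots> \<otimes> v\<^sub>n\<close>, and two
  elements of \<open>tensor_words V\<close> represent the same tensor iff they differ by an element of
  \<open>tensor_relations V\<close>.  The type variable \<open>'k\<close> is the ground field.  The fields \<open>mult\<close> and
  \<open>one\<close> that module records inherit from ring records are never used.\<close>

definition tensor_words :: "('k::field, 'v, 'm) module_scheme \<Rightarrow> ('v list \<Rightarrow>\<^sub>0 'k) set" where
  "tensor_words V = {f. Poly_Mapping.keys f \<subseteq> lists (carrier V)}"

definition tensor_relations :: "('k::field, 'v, 'm) module_scheme \<Rightarrow> ('v list \<Rightarrow>\<^sub>0 'k) set" where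
  "tensor_relations V = free_vs.span
    ({basis_vec (us @ [v \<oplus>\<^bsub>V\<^esub> w] @ ws) - basis_vec (us @ [v] @ ws) - basis_vec (us @ [w] @ ws) |us v w ws.
        us \<in> lists (carrier V) \<and> v \<in> carrier V \<and> w \<in> carrier V \<and> ws \<in> lists (carrier V)} \<union>
     {basis_vec (us @ [a \<odot>\<^bsub>V\<^esub> v] @ ws) - free_scale a (basis_vec (us @ [v] @ ws)) |us a v ws.
        us \<in> lists (carrier V) \<and> v \<in> carrier V \<and> ws \<in> lists (carrier V)})"

definition tensor_component :: "nat \<Rightarrow> ('v list \<Rightarrow>\<^sub>0 'k::field) \<Rightarrow> ('v list \<Rightarrow>\<^sub>0 'k)" where
  "tensor_component n = free_extend (\<lambda>w. if length w = n then basis_vec w else 0)"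

text \<open>A braiding is given by representatives: \<open>c v w\<close> is a combination of words of length 2
  representing \<open>c(v \<otimes> w)\<close>.  Positions in a word are counted from 0, so \<open>braid_at c i\<close> applies
  \<open>c\<close> to the tensor factors at positions \<open>i\<close> and \<open>i + 1\<close>.\<close>

definition braid_at ::
    "('v \<Rightarrow> 'v \<Rightarrow> ('v list \<Rightarrow>\<^sub>0 'k::field)) \<Rightarrow> nat \<Rightarrow> ('v list \<Rightarrow>\<^sub>0 'k) \<Rightarrow> ('v list \<Rightarrow>\<^sub>0 'k)" where
  "braid_at c i = free_extend (\<lambda>w.
     free_extend (\<lambda>p. basis_vec (take i w @ p @ drop (i + 2) w)) (c (w ! i) (w ! (i + 1))))"

definition is_expression :: "nat \<Rightarrow> (nat \<Rightarrow> nat) \<Rightarrow> nat list \<Rightarrow> bool" where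
  "is_expression n \<sigma> is \<longleftrightarrow>
     (\<forall>i\<in>set is. i + 1 < n) \<and> \<sigma> = foldr (\<lambda>i \<tau>. Transposition.transpose i (i + 1) \<circ> \<tau>) is id"

definition is_reduced_expression :: "nat \<Rightarrow> (nat \<Rightarrow> nat) \<Rightarrow> nat list \<Rightarrow> bool" where
  "is_reduced_expression n \<sigma> is \<longleftrightarrow>
     is_expression n \<sigma> is \<and> (\<forall>js. is_expression n \<sigma> js \<longrightarrow> length is \<le> length js)"

text \<open>When \<open>c\<close> satisfies the braid equation, the class of the result in \<open>T(V)\<close> does not depend
  on the reduced expression that is chosen.\<close>

definition braid_perm ::
    "('v \<Rightarrow> 'v \<Rightarrow> ('v list \<Rightarrow>\<^sub>0 'k::field)) \<Rightarrow> nat \<Rightarrow> (nat \<Rightarrow> nat) \<Rightarrow> ('v list \<Rightarrow>\<^sub>0 'k) \<Rightarrow> ('v list \<Rightarrow>\<^sub>0 'k)"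
  where "braid_perm c n \<sigma> =
    foldr (\<lambda>i \<psi>. braid_at c i \<circ> \<psi>) (SOME is. is_reduced_expression n \<sigma> is) id"

definition quantum_symmetrizer ::
    "('v \<Rightarrow> 'v \<Rightarrow> ('v list \<Rightarrow>\<^sub>0 'k::field)) \<Rightarrow> nat \<Rightarrow> ('v list \<Rightarrow>\<^sub>0 'k) \<Rightarrow> ('v list \<Rightarrow>\<^sub>0 'k)" where
  "quantum_symmetrizer c n f = (\<Sum>\<sigma> | \<sigma> permutes {..<n}. braid_perm c n \<sigma> f)"

text \<open>The preimage in \<open>tensor_words V\<close> of the ideal of \<open>T(V)\<close> that is the sum of the kernels of
  the quantum symmetrizers in degrees at least 2.  In degrees 0 and 1 the ideal is zero.\<close>

definition nichols_relations ::
    "('k::field, 'v, 'm) module_scheme \<Rightarrow> ('v \<Rightarrow> 'v \<Rightarrow> ('v list \<Rightarrow>\<^sub>0 'k)) \<Rightarrow> ('v list \<Rightarrow>\<^sub>0 'k) set" where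
  "nichols_relations V c = {f \<in> tensor_words V.
     (\<forall>n<2. tensor_component n f \<in> tensor_relations V) \<and>
     (\<forall>n\<ge>2. quantum_symmetrizer c n (tensor_component n f) \<in> tensor_relations V)}"

text \<open>The Nichols algebra is \<open>tensor_words V\<close> modulo \<open>nichols_relations V c\<close>; it is finite
  dimensional iff finitely many cosets span it.\<close>

definition nichols_finite_dim ::
    "('k::field, 'v, 'm) module_scheme \<Rightarrow> ('v \<Rightarrow> 'v \<Rightarrow> ('v list \<Rightarrow>\<^sub>0 'k)) \<Rightarrow> bool" where
  "nichols_finite_dim V c \<longleftrightarrow>
     (\<exists>S. finite S \<and> S \<subseteq> tensor_words V \<and> tensor_words V \<subseteq> free_vs.span (S \<union> nichols_relations V c))"


section \<open>Yetter--Drinfeld modules\<close>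

text \<open>The grading is recorded by the projections onto the homogeneous components:
  \<open>component V h v\<close> is the component of \<open>v\<close> of degree \<open>h\<close>.\<close>

record ('k, 'v, 'g) yd_module = "('k, 'v) module" +
  action :: "'g \<Rightarrow> 'v \<Rightarrow> 'v"
  component :: "'g \<Rightarrow> 'v \<Rightarrow> 'v"

definition yd_braiding ::
    "('g, 'a) monoid_scheme \<Rightarrow> ('k::field, 'v, 'g, 'm) yd_module_scheme \<Rightarrow> 'v \<Rightarrow> 'v \<Rightarrow> ('v list \<Rightarrow>\<^sub>0 'k)"
  where "yd_braiding G V v w = (\<Sum>h\<in>carrier G. basis_vec [action V h w, component V h v])"

definition centralizer :: "('g, 'a) monoid_scheme \<Rightarrow> 'g \<Rightarrow> 'g set" where
  "centralizer G g = {z \<in> carrier G. z \<otimes>\<^bsub>G\<^esub> g = g \<otimes>\<^bsub>G\<^esub> z}"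

definition mult_group_of_field :: "'k::field monoid" where
  "mult_group_of_field = \<lparr>carrier = - {0}, monoid.mult = (*), one = 1\<rparr>"

definition characters :: "('g, 'a) monoid_scheme \<Rightarrow> 'g set \<Rightarrow> ('g \<Rightarrow> 'k::field) set" where
  "characters G H = hom (G\<lparr>carrier := H\<rparr>) mult_group_of_field"

text \<open>\<open>induced_module G g ch\<close> is \<open>kG \<otimes>\<^bsub>kZ\<^esub> k\<^sub>c\<^sub>h\<close>, where \<open>Z\<close> is the centralizer of \<open>g\<close>, that is, \<open>kG\<close>
  modulo the relations \<open>hz \<otimes> 1 = ch(z)(h \<otimes> 1)\<close>.  The element \<open>h \<otimes> 1\<close> is the coset of \<open>basis_vec h\<close>.\<close>

definition induced_relations ::
    "('g, 'a) monoid_scheme \<Rightarrow> 'g \<Rightarrow> ('g \<Rightarrow> 'k::field) \<Rightarrow> ('g \<Rightarrow>\<^sub>0 'k) set" where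
  "induced_relations G g ch = free_vs.span
     {basis_vec (h \<otimes>\<^bsub>G\<^esub> z) - free_scale (ch z) (basis_vec h) |h z. h \<in> carrier G \<and> z \<in> centralizer G g}"

definition induced_module ::
    "('g, 'a) monoid_scheme \<Rightarrow> 'g \<Rightarrow> ('g \<Rightarrow> 'k::field) \<Rightarrow> ('k, ('g \<Rightarrow>\<^sub>0 'k) set, 'g) yd_module" where
  "induced_module G g ch = (let R = induced_relations G g ch in
     \<lparr>carrier = {coset_of R f |f. Poly_Mapping.keys f \<subseteq> carrier G},
      monoid.mult = undefined, one = undefined,
      zero = R,
      add = (\<lambda>C D. {c + d |c d. c \<in> C \<and> d \<in> D}),
      module.smult = (\<lambda>a. coset_map R (free_scale a)),
      action = (\<lambda>y. coset_map R (free_extend (\<lambda>h. basis_vec (y \<otimes>\<^bsub>G\<^esub> h)))),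
      component = (\<lambda>d. coset_map R
        (free_extend (\<lambda>h. if h \<otimes>\<^bsub>G\<^esub> g \<otimes>\<^bsub>G\<^esub> inv\<^bsub>G\<^esub> h = d then basis_vec h else 0)))\<rparr>)"

text \<open>\<open>t\<close> enumerates the commuting conjugates \<open>g\<^sub>i\<close> of \<open>g\<close>, and \<open>y\<close> gives elements with
  \<open>g\<^sub>i = y\<^sub>i g y\<^sub>i\<inverse>\<close>.\<close>

definition braiding_matrix ::
    "('g, 'a) monoid_scheme \<Rightarrow> ('g \<Rightarrow> 'k) \<Rightarrow> 'g ^ 'n \<Rightarrow> 'g ^ 'n \<Rightarrow> 'k ^ 'n ^ 'n" where
  "braiding_matrix G ch t y = (\<chi> i j. ch (inv\<^bsub>G\<^esub> (y $ j) \<otimes>\<^bsub>G\<^esub> (t $ i) \<otimes>\<^bsub>G\<^esub> (y $ j)))"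


section \<open>The general linear group and the quadratic extension\<close>

definition GL :: "('f::field ^ 'n ^ 'n) monoid" where
  "GL = \<lparr>carrier = {A. invertible A}, monoid.mult = (**), one = mat 1\<rparr>"

definition mat2 :: "'a::zero \<Rightarrow> 'a \<Rightarrow> 'a \<Rightarrow> 'a \<Rightarrow> 'a ^ 2 ^ 2" where
  "mat2 a b c d = vector [vector [a, b], vector [c, d]]"

definition field_embedding :: "('f::field \<Rightarrow> 'e::field) \<Rightarrow> bool" where
  "field_embedding \<iota> \<longleftrightarrow> \<iota> 1 = 1 \<and> (\<forall>a b. \<iota> (a + b) = \<iota> a + \<iota> b) \<and> (\<forall>a b. \<iota> (a * b) = \<iota> a * \<iota> b)"

text \<open>For an embedding \<open>\<iota>\<close> of \<open>\<F>\<^sub>q\<close> into \<open>\<F>\<^sub>q\<^sub>2\<close>, with \<open>q = CARD('f)\<close>, these are the elements of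
  \<open>\<F>\<^sub>q\<close> that \<open>\<iota>\<close> maps to \<open>x + x\<^sup>q\<close> and to \<open>x x\<^sup>q\<close>.\<close>

definition conj_sum :: "('f::{field,finite} \<Rightarrow> 'e::field) \<Rightarrow> 'e \<Rightarrow> 'f" where
  "conj_sum \<iota> x = the_inv \<iota> (x + x ^ CARD('f))"

definition conj_prod :: "('f::{field,finite} \<Rightarrow> 'e::field) \<Rightarrow> 'e \<Rightarrow> 'f" where
  "conj_prod \<iota> x = the_inv \<iota> (x * x ^ CARD('f))"

definition c4 :: "('f::{field,finite} \<Rightarrow> 'e::field) \<Rightarrow> 'e \<Rightarrow> 'f ^ 2 ^ 2" where
  "c4 \<iota> x = mat2 0 (- conj_prod \<iota> x) 1 (conj_sum \<iota> x)"

definition primitive_root_of_unity :: "nat \<Rightarrow> 'k::field \<Rightarrow> bool" where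
  "primitive_root_of_unity n \<omega> \<longleftrightarrow> n > 0 \<and> \<omega> ^ n = 1 \<and> (\<forall>m. 0 < m \<and> m < n \<longrightarrow> \<omega> ^ m \<noteq> 1)"

end

theory Submission
  imports Defs "HOL-Number_Theory.Residues"
begin

text \<open>The subalgebra generated by \<open>g\<close> over \<open>\<F>\<^sub>q\<close> is a copy of \<open>\<F>\<^sub>q\<^sub>2\<close>, and the second element of \<open>T\<close>
  is \<open>g ^ q\<close>.  Hence the braiding matrix has \<open>a = \<chi>(g)\<close> on the diagonal and \<open>s = a ^ q\<close> off the
  diagonal, with \<open>a ^ (q\<^sup>2) = a\<close>.  Let \<open>N\<close> be the order of \<open>a\<close> and \<open>s\<^sup>2 = a ^ (-k)\<close> with \<open>0 \<le> k < N\<close>, so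
  that the braiding is of Cartan type with both off-diagonal Cartan entries \<open>-k\<close>.  The cases
  \<open>k = 0\<close> and \<open>k = 1\<close> give the two matrices of the theorem, and \<open>N = 1\<close> gives a polynomial ring.

  For \<open>k \<ge> 2\<close> the Nichols algebra is infinite dimensional.  It contains, inside the quantum shuffle
  algebra, the Steinberg module of the corresponding quantum group of rank 2.  The reflection in the
  first simple root replaces the Chevalley generators by root vectors of the roots \<open>-\<alpha>\<^sub>1\<close> and
  \<open>\<alpha>\<^sub>2 + k \<alpha>\<^sub>1\<close> and the highest weight vector by \<open>F\<^sub>1 ^ (N - 1)\<close> applied to it; for the Steinberg
  weight all defining relations keep their form.  So if the module is nonzero in degree
  \<open>(p, m)\<close>, then it is nonzero in degree \<open>(N - 1 - p + k m, m)\<close>, and by symmetry in degree \<open>(m, p)\<close>.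
  A nonzero component of maximal total degree contradicts this.\<close>

section \<open>Operators on functions of words\<close>

text \<open>A function killed by both operators \<open>strip\<close> is a multiple of
  \<open>delta\<close>. Functions of words thus form a coinduced module whose only singular vectors
  lie on the line of \<open>delta\<close>, and the submodule generated by \<open>delta\<close> is
  simple from the start: no Verma module has to be divided by a radical. Its link to the Nichols
  algebra is that a raising operator is a combination of the two shuffle multiplications by a
  letter, on one side and on the other. Hence everything generated by \<open>delta\<close> is a
  combination of shuffle products of letters, and these are the matrix coefficients of the quantum
  symmetrizers. Only this inclusion is needed: infinite dimension just asks for nonzero values in
  arbitrarily high degree. Working with a module is what makes reflection elementary. Reflecting a
  Nichols algebra produces another algebra that has to be identified, whereas here one space carries
  both the original and the reflected operators, and it suffices to check that both families satisfy
  the same commutation relations.\<close>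

type_synonym 'k wfun = "bool list \<Rightarrow> 'k"

text \<open>The letters \<open>False\<close> and \<open>True\<close> stand for the two basis vectors.  A function on words is an
  element of the (completed) quantum shuffle algebra; \<open>strip\<close> is the dual of left multiplication by
  a letter, and \<open>insert_letter\<close> is a shuffle product with a letter, weighted by the part of the word
  to the right of the inserted letter.\<close>

definition strip :: "bool \<Rightarrow> 'k wfun \<Rightarrow> 'k wfun" where
  "strip i f w = f (i # w)"

fun insert_letter :: "(bool \<Rightarrow> int \<Rightarrow> int \<Rightarrow> 'k::field) \<Rightarrow> bool \<Rightarrow> 'k wfun \<Rightarrow> 'k wfun" where
  "insert_letter W j f [] = 0"
| "insert_letter W j f (i # w) =
     (if i = j then W j (int (count_list w False)) (int (count_list w True)) * f w else 0)
     + insert_letter W j (\<lambda>v. f (i # v)) w"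

definition delta :: "'k::field wfun" where
  "delta w = (if w = [] then 1 else 0)"

text \<open>Degrees are integers, so that lowering and reflection shift them without side
  conditions; a function of negative degree is zero, see \<open>homog_neg\<close>.\<close>

definition homog :: "int \<Rightarrow> int \<Rightarrow> 'k::field wfun \<Rightarrow> bool" where
  "homog p m f \<longleftrightarrow> (\<forall>w. f w \<noteq> 0 \<longrightarrow> int (count_list w False) = p \<and> int (count_list w True) = m)"

lemma insert_letter_add:
  "insert_letter W j (\<lambda>w. f w + g w) w = insert_letter W j f w + insert_letter W j g w"
  by (induction w arbitrary: f g) (simp_all add: algebra_simps)

lemma insert_letter_scale:
  "insert_letter W j (\<lambda>w. c * f w) w = c * insert_letter W j f w"
  by (induction w arbitrary: f) (simp_all add: algebra_simps)

lemma insert_letter_diff: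
  "insert_letter W j (\<lambda>w. f w - g w) w = insert_letter W j f w - insert_letter W j g w"
  by (induction w arbitrary: f g) (simp_all add: algebra_simps)

lemma insert_letter_zero: "insert_letter W j (\<lambda>w. 0) w = 0"
  by (induction w) simp_all

lemma homog_zero [simp]: "homog p m (\<lambda>w. 0)"
  by (simp add: homog_def)

lemma homog_add: "homog p m f \<Longrightarrow> homog p m g \<Longrightarrow> homog p m (\<lambda>w. f w + g w)"
  unfolding homog_def by (metis add.right_neutral)

lemma homog_diff: "homog p m f \<Longrightarrow> homog p m g \<Longrightarrow> homog p m (\<lambda>w. f w - g w)"
  unfolding homog_def by (metis diff_zero)

lemma homog_scale: "homog p m f \<Longrightarrow> homog p m (\<lambda>w. c * f w)"
  unfolding homog_def by auto

lemma homog_strip: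
  "homog p m f \<Longrightarrow> homog (p - (if i then 0 else 1)) (m - (if i then 1 else 0)) (strip i f)"
  unfolding homog_def strip_def by (fastforce split: if_splits)

lemma homog_insert_letter_aux:
  "insert_letter W j f w \<noteq> 0 \<Longrightarrow> homog p m f \<Longrightarrow>
     int (count_list w False) = p + (if j then 0 else 1) \<and>
     int (count_list w True) = m + (if j then 1 else 0)"
proof (induction W j f w arbitrary: p m rule: insert_letter.induct)
  case (2 W j f i w)
  have h: "homog (p - (if i then 0 else 1)) (m - (if i then 1 else 0)) (\<lambda>v. f (i # v))"
    using homog_strip[OF "2.prems"(2), of i] by (simp add: strip_def[abs_def])
  show ?case
  proof (cases "insert_letter W j (\<lambda>v. f (i # v)) w = 0")
    case True
    then have "i = j" "f w \<noteq> 0" using "2.prems"(1) by (auto split: if_splits)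
    then show ?thesis using "2.prems"(2) by (auto simp: homog_def)
  next
    case False
    from "2.IH"[OF False h] show ?thesis by (auto split: if_splits)
  qed
qed simp

lemma homog_insert_letter:
  "homog p m f \<Longrightarrow>
     homog (p + (if j then 0 else 1)) (m + (if j then 1 else 0)) (insert_letter W j f)"
  unfolding homog_def[of _ _ "insert_letter W j f"] using homog_insert_letter_aux by blast

text \<open>Only an insertion in front is affected by stripping the first letter, and there the part
  to the right of the new letter is the whole word, so the weight is taken at the degree of
  \<open>f\<close>.\<close>

lemma strip_insert_letter:
  assumes "homog p m f"
  shows "strip i (insert_letter W j f) w =
    insert_letter W j (strip i f) w + (if i = j then W j p m * f w else 0)"
  using assms by (auto simp: strip_def[abs_def] homog_def)

section \<open>Commutation relations of the root vectors in rank two\<close>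

locale rank2_braiding =
  fixes a s :: "'k::field"
  assumes a0 [simp]: "a \<noteq> 0" and s0 [simp]: "s \<noteq> 0"
begin

text \<open>The scalar from braiding the letter \<open>i\<close> past a word of degree
  \<open>(p, m)\<close>. It acts as the group-like element K_i of the quantum group.\<close>

definition kappa :: "bool \<Rightarrow> int \<Rightarrow> int \<Rightarrow> 'k" where
  "kappa i p m = (if i then s powi p * a powi m else a powi p * s powi m)"

text \<open>The factor \<open>a\<close> in the second term is the highest weight of the Steinberg module.  It is the
  choice for which the relations are invariant under reflection, see \<open>reflected_relations\<close>.\<close>

definition cartan_weight :: "bool \<Rightarrow> int \<Rightarrow> int \<Rightarrow> 'k" where
  "cartan_weight i p m = inverse (kappa i p m) - a * kappa i p m"

abbreviation raising where "raising \<equiv> insert_letter cartan_weight"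

lemma kappa_nonzero [simp]: "kappa i p m \<noteq> 0"
  by (simp add: kappa_def)

lemma kappa_shift:
  "kappa False (p + 1) m = a * kappa False p m" "kappa False (p - 1) m = kappa False p m / a"
  "kappa False p (m + 1) = s * kappa False p m" "kappa False p (m - 1) = kappa False p m / s"
  "kappa True (p + 1) m = s * kappa True p m" "kappa True (p - 1) m = kappa True p m / s"
  "kappa True p (m + 1) = a * kappa True p m" "kappa True p (m - 1) = kappa True p m / a"
  by (simp_all add: kappa_def power_int_add power_int_diff)

lemma kappa_shift_nat:
  "kappa False (p + int j) m = a ^ j * kappa False p m" "kappa False (p - int j) m = kappa False p m / a ^ j"
  "kappa True (p + int j) m = s ^ j * kappa True p m" "kappa True (p - int j) m = kappa True p m / s ^ j"
  by (simp_all add: kappa_def power_int_add power_int_diff)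

lemma raising_homog [simp]:
  "homog p m f \<Longrightarrow> homog (p + 1) m (raising False f)"
  "homog p m f \<Longrightarrow> homog p (m + 1) (raising True f)"
  using homog_insert_letter[of p m f False cartan_weight] homog_insert_letter[of p m f True cartan_weight] by simp_all

lemma strip_homog [simp]:
  "homog p m f \<Longrightarrow> homog (p - 1) m (strip False f)"
  "homog p m f \<Longrightarrow> homog p (m - 1) (strip True f)"
  using homog_strip[of p m f False] homog_strip[of p m f True] by simp_all

lemmas insert_letter_linear = insert_letter_add insert_letter_scale insert_letter_diff

text \<open>The root vectors \<open>(ad F\<^sub>1)\<^sup>j F\<^sub>2\<close> and \<open>(ad E\<^sub>1)\<^sup>j E\<^sub>2\<close> of the quantum group.\<close>

primrec root_raising :: "nat \<Rightarrow> 'k wfun \<Rightarrow> 'k wfun" where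
  "root_raising 0 f = raising True f"
| "root_raising (Suc j) f = (\<lambda>w. raising False (root_raising j f) w - a ^ j * s * root_raising j (raising False f) w)"

primrec root_lowering :: "nat \<Rightarrow> 'k wfun \<Rightarrow> 'k wfun" where
  "root_lowering 0 f = strip True f"
| "root_lowering (Suc j) f = (\<lambda>w. strip False (root_lowering j f) w - a ^ j * s * root_lowering j (strip False f) w)"

lemma strip_linear:
  "strip i (\<lambda>w. f w + g w) = (\<lambda>w. strip i f w + strip i g w)"
  "strip i (\<lambda>w. f w - g w) = (\<lambda>w. strip i f w - strip i g w)"
  "strip i (\<lambda>w. c * f w) = (\<lambda>w. c * strip i f w)"
  by (simp_all add: strip_def[abs_def])

lemma raising_lin:
  "raising i (\<lambda>w. f w + g w) = (\<lambda>w. raising i f w + raising i g w)"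
  "raising i (\<lambda>w. f w - g w) = (\<lambda>w. raising i f w - raising i g w)"
  "raising i (\<lambda>w. c * f w) = (\<lambda>w. c * raising i f w)"
  by (simp_all add: insert_letter_linear fun_eq_iff)

lemma root_raising_lin:
  "root_raising j (\<lambda>w. f w + g w) = (\<lambda>w. root_raising j f w + root_raising j g w)"
  "root_raising j (\<lambda>w. f w - g w) = (\<lambda>w. root_raising j f w - root_raising j g w)"
  "root_raising j (\<lambda>w. c * f w) = (\<lambda>w. c * root_raising j f w)"
  by (induction j arbitrary: f g) (simp_all add: raising_lin algebra_simps)

lemma root_lowering_lin:
  "root_lowering j (\<lambda>w. f w + g w) = (\<lambda>w. root_lowering j f w + root_lowering j g w)"
  "root_lowering j (\<lambda>w. f w - g w) = (\<lambda>w. root_lowering j f w - root_lowering j g w)"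
  "root_lowering j (\<lambda>w. c * f w) = (\<lambda>w. c * root_lowering j f w)"
  by (induction j arbitrary: f g) (simp_all add: strip_linear algebra_simps)

lemma root_raising_homog [simp]: "homog p m f \<Longrightarrow> homog (p + int j) (m + 1) (root_raising j f)"
proof (induction j arbitrary: p m f)
  case (Suc j)
  have "homog (p + int j + 1) (m + 1) (raising False (root_raising j f))" using Suc by simp
  moreover have "homog (p + 1 + int j) (m + 1) (root_raising j (raising False f))"
    by (rule Suc.IH) (simp add: Suc.prems)
  ultimately show ?case
    unfolding root_raising.simps by (intro homog_diff homog_scale) (simp_all add: add.commute add.left_commute)
qed simp

lemma root_lowering_homog [simp]: "homog p m f \<Longrightarrow> homog (p - int j) (m - 1) (root_lowering j f)"
proof (induction j arbitrary: p m f)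
  case (Suc j)
  have "homog (p - int j - 1) (m - 1) (strip False (root_lowering j f))" using Suc by simp
  moreover have "homog (p - 1 - int j) (m - 1) (root_lowering j (strip False f))"
    by (rule Suc.IH) (simp add: Suc.prems)
  ultimately show ?case
    unfolding root_lowering.simps by (intro homog_diff homog_scale) (simp_all add: algebra_simps)
qed simp

text \<open>The structure constant between E_1 and the root vectors: the summand for
  \<open>r\<close> is what is left of two Cartan weights at the step from \<open>r\<close> to
  \<open>r + 1\<close>.\<close>

definition gamma_coeff :: "nat \<Rightarrow> 'k" where
  "gamma_coeff j = (\<Sum>r<j. inverse (a ^ r * s) - a ^ r * s)"

lemma strip_raising:
  assumes "homog p m f"
  shows "strip i (raising j f) = (\<lambda>w. raising j (strip i f) w + (if i = j then cartan_weight j p m else 0) * f w)"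
  using strip_insert_letter[OF assms, of i cartan_weight j] by auto

text \<open>The coefficient \<open>a ^ j * s\<close> of the skew commutator is chosen so that the
  terms of the two Cartan weights that are proportional to \<open>kappa\<close> cancel. Those with
  the inverse of \<open>kappa\<close> remain and lead back to the preceding root vector.\<close>

lemma strip_False_root_raising:
  assumes "homog p m f"
  shows "strip False (root_raising j f) =
    (\<lambda>w. root_raising j (strip False f) w + gamma_coeff j * inverse (kappa False p m) * root_raising (j - 1) f w)"
  using assms
proof (induction j arbitrary: p m f)
  case 0
  then show ?case by (simp add: strip_raising gamma_coeff_def)
next
  case (Suc j)
  note hf = Suc.prems
  have hY: "homog (p + int j) (m + 1) (root_raising j f)" using hf by simp
  have hF: "homog (p + 1) m (raising False f)" using hf by simp
  let ?x = "kappa False p m"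
  have w1: "cartan_weight False (p + int j) (m + 1) = inverse (a ^ j * s * ?x) - a * (a ^ j * s * ?x)"
    by (simp add: cartan_weight_def kappa_shift kappa_shift_nat mult.commute mult.left_commute)
  have w2: "cartan_weight False p m = inverse ?x - a * ?x" by (simp add: cartan_weight_def)
  have g: "gamma_coeff (Suc j) = gamma_coeff j + (inverse (a ^ j * s) - a ^ j * s)" by (simp add: gamma_coeff_def)
  have IH1: "strip False (root_raising j f) =
    (\<lambda>w. root_raising j (strip False f) w + gamma_coeff j * inverse ?x * root_raising (j - 1) f w)" by (rule Suc.IH[OF hf])
  have IH2: "strip False (root_raising j (raising False f)) =
    (\<lambda>w. root_raising j (strip False (raising False f)) w + gamma_coeff j * inverse (a * ?x) * root_raising (j - 1) (raising False f) w)"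
    using Suc.IH[OF hF] by (simp add: kappa_shift)
  \<comment> \<open>The truncated \<open>j - 1\<close> is harmless at \<open>j = 0\<close>, because
    \<open>gamma_coeff 0 = 0\<close>.\<close>
  have Yj: "gamma_coeff j * root_raising j f w =
      gamma_coeff j * (raising False (root_raising (j - 1) f) w - a ^ (j - 1) * s * root_raising (j - 1) (raising False f) w)" for w
    by (cases j) (simp_all add: gamma_coeff_def)
  have aj: "gamma_coeff j * a ^ j = gamma_coeff j * (a * a ^ (j - 1))"
    by (cases j) (simp_all add: gamma_coeff_def)
  show ?case
  proof
    fix w
    have "strip False (root_raising (Suc j) f) w = strip False (raising False (root_raising j f)) w
        - a ^ j * s * strip False (root_raising j (raising False f)) w"
      by (simp add: strip_linear)
    also have "\<dots> = raising False (root_raising j (strip False f)) w + gamma_coeff j * inverse ?x * raising False (root_raising (j - 1) f) w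
        + (inverse (a ^ j * s * ?x) - a * (a ^ j * s * ?x)) * root_raising j f w
        - a ^ j * s * (root_raising j (raising False (strip False f)) w + (inverse ?x - a * ?x) * root_raising j f w
          + gamma_coeff j * inverse (a * ?x) * root_raising (j - 1) (raising False f) w)"
      by (simp only: strip_raising[OF hY] IH1 IH2 strip_raising[OF hf] raising_lin root_raising_lin w1 w2) simp
    also have "\<dots> = root_raising (Suc j) (strip False f) w
        + inverse ?x * (inverse (a ^ j * s) - a ^ j * s) * root_raising j f w
        + inverse ?x * (gamma_coeff j * raising False (root_raising (j - 1) f) w
           - (gamma_coeff j * a ^ j) * s * inverse a * root_raising (j - 1) (raising False f) w)"
      by (simp add: field_simps)
    also have "gamma_coeff j * raising False (root_raising (j - 1) f) w
           - (gamma_coeff j * a ^ j) * s * inverse a * root_raising (j - 1) (raising False f) w = gamma_coeff j * root_raising j f w"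
      unfolding aj Yj by (simp add: field_simps)
    finally show "strip False (root_raising (Suc j) f) w = root_raising (Suc j) (strip False f) w
        + gamma_coeff (Suc j) * inverse ?x * root_raising (Suc j - 1) f w"
      by (simp add: g algebra_simps)
  qed
qed

definition quantum_nat :: "nat \<Rightarrow> 'k" where
  "quantum_nat t = (\<Sum>r<t. a ^ r)"

lemma quantum_nat_Suc: "quantum_nat (Suc t) = 1 + a * quantum_nat t"
  unfolding quantum_nat_def sum.lessThan_Suc_shift by (simp add: sum_distrib_left)

lemma quantum_nat_Suc': "quantum_nat (Suc t) = quantum_nat t + a ^ t"
  by (simp add: quantum_nat_def)

text \<open>The last factor vanishes under the Cartan condition \<open>a ^ j * s ^ 2 = 1\<close>;
  this is one source of the Serre relations.\<close>

lemma gamma_coeff_eq: "gamma_coeff (Suc j) * (a ^ j * s) = quantum_nat (Suc j) * (1 - a ^ j * s ^ 2)"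
proof (induction j)
  case 0
  show ?case by (simp add: gamma_coeff_def quantum_nat_def field_simps power2_eq_square)
next
  case (Suc j)
  have "gamma_coeff (Suc (Suc j)) * (a ^ Suc j * s) =
      a * (gamma_coeff (Suc j) * (a ^ j * s)) + (1 - (a ^ Suc j * s) ^ 2)"
    by (simp add: gamma_coeff_def field_simps power2_eq_square)
  also have "\<dots> = quantum_nat (Suc (Suc j)) * (1 - a ^ Suc j * s ^ 2)"
    unfolding Suc.IH quantum_nat_Suc'[of "Suc j"]
  proof -
    have 1: "a * quantum_nat (Suc j) = quantum_nat (Suc j) + a ^ Suc j - 1"
      using quantum_nat_Suc[of "Suc j"] quantum_nat_Suc'[of "Suc j"] by (simp add: algebra_simps)
    have 2: "(a - 1) * quantum_nat (Suc j) = a ^ Suc j - 1" using 1 by (simp add: algebra_simps)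
    have "a * (quantum_nat (Suc j) * (1 - a ^ j * s ^ 2)) + (1 - (a ^ Suc j * s) ^ 2)
        - (quantum_nat (Suc j) + a ^ Suc j) * (1 - a ^ Suc j * s ^ 2)
      = (a - 1) * quantum_nat (Suc j) + 1 - a ^ Suc j" 
      by (simp add: algebra_simps power2_eq_square)
    then show "a * (quantum_nat (Suc j) * (1 - a ^ j * s ^ 2)) + (1 - (a ^ Suc j * s) ^ 2)
        = (quantum_nat (Suc j) + a ^ Suc j) * (1 - a ^ Suc j * s ^ 2)"
      using 2 by simp
  qed
  finally show ?case .
qed

lemma raising_pow_homog [simp]: "homog p m f \<Longrightarrow> homog (p + int t) m ((raising False ^^ t) f)"
proof (induction t)
  case (Suc t)
  have "homog (p + int t + 1) m (raising False ((raising False ^^ t) f))" using Suc by simp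
  then show ?case by (simp add: add.commute add.left_commute)
qed simp

text \<open>The rank one computation. In degree zero the bracket is \<open>a / a ^ t - a\<close>, so
  the string through the highest weight vector first breaks when \<open>t\<close> is the order of
  \<open>a\<close>. This is the Steinberg property.\<close>

lemma strip_raising_pow:
  assumes "homog p m f"
  shows "strip False ((raising False ^^ t) f) = (\<lambda>w. (raising False ^^ t) (strip False f) w +
     quantum_nat t * (a / a ^ t * inverse (kappa False p m) - a * kappa False p m) * (raising False ^^ (t - 1)) f w)"
proof (induction t)
  case 0
  show ?case by (simp add: quantum_nat_def)
next
  case (Suc t)
  let ?x = "kappa False p m"
  have hF: "homog (p + int t) m ((raising False ^^ t) f)" using assms by simp
  have w1: "cartan_weight False (p + int t) m = inverse (a ^ t * ?x) - a * (a ^ t * ?x)"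
    by (simp add: cartan_weight_def kappa_shift_nat)
  have q1: "quantum_nat t * raising False ((raising False ^^ (t - 1)) f) w = quantum_nat t * (raising False ^^ t) f w" for w
    by (cases t) (simp_all add: quantum_nat_def)
  have q2: "quantum_nat (Suc t) * (a / a ^ Suc t * inverse ?x - a * ?x) =
     quantum_nat t * (a / a ^ t * inverse ?x - a * ?x) + (inverse (a ^ t * ?x) - a * (a ^ t * ?x))"
  proof -
    have u: "a / a ^ Suc t * inverse ?x = inverse (a ^ t * ?x)"
      "a / a ^ t * inverse ?x = a * inverse (a ^ t * ?x)"
      by (simp_all add: field_simps)
    have "quantum_nat (Suc t) * inverse (a ^ t * ?x) = (1 + a * quantum_nat t) * inverse (a ^ t * ?x)"
      by (simp only: quantum_nat_Suc)
    moreover have "quantum_nat (Suc t) * (a * ?x) = (quantum_nat t + a ^ t) * (a * ?x)"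
      by (simp only: quantum_nat_Suc')
    ultimately show ?thesis
      unfolding u right_diff_distrib by (simp add: algebra_simps)
  qed
  show ?case
  proof
    fix w
    have "strip False ((raising False ^^ Suc t) f) w =
        raising False (strip False ((raising False ^^ t) f)) w
         + (inverse (a ^ t * ?x) - a * (a ^ t * ?x)) * (raising False ^^ t) f w"
      using strip_raising[OF hF, of False False] by (simp add: w1)
    also have "\<dots> = (raising False ^^ Suc t) (strip False f) w
       + (a / a ^ t * inverse ?x - a * ?x) * (quantum_nat t * raising False ((raising False ^^ (t - 1)) f) w)
       + (inverse (a ^ t * ?x) - a * (a ^ t * ?x)) * (raising False ^^ t) f w"
      unfolding Suc.IH raising_lin by simp
    also have "\<dots> = (raising False ^^ Suc t) (strip False f) w
       + (quantum_nat (Suc t) * (a / a ^ Suc t * inverse ?x - a * ?x)) * (raising False ^^ t) f w"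
      unfolding q1 q2 by (simp add: algebra_simps)
    finally show "strip False ((raising False ^^ Suc t) f) w = (raising False ^^ Suc t) (strip False f) w +
     quantum_nat (Suc t) * (a / a ^ Suc t * inverse ?x - a * ?x) * (raising False ^^ (Suc t - 1)) f w"
      by simp
  qed
qed

text \<open>The coefficient of K_1^i K_2 F_1^(j - i) in the commutator of two root vectors. The
  recursion commutes one more E_1 past F_1^(j - i) and keeps the part with a positive power of
  K_1.\<close>

primrec comm_coeff :: "nat \<Rightarrow> nat \<Rightarrow> 'k" where
  "comm_coeff 0 j = - a * (\<Prod>r<j. 1 - a ^ r * s ^ 2)"
| "comm_coeff (Suc i) j = - a * quantum_nat (j - i) * comm_coeff i j"

text \<open>The coefficient of the inverse group-like element, which occurs only for equal indices;
  each factor comes from lowering both indices by one.\<close>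

definition diag_coeff :: "nat \<Rightarrow> 'k" where
  "diag_coeff i = (\<Prod>r<i. - (a ^ r) * s * gamma_coeff (Suc r))"

text \<open>This identity removes the unwanted terms with the inverse of \<open>kappa False\<close>
  in the inductive step of \<open>root_lowering_root_raising\<close>.\<close>

lemma comm_coeff_cancel: "i \<le> j \<Longrightarrow> comm_coeff i (Suc j) * quantum_nat (Suc j - i) = a ^ j * s * gamma_coeff (Suc j) * comm_coeff i j"
proof (induction i)
  case 0
  show ?case using gamma_coeff_eq[of j] by (simp add: mult.commute mult.left_commute)
next
  case (Suc i)
  then have IH: "comm_coeff i (Suc j) * quantum_nat (Suc j - i) = a ^ j * s * gamma_coeff (Suc j) * comm_coeff i j" by simp
  have "comm_coeff (Suc i) (Suc j) * quantum_nat (Suc j - Suc i) = - a * quantum_nat (j - i) * (comm_coeff i (Suc j) * quantum_nat (Suc j - i))"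
    by simp
  also have "\<dots> = a ^ j * s * gamma_coeff (Suc j) * comm_coeff (Suc i) j" unfolding IH by simp
  finally show ?case .
qed

text \<open>Both terms of the Cartan weight are present only for \<open>j = 0\<close>. The first
  skew commutator with F_1 cancels the inverse one, and every commutator multiplies the other by a
  factor \<open>1 - a ^ r * s ^ 2\<close>.\<close>

lemma strip_True_root_raising:
  assumes "homog p m f"
  shows "strip True (root_raising j f) = (\<lambda>w. root_raising j (strip True f) w
     + comm_coeff 0 j * kappa True p m * (raising False ^^ j) f w
     + (if j = 0 then inverse (kappa True p m) * f w else 0))"
  using assms
proof (induction j arbitrary: p m f)
  case 0
  then show ?case by (auto simp: strip_raising cartan_weight_def fun_eq_iff algebra_simps)
next
  case (Suc j)
  note hf = Suc.prems
  have hF: "homog (p + 1) m (raising False f)" using hf by simp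
  have hY: "homog (p + int j) (m + 1) (root_raising j f)" using hf by simp
  have pw: "(raising False ^^ j) (raising False f) = raising False ((raising False ^^ j) f)"
    by (metis comp_apply funpow_Suc_right funpow.simps(2))
  show ?case
  proof
    fix w
    have "strip True (root_raising (Suc j) f) w = strip True (raising False (root_raising j f)) w
        - a ^ j * s * strip True (root_raising j (raising False f)) w"
      by (simp add: strip_linear)
    also have "\<dots> = raising False (strip True (root_raising j f)) w
        - a ^ j * s * (root_raising j (raising False (strip True f)) w
          + comm_coeff 0 j * (s * kappa True p m) * raising False ((raising False ^^ j) f) w
          + (if j = 0 then inverse (s * kappa True p m) * raising False f w else 0))"
      unfolding Suc.IH[OF hF] by (simp only: strip_raising[OF hY] strip_raising[OF hf] kappa_shift pw) simp
    also have "raising False (strip True (root_raising j f)) w = raising False (root_raising j (strip True f)) w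
       + comm_coeff 0 j * kappa True p m * raising False ((raising False ^^ j) f) w
       + (if j = 0 then inverse (kappa True p m) * raising False f w else 0)"
      unfolding Suc.IH[OF hf] by (simp add: raising_lin insert_letter_zero)
    also have "raising False (root_raising j (strip True f)) w
       + comm_coeff 0 j * kappa True p m * raising False ((raising False ^^ j) f) w
       + (if j = 0 then inverse (kappa True p m) * raising False f w else 0)
       - a ^ j * s * (root_raising j (raising False (strip True f)) w
          + comm_coeff 0 j * (s * kappa True p m) * raising False ((raising False ^^ j) f) w
          + (if j = 0 then inverse (s * kappa True p m) * raising False f w else 0))
       = root_raising (Suc j) (strip True f) w + comm_coeff 0 (Suc j) * kappa True p m * (raising False ^^ (Suc j)) f w
         + (if Suc j = 0 then inverse (kappa True p m) * f w else 0)"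
      by (cases "j = 0") (simp_all add: field_simps power2_eq_square)
    finally show "strip True (root_raising (Suc j) f) w = root_raising (Suc j) (strip True f) w
     + comm_coeff 0 (Suc j) * kappa True p m * (raising False ^^ (Suc j)) f w
     + (if Suc j = 0 then inverse (kappa True p m) * f w else 0)" .
  qed
qed

text \<open>In the induction on \<open>i\<close>, one more E_1 meets either the power of F_1 or,
  through \<open>gamma_coeff\<close>, the shorter root vector. The two contributions with inverse
  \<open>kappa False\<close> cancel in front of F_1^(j - i); the diagonal term is inherited from the
  shorter vector alone.\<close>

lemma root_lowering_root_raising:
  assumes "homog p m f" "i \<le> j"
  shows "root_lowering i (root_raising j f) = (\<lambda>w. root_raising j (root_lowering i f) w
     + comm_coeff i j * kappa False p m ^ i * kappa True p m * (raising False ^^ (j - i)) f w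
     + (if i = j then diag_coeff i * inverse (kappa False p m ^ i * kappa True p m) * f w else 0))"
  using assms
proof (induction i arbitrary: j p m f)
  case 0
  then show ?case using strip_True_root_raising[OF 0(1), of j] by (auto simp: diag_coeff_def)
next
  case (Suc i)
  note hf = Suc.prems(1)
  obtain l where j: "j = Suc l" and il: "i \<le> l" using Suc.prems(2) by (cases j) auto
  let ?x = "kappa False p m" and ?y = "kappa True p m"
  have hE: "homog (p - 1) m (strip False f)" using hf by simp
  have hZ: "homog (p - int i) (m - 1) (root_lowering i f)" using hf by simp
  have kz: "kappa False (p - int i) (m - 1) = ?x / a ^ i / s"
    by (simp add: kappa_shift kappa_shift_nat)
  have t: "j - i = Suc (l - i)" using j il by simp
  have 1: "strip False (root_lowering i (root_raising j f)) w = strip False (root_raising j (root_lowering i f)) w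
     + comm_coeff i j * ?x ^ i * ?y * strip False ((raising False ^^ (j - i)) f) w" for w
    using il j unfolding Suc.IH[OF hf, of j, OF Suc_leD[OF Suc.prems(2)]]
    by (simp add: strip_linear)
  have 2: "root_lowering i (strip False (root_raising j f)) w = root_lowering i (root_raising j (strip False f)) w
     + gamma_coeff j * inverse ?x * root_lowering i (root_raising l f) w" for w
    unfolding strip_False_root_raising[OF hf] by (simp add: root_lowering_lin j)
  have 3: "root_lowering i (root_raising j (strip False f)) w = root_raising j (root_lowering i (strip False f)) w
     + comm_coeff i j * (?x / a) ^ i * (?y / s) * (raising False ^^ (j - i)) (strip False f) w" for w
    using il j unfolding Suc.IH[OF hE, of j, OF Suc_leD[OF Suc.prems(2)]] by (simp add: kappa_shift)
  have c: "comm_coeff i j * quantum_nat (Suc (l - i)) = a ^ l * s * gamma_coeff j * comm_coeff i l"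
    using comm_coeff_cancel[OF il] il by (simp add: j Suc_diff_le)
  have al: "a ^ l = a ^ i * a ^ (l - i)" using il by (simp flip: power_add)
  have e: "comm_coeff (Suc i) j = - a * (a ^ l * s * gamma_coeff j * comm_coeff i l)"
    using c t by (simp add: mult.commute mult.left_commute)
  show ?case
  proof
    fix w
    let ?refl_coeffs = "(raising False ^^ (l - i)) f w"
    let ?H = "if i = l then diag_coeff i * inverse (?x ^ i * ?y) * f w else 0"
    have "root_lowering (Suc i) (root_raising j f) w = strip False (root_lowering i (root_raising j f)) w - a ^ i * s * root_lowering i (strip False (root_raising j f)) w"
      by simp
    also have "\<dots> = root_raising j (strip False (root_lowering i f)) w + gamma_coeff j * inverse (?x / a ^ i / s) * root_raising l (root_lowering i f) w
        + comm_coeff i j * ?x ^ i * ?y * ((raising False ^^ (j - i)) (strip False f) w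
            + quantum_nat (Suc (l - i)) * (a / a ^ Suc (l - i) * inverse ?x - a * ?x) * ?refl_coeffs)
        - a ^ i * s * (root_raising j (root_lowering i (strip False f)) w
            + comm_coeff i j * (?x / a) ^ i * (?y / s) * (raising False ^^ (j - i)) (strip False f) w
            + gamma_coeff j * inverse ?x * (root_raising l (root_lowering i f) w + comm_coeff i l * ?x ^ i * ?y * ?refl_coeffs + ?H))"
      unfolding 1 2 3 strip_False_root_raising[OF hZ] strip_raising_pow[OF hf] kz Suc.IH[OF hf il] t by (simp add: j)
    also have "\<dots> = root_raising j (root_lowering (Suc i) f) w
        + (comm_coeff i j * quantum_nat (Suc (l - i))) * ?x ^ i * ?y * (inverse (a ^ (l - i)) * inverse ?x - a * ?x) * ?refl_coeffs
        - a ^ i * s * gamma_coeff j * inverse ?x * comm_coeff i l * ?x ^ i * ?y * ?refl_coeffs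
        - a ^ i * s * gamma_coeff j * inverse ?x * ?H"
      by (simp add: root_raising_lin field_simps)
    also have "\<dots> = root_raising j (root_lowering (Suc i) f) w
        + comm_coeff (Suc i) j * ?x ^ Suc i * ?y * ?refl_coeffs - a ^ i * s * gamma_coeff j * inverse ?x * ?H"
      unfolding c e by (simp add: al field_simps)
    also have "a ^ i * s * gamma_coeff j * inverse ?x * ?H =
        - (if Suc i = j then diag_coeff (Suc i) * inverse (?x ^ Suc i * ?y) * f w else 0)"
      by (simp add: j diag_coeff_def field_simps)
    finally show "root_lowering (Suc i) (root_raising j f) w = root_raising j (root_lowering (Suc i) f) w
       + comm_coeff (Suc i) j * ?x ^ Suc i * ?y * (raising False ^^ (j - Suc i)) f w
       + (if Suc i = j then diag_coeff (Suc i) * inverse (?x ^ Suc i * ?y) * f w else 0)"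
      using il j by simp
  qed
qed

text \<open>The mirror image of \<open>strip_False_root_raising\<close>: here the inverse terms of
  the Cartan weights cancel and those with \<open>kappa\<close> survive.\<close>

lemma root_lowering_raising_False:
  assumes "homog p m f"
  shows "root_lowering j (raising False f) = (\<lambda>w. raising False (root_lowering j f) w - a * gamma_coeff j * kappa False p m * root_lowering (j - 1) f w)"
  using assms
proof (induction j arbitrary: p m f)
  case 0
  then show ?case by (simp add: strip_raising gamma_coeff_def)
next
  case (Suc j)
  note hf = Suc.prems
  let ?x = "kappa False p m"
  have hZ: "homog (p - int j) (m - 1) (root_lowering j f)" using hf by simp
  have hE: "homog (p - 1) m (strip False f)" using hf by simp
  have w1: "cartan_weight False (p - int j) (m - 1) = a ^ j * s * inverse ?x - a * (?x / (a ^ j * s))"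
    by (simp add: cartan_weight_def kappa_shift kappa_shift_nat field_simps)
  have w2: "cartan_weight False p m = inverse ?x - a * ?x" by (simp add: cartan_weight_def)
  have g: "gamma_coeff (Suc j) = gamma_coeff j + (inverse (a ^ j * s) - a ^ j * s)" by (simp add: gamma_coeff_def)
  have Zj: "gamma_coeff j * root_lowering j f w =
      gamma_coeff j * (strip False (root_lowering (j - 1) f) w - a ^ (j - 1) * s * root_lowering (j - 1) (strip False f) w)" for w
    by (cases j) (simp_all add: gamma_coeff_def)
  have aj: "gamma_coeff j * a ^ j = gamma_coeff j * (a * a ^ (j - 1))"
    by (cases j) (simp_all add: gamma_coeff_def)
  show ?case
  proof
    fix w
    have "root_lowering (Suc j) (raising False f) w = strip False (raising False (root_lowering j f)) w
         - a * gamma_coeff j * ?x * strip False (root_lowering (j - 1) f) w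
         - a ^ j * s * (root_lowering j (raising False (strip False f)) w + (inverse ?x - a * ?x) * root_lowering j f w)"
      by (simp add: Suc.IH[OF hf] strip_raising[OF hf] w2 strip_linear root_lowering_lin)
    also have "\<dots> = raising False (strip False (root_lowering j f)) w
         + (a ^ j * s * inverse ?x - a * (?x / (a ^ j * s))) * root_lowering j f w
         - a * gamma_coeff j * ?x * strip False (root_lowering (j - 1) f) w
         - a ^ j * s * (raising False (root_lowering j (strip False f)) w
             - a * gamma_coeff j * (?x / a) * root_lowering (j - 1) (strip False f) w + (inverse ?x - a * ?x) * root_lowering j f w)"
      by (simp add: Suc.IH[OF hE] strip_raising[OF hZ] w1 kappa_shift)
    also have "\<dots> = raising False (root_lowering (Suc j) f) w
         - a * (inverse (a ^ j * s) - a ^ j * s) * ?x * root_lowering j f w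
         - a * ?x * (gamma_coeff j * strip False (root_lowering (j - 1) f) w
            - (gamma_coeff j * a ^ j) * s / a * root_lowering (j - 1) (strip False f) w)"
      by (simp add: raising_lin field_simps)
    also have "gamma_coeff j * strip False (root_lowering (j - 1) f) w
            - (gamma_coeff j * a ^ j) * s / a * root_lowering (j - 1) (strip False f) w = gamma_coeff j * root_lowering j f w"
      unfolding aj Zj by (simp add: field_simps)
    finally show "root_lowering (Suc j) (raising False f) w = raising False (root_lowering (Suc j) f) w
         - a * gamma_coeff (Suc j) * ?x * root_lowering (Suc j - 1) f w"
      by (simp add: g algebra_simps)
  qed
qed

text \<open>The counterpart of \<open>strip_True_root_raising\<close> with the roles of the two
  Cartan terms exchanged. At \<open>j = k + 1\<close> the product contains the factor
  \<open>1 - a ^ k * s ^ 2\<close>, as \<open>serre_lowering\<close> needs.\<close>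

lemma root_lowering_raising_True:
  assumes "homog p m f"
  shows "root_lowering j (raising True f) = (\<lambda>w. raising True (root_lowering j f) w
     + (\<Prod>r<j. 1 - a ^ r * s ^ 2) * inverse (kappa True p m) * (strip False ^^ j) f w
     - (if j = 0 then a * kappa True p m * f w else 0))"
  using assms
proof (induction j arbitrary: p m f)
  case 0
  then show ?case
    by (simp add: strip_raising fun_eq_iff cartan_weight_def[of True p m] algebra_simps)
next
  case (Suc j)
  note hf = Suc.prems
  have hE: "homog (p - 1) m (strip False f)" using hf by simp
  have hZ: "homog (p - int j) (m - 1) (root_lowering j f)" using hf by simp
  have pw: "(strip False ^^ j) (strip False f) = strip False ((strip False ^^ j) f)"
    by (metis comp_apply funpow_Suc_right funpow.simps(2))
  show ?case
  proof
    fix w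
    have "root_lowering (Suc j) (raising True f) w = strip False (root_lowering j (raising True f)) w
        - a ^ j * s * root_lowering j (raising True (strip False f)) w"
      by (simp add: strip_raising[OF hf])
    also have "strip False (root_lowering j (raising True f)) w = raising True (strip False (root_lowering j f)) w
       + (\<Prod>r<j. 1 - a ^ r * s ^ 2) * inverse (kappa True p m) * strip False ((strip False ^^ j) f) w
       - (if j = 0 then a * kappa True p m * strip False f w else 0)"
      unfolding Suc.IH[OF hf] using strip_raising[OF hZ, of False True] by (auto simp add: strip_linear) (simp add: strip_def)
    also have "root_lowering j (raising True (strip False f)) w = raising True (root_lowering j (strip False f)) w
       + (\<Prod>r<j. 1 - a ^ r * s ^ 2) * inverse (kappa True p m / s) * strip False ((strip False ^^ j) f) w
       - (if j = 0 then a * (kappa True p m / s) * strip False f w else 0)"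
      unfolding Suc.IH[OF hE] kappa_shift pw ..
    also have "raising True (strip False (root_lowering j f)) w
       + (\<Prod>r<j. 1 - a ^ r * s ^ 2) * inverse (kappa True p m) * strip False ((strip False ^^ j) f) w
       - (if j = 0 then a * kappa True p m * strip False f w else 0)
       - a ^ j * s * (raising True (root_lowering j (strip False f)) w
       + (\<Prod>r<j. 1 - a ^ r * s ^ 2) * inverse (kappa True p m / s) * strip False ((strip False ^^ j) f) w
       - (if j = 0 then a * (kappa True p m / s) * strip False f w else 0))
       = raising True (root_lowering (Suc j) f) w
     + (\<Prod>r<Suc j. 1 - a ^ r * s ^ 2) * inverse (kappa True p m) * (strip False ^^ Suc j) f w
     - (if Suc j = 0 then a * kappa True p m * f w else 0)"
      by (cases "j = 0") (simp_all add: raising_lin field_simps power2_eq_square)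
    finally show "root_lowering (Suc j) (raising True f) w = raising True (root_lowering (Suc j) f) w
     + (\<Prod>r<Suc j. 1 - a ^ r * s ^ 2) * inverse (kappa True p m) * (strip False ^^ Suc j) f w
     - (if Suc j = 0 then a * kappa True p m * f w else 0)" .
  qed
qed

end

section \<open>The reflected operators\<close>

context rank2_braiding
begin

inductive steinberg :: "int \<Rightarrow> int \<Rightarrow> 'k wfun \<Rightarrow> bool" where
  delta: "steinberg 0 0 delta"
| zero: "steinberg p m (\<lambda>w. 0)"
| add: "steinberg p m f \<Longrightarrow> steinberg p m g \<Longrightarrow> steinberg p m (\<lambda>w. f w + g w)"
| scale: "steinberg p m f \<Longrightarrow> steinberg p m (\<lambda>w. c * f w)"
| ins: "steinberg p m f \<Longrightarrow> steinberg (p + (if j then 0 else 1)) (m + (if j then 1 else 0)) (raising j f)"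

lemma steinberg_homog: "steinberg p m f \<Longrightarrow> homog p m f"
proof (induction rule: steinberg.induct)
  case delta
  then show ?case by (simp add: homog_def delta_def)
next
  case (add p m f g)
  then show ?case by (intro homog_add)
next
  case (scale p m f c)
  then show ?case by (intro homog_scale)
next
  case (ins p m f j)
  then show ?case by (intro homog_insert_letter)
qed simp

lemma steinberg_diff: "steinberg p m f \<Longrightarrow> steinberg p m g \<Longrightarrow> steinberg p m (\<lambda>w. f w - g w)"
  using steinberg.add[of p m f "\<lambda>w. (-1) * g w"] steinberg.scale[of p m g "-1"] by simp

lemma steinberg_raising:
  "steinberg p m f \<Longrightarrow> steinberg (p + 1) m (raising False f)" "steinberg p m f \<Longrightarrow> steinberg p (m + 1) (raising True f)"
  using steinberg.ins[of p m f False] steinberg.ins[of p m f True] by simp_all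

text \<open>The commutation relation moves \<open>strip\<close> inward past the raising operators
  until it reaches \<open>delta\<close>, which it kills. So closure under lowering follows from
  closure under raising.\<close>

lemma steinberg_strip:
  "steinberg p m f \<Longrightarrow> steinberg (p - (if i then 0 else 1)) (m - (if i then 1 else 0)) (strip i f)"
proof (induction rule: steinberg.induct)
  case delta
  have "strip i delta = (\<lambda>w. 0 :: 'k)" by (simp add: strip_def[abs_def] delta_def)
  then show ?case by (simp only: steinberg.zero)
next
  case (zero p m)
  have "strip i (\<lambda>w. 0) = (\<lambda>w. 0 :: 'k)" by (simp add: strip_def[abs_def])
  then show ?case by (simp only: steinberg.zero)
next
  case (add p m f g)
  then show ?case unfolding strip_linear by (intro steinberg.add)
next
  case (scale p m f c)
  then show ?case unfolding strip_linear by (intro steinberg.scale)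
next
  case (ins p m f j)
  let ?p = "p + (if j then 0 else 1) - (if i then 0 else 1)"
  let ?m = "m + (if j then 1 else 0) - (if i then 1 else 0)"
  have 1: "steinberg ?p ?m (raising j (strip i f))"
    using steinberg.ins[OF ins.IH, of j] by (simp add: algebra_simps)
  have 2: "steinberg ?p ?m (\<lambda>w. (if i = j then cartan_weight j p m else 0) * f w)"
  proof (cases "i = j")
    case True
    then show ?thesis using steinberg.scale[OF ins.hyps, of "cartan_weight j p m"] by simp
  next
    case False
    then show ?thesis using steinberg.zero by simp
  qed
  show ?case unfolding strip_raising[OF steinberg_homog[OF ins.hyps]] using steinberg.add[OF 1 2] by simp
qed

lemma steinberg_strip_letter:
  "steinberg p m f \<Longrightarrow> steinberg (p - 1) m (strip False f)" "steinberg p m f \<Longrightarrow> steinberg p (m - 1) (strip True f)"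
  using steinberg_strip[of p m f False] steinberg_strip[of p m f True] by simp_all

lemma steinberg_root_raising: "steinberg p m f \<Longrightarrow> steinberg (p + int j) (m + 1) (root_raising j f)"
proof (induction j arbitrary: p m f)
  case 0
  then show ?case by (simp add: steinberg_raising)
next
  case (Suc j)
  have 1: "steinberg (p + int (Suc j)) (m + 1) (raising False (root_raising j f))"
    using steinberg_raising(1)[OF Suc.IH[OF Suc.prems]] by (simp add: algebra_simps)
  have 2: "steinberg (p + int (Suc j)) (m + 1) (root_raising j (raising False f))"
    using Suc.IH[OF steinberg_raising(1)[OF Suc.prems]] by (simp add: algebra_simps)
  show ?case unfolding root_raising.simps by (intro steinberg_diff steinberg.scale 1 2)
qed

lemma steinberg_root_lowering: "steinberg p m f \<Longrightarrow> steinberg (p - int j) (m - 1) (root_lowering j f)"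
proof (induction j arbitrary: p m f)
  case 0
  then show ?case by (simp add: steinberg_strip_letter)
next
  case (Suc j)
  have 1: "steinberg (p - int (Suc j)) (m - 1) (strip False (root_lowering j f))"
    using steinberg_strip_letter(1)[OF Suc.IH[OF Suc.prems]] by (simp add: algebra_simps)
  have 2: "steinberg (p - int (Suc j)) (m - 1) (root_lowering j (strip False f))"
    using Suc.IH[OF steinberg_strip_letter(1)[OF Suc.prems]] by (simp add: algebra_simps)
  show ?case unfolding root_lowering.simps by (intro steinberg_diff steinberg.scale 1 2)
qed

lemma homog_neg: "homog p m f \<Longrightarrow> p < 0 \<or> m < 0 \<Longrightarrow> f = (\<lambda>w. 0)"
  unfolding homog_def by (metis of_nat_less_0_iff ext)

lemma raising_zero: "raising j (\<lambda>w. 0) = (\<lambda>w. 0)"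
  by (simp add: insert_letter_zero fun_eq_iff)

lemma strip_zero: "strip j (\<lambda>w. 0) = (\<lambda>w. 0)"
  by (simp add: strip_def[abs_def])

lemma root_raising_zero: "root_raising j (\<lambda>w. 0) = (\<lambda>w. 0)"
  by (induction j) (simp_all add: raising_zero)

lemma root_lowering_zero: "root_lowering j (\<lambda>w. 0) = (\<lambda>w. 0)"
  by (induction j) (simp_all add: strip_zero)

lemma root_raising_Nil: "root_raising j f [] = 0"
  by (induction j arbitrary: f) simp_all

text \<open>Both diagonal entries of the braiding are \<open>a\<close> and both off-diagonal entries
  are \<open>s\<close>, so exchanging the two letters preserves all weights.\<close>

lemma raising_swap: "raising j f (map Not w) = raising (\<not> j) (\<lambda>v. f (map Not v)) w"
proof (induction w arbitrary: f)
  case (Cons i w)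
  have c: "count_list (map Not w) b = count_list w (\<not> b)" for b
    by (induction w) auto
  have "cartan_weight j (int (count_list w True)) (int (count_list w False)) =
      cartan_weight (\<not> j) (int (count_list w False)) (int (count_list w True))"
    by (auto simp: cartan_weight_def kappa_def mult.commute)
  then show ?case using Cons[of "\<lambda>v. f ((\<not> i) # v)"] by (auto simp: c)
qed simp

lemma steinberg_swap: "steinberg p m f \<Longrightarrow> steinberg m p (\<lambda>w. f (map Not w))"
proof (induction rule: steinberg.induct)
  case delta
  have "(\<lambda>w. delta (map Not w) :: 'k) = delta" by (simp add: delta_def fun_eq_iff)
  then show ?case by (simp only: steinberg.delta)
next
  case (ins p m f j)
  then show ?case using steinberg.ins[OF ins.IH, of "\<not> j"] by (cases j) (simp_all add: raising_swap)
qed (auto intro: steinberg.intros)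

end

section \<open>The Cartan condition and the Serre relations\<close>

locale rank2_cartan = rank2_braiding a s for a s :: "'k::field" +
  fixes N k :: nat
  assumes N2: "N \<ge> 2" and aN: "a ^ N = 1" and a_prim: "\<And>t. 0 < t \<Longrightarrow> t < N \<Longrightarrow> a ^ t \<noteq> 1"
    and kN: "k < N" and aks: "a ^ k * s ^ 2 = 1"
begin

lemma comm_coeff_k: "comm_coeff 0 (Suc k) = 0"
  using aks by simp

lemma gamma_coeff_k: "gamma_coeff (Suc k) = 0"
  using gamma_coeff_eq[of k] aks by simp

lemma quantum_nat_geometric: "(a - 1) * quantum_nat t = a ^ t - 1"
  unfolding quantum_nat_def by (simp add: power_diff_1_eq)

lemma a1: "a \<noteq> 1"
  using a_prim[of 1] N2 by simp

lemma quantum_nat_N: "quantum_nat N = 0"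
  using quantum_nat_geometric[of N] a1 aN by simp

lemma quantum_nat_nonzero: "0 < t \<Longrightarrow> t < N \<Longrightarrow> quantum_nat t \<noteq> 0"
  using quantum_nat_geometric[of t] a_prim by auto

text \<open>If \<open>a ^ j * s ^ 2 = 1\<close> held for some \<open>j\<close> below
  \<open>k\<close>, then \<open>a ^ (k - j) = 1\<close> with \<open>k - j\<close> smaller than the
  order of \<open>a\<close>. The lemma makes \<open>refl_const\<close> invertible.\<close>

lemma gamma_coeff_nonzero: "j < k \<Longrightarrow> gamma_coeff (Suc j) \<noteq> 0"
proof -
  assume j: "j < k"
  have "1 - a ^ j * s ^ 2 \<noteq> 0"
  proof
    assume "1 - a ^ j * s ^ 2 = 0"
    then have "a ^ j * s ^ 2 = a ^ k * s ^ 2" using aks by simp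
    then have "a ^ j = a ^ k" by simp
    moreover have "a ^ k = a ^ j * a ^ (k - j)" using j by (simp flip: power_add)
    ultimately have "a ^ (k - j) = 1" by simp
    then show False using a_prim[of "k - j"] j kN by simp
  qed
  then have "gamma_coeff (Suc j) * (a ^ j * s) \<noteq> 0" unfolding gamma_coeff_eq using quantum_nat_nonzero[of "Suc j"] j kN by simp
  then show ?thesis by auto
qed

text \<open>Under the Cartan condition this root vector commutes with both operators
  \<open>strip\<close>, so its value at a word reduces letter by letter to the empty word, where it
  is zero. Hence it kills every homogeneous function.\<close>

lemma serre_raising: "homog p m f \<Longrightarrow> root_raising (Suc k) f w = 0"
proof (induction w arbitrary: p m f)
  case Nil
  show ?case by (rule root_raising_Nil)
next
  case (Cons i w)
  have "strip i (root_raising (Suc k) f) w = 0"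
  proof (cases i)
    case True
    then show ?thesis
      using strip_True_root_raising[OF Cons.prems, of "Suc k"] Cons.IH[OF strip_homog(2)[OF Cons.prems]] comm_coeff_k
      by (simp del: root_raising.simps comm_coeff.simps)
  next
    case False
    then show ?thesis
      using strip_False_root_raising[OF Cons.prems, of "Suc k"] Cons.IH[OF strip_homog(1)[OF Cons.prems]] gamma_coeff_k
      by (simp del: root_raising.simps)
  qed
  then show ?case by (simp only: strip_def)
qed

lemma root_lowering_delta: "root_lowering (Suc j) delta = (\<lambda>w. 0)"
proof -
  have "homog (0 - int (Suc j)) (0 - 1) (root_lowering (Suc j) delta)"
    by (rule root_lowering_homog) (rule steinberg_homog[OF steinberg.delta])
  from homog_neg[OF this] show ?thesis by simp
qed

text \<open>The dual argument: the operator commutes with both raising operators and kills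
  \<open>delta\<close>, hence all that \<open>delta\<close> generates. Here membership in the module
  is essential.\<close>

lemma serre_lowering: "steinberg p m f \<Longrightarrow> root_lowering (Suc k) f = (\<lambda>w. 0)"
proof (induction rule: steinberg.induct)
  case (ins p m f j)
  note h = steinberg_homog[OF ins.hyps]
  have "(\<Prod>r<Suc k. 1 - a ^ r * s ^ 2) = 0" using aks by simp
  then show ?case
    using root_lowering_raising_False[OF h, of "Suc k"] root_lowering_raising_True[OF h, of "Suc k"] ins.IH gamma_coeff_k
    by (cases j) (simp_all only: raising_zero, simp_all)
next
  case delta
  show ?case by (rule root_lowering_delta)
next
  case (zero p m)
  show ?case by (rule root_lowering_zero)
next
  case (add p m f g)
  then show ?case by (simp only: root_lowering_lin) simp
next
  case (scale p m f c)
  then show ?case by (simp only: root_lowering_lin) simp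
qed

definition twist :: "'k wfun \<Rightarrow> 'k wfun" where
  "twist f w = kappa True (int (count_list w False)) (int (count_list w True)) * f w"

definition untwist :: "'k wfun \<Rightarrow> 'k wfun" where
  "untwist f w = inverse (kappa True (int (count_list w False)) (int (count_list w True))) * f w"

lemma twist_homog: "homog p m f \<Longrightarrow> twist f = (\<lambda>w. kappa True p m * f w)"
  "homog p m f \<Longrightarrow> untwist f = (\<lambda>w. inverse (kappa True p m) * f w)"
  by (auto simp: twist_def[abs_def] untwist_def[abs_def] homog_def fun_eq_iff)

lemma comm_coeff_diag: "comm_coeff i i = - (a ^ (i + 1)) * diag_coeff i"
proof (induction i)
  case 0
  show ?case by (simp add: diag_coeff_def)
next
  case (Suc i)
  have "comm_coeff (Suc i) (Suc i) = - a * (comm_coeff i (Suc i) * quantum_nat (Suc i - i))" by simp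
  also have "\<dots> = - a * (a ^ i * s * gamma_coeff (Suc i) * comm_coeff i i)"
    using comm_coeff_cancel[of i i] by simp
  finally show ?case unfolding Suc.IH by (simp add: diag_coeff_def)
qed

text \<open>Chosen to make the commutator of the reflected operators for \<open>True\<close> equal
  to a Cartan weight. \<open>s ^ k * a\<close> is the change of \<open>kappa True\<close> along the
  root \<alpha>2 + k \<alpha>1, \<open>diag_coeff k\<close> is the coefficient in the commutator of
  the root vectors, and \<open>s ^ (N + 1)\<close> comes from
  \<open>kappa_refl_degree\<close>.\<close>

definition refl_const :: 'k where
  "refl_const = s ^ k * a * diag_coeff k * inverse (s ^ (N + 1))"

lemma refl_const_nonzero: "refl_const \<noteq> 0"
  using gamma_coeff_nonzero by (auto simp: refl_const_def diag_coeff_def)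

text \<open>The Chevalley operators for the simple roots \<open>-\<alpha>\<^sub>1\<close> and \<open>\<alpha>\<^sub>2 + k \<alpha>\<^sub>1\<close>.  The twists by
  \<open>kappa\<close> turn the Serre relations, which are skew commutators, into commutators.\<close>

fun refl_lowering :: "bool \<Rightarrow> 'k wfun \<Rightarrow> 'k wfun" where
  "refl_lowering False f = raising False f"
| "refl_lowering True f = (\<lambda>w. inverse refl_const * root_lowering k (twist f) w)"

fun refl_raising :: "bool \<Rightarrow> 'k wfun \<Rightarrow> 'k wfun" where
  "refl_raising False f = strip False f"
| "refl_raising True f = root_raising k (untwist f)"

text \<open>The coefficient of \<open>lowest_vector\<close> in the images of \<open>x\<close> under all words in the reflected
  lowering operators.  In these coordinates the reflected operators become the original ones.\<close>

fun refl_coeffs :: "'k wfun \<Rightarrow> 'k wfun" where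
  "refl_coeffs x [] = x (replicate (N - 1) False)"
| "refl_coeffs x (i # w) = refl_coeffs (refl_lowering i x) w"

lemma refl_lowering_lin:
  "refl_lowering i (\<lambda>w. f w + g w) = (\<lambda>w. refl_lowering i f w + refl_lowering i g w)"
  "refl_lowering i (\<lambda>w. c * f w) = (\<lambda>w. c * refl_lowering i f w)"
proof -
  have "twist (\<lambda>w. f w + g w) = (\<lambda>w. twist f w + twist g w)" "twist (\<lambda>w. c * f w) = (\<lambda>w. c * twist f w)"
    by (simp_all add: twist_def[abs_def] algebra_simps)
  then show "refl_lowering i (\<lambda>w. f w + g w) = (\<lambda>w. refl_lowering i f w + refl_lowering i g w)"
    "refl_lowering i (\<lambda>w. c * f w) = (\<lambda>w. c * refl_lowering i f w)"
    by (cases i; simp add: raising_lin root_lowering_lin algebra_simps)+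
qed

lemma refl_coeffs_lin:
  "refl_coeffs (\<lambda>w. f w + g w) v = refl_coeffs f v + refl_coeffs g v"
  "refl_coeffs (\<lambda>w. c * f w) v = c * refl_coeffs f v"
  by (induction v arbitrary: f g) (simp_all add: refl_lowering_lin)

lemma refl_coeffs_zero: "refl_coeffs (\<lambda>w. 0) v = 0"
  using refl_coeffs_lin(2)[of 0 "\<lambda>w. 0" v] by simp

lemma steinberg_refl_lowering:
  "steinberg p m f \<Longrightarrow> steinberg (p + (if i then - int k else 1)) (m - (if i then 1 else 0)) (refl_lowering i f)"
proof (cases i)
  case True
  assume f: "steinberg p m f"
  have "steinberg (p - int k) (m - 1) (root_lowering k (twist f))"
    using steinberg_root_lowering[OF steinberg.scale[OF f]] twist_homog(1)[OF steinberg_homog[OF f]] by simp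
  then show ?thesis using True steinberg.scale by simp
qed (simp add: steinberg_raising)

lemma steinberg_refl_raising:
  "steinberg p m f \<Longrightarrow> steinberg (p + (if i then int k else - 1)) (m + (if i then 1 else 0)) (refl_raising i f)"
proof (cases i)
  case True
  assume f: "steinberg p m f"
  have "steinberg (p + int k) (m + 1) (root_raising k (untwist f))"
    using steinberg_root_raising[OF steinberg.scale[OF f]] twist_homog(2)[OF steinberg_homog[OF f]] by simp
  then show ?thesis using True by simp
next
  case False
  assume f: "steinberg p m f"
  then show ?thesis using False steinberg_strip_letter(1)[OF f] by simp
qed

text \<open>The degree \<open>(p, m)\<close> in terms of the reflected simple roots and the new highest weight vector;
  this map is an involution.\<close>

abbreviation refl_degree :: "int \<Rightarrow> int \<Rightarrow> int" where
  "refl_degree p m \<equiv> int N - 1 - p + int k * m"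

text \<open>The \<open>N\<close>-th power of the Cartan condition shows that \<open>s ^ N\<close> is
  1 or -1; this sign is carried along in \<open>s ^ (N + 1)\<close>.\<close>

lemma s_power_square: "s ^ (N + 1) * s ^ (N + 1) = s ^ 2"
proof -
  have "1 = (a ^ k * s ^ 2) ^ N" by (simp add: aks)
  also have "\<dots> = (a ^ N) ^ k * (s ^ N * s ^ N)"
    unfolding power_mult_distrib
    by (metis mult.commute power2_eq_square power_mult power_mult_distrib)
  finally have "s ^ N * s ^ N = 1" by (simp add: aN)
  then show ?thesis by (simp add: power2_eq_square algebra_simps)
qed

text \<open>The first identity says that reflection inverts K_1, up to the factor \<open>a\<close>;
  this swaps the two terms of the Cartan weight and so changes its sign. The second identifies K_1^k
  K_2 with the group-like element of the reflected root, up to the factor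
  \<open>s ^ (N + 1)\<close>.\<close>

lemma kappa_refl_degree:
  "kappa False (refl_degree p m) m = inverse (a * kappa False p m)"
  "kappa False p m ^ k * kappa True p m = s ^ (N + 1) * kappa True (refl_degree p m) m"
proof -
  have ak: "a ^ k = inverse (s ^ 2)" using aks by (simp add: field_simps)
  have akm: "a powi (int k * m) = inverse ((s ^ 2) powi m)"
    by (simp add: power_int_mult ak power_int_inverse)
  have s2m: "(s ^ 2) powi m = s powi m * s powi m"
    by (simp add: power2_eq_square power_int_mult_distrib)
  have "kappa False (refl_degree p m) m = a powi (int N) / a / a powi p * a powi (int k * m) * s powi m"
    by (simp add: kappa_def power_int_add power_int_diff)
  also have "\<dots> = inverse a * inverse (a powi p) * inverse (s powi m)"
    unfolding akm s2m by (simp add: aN field_simps)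
  also have "\<dots> = inverse (a * kappa False p m)" by (simp add: kappa_def)
  finally show "kappa False (refl_degree p m) m = inverse (a * kappa False p m)" .
  have akp: "(a powi p) ^ k = inverse (s powi p * s powi p)"
  proof -
    have "(a powi p) ^ k = (a ^ k) powi p"
      by (metis mult.commute power_int_mult power_int_of_nat)
    also have "\<dots> = inverse (s powi p * s powi p)"
      by (simp add: ak power_int_inverse power2_eq_square power_int_mult_distrib)
    finally show ?thesis .
  qed
  have skm: "s powi (int k * m) = (s powi m) ^ k"
    by (metis mult.commute power_int_mult power_int_of_nat)
  have e1: "kappa True (refl_degree p m) m = s ^ N / s / s powi p * (s powi m) ^ k * a powi m"
    unfolding skm[symmetric] by (simp add: kappa_def power_int_add power_int_diff)
  have e2: "kappa False p m ^ k * kappa True p m = inverse (s powi p) * (s powi m) ^ k * a powi m"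
    by (simp add: kappa_def power_mult_distrib akp field_simps)
  have "s ^ (N + 1) * kappa True (refl_degree p m) m = s ^ N * s ^ N * (inverse (s powi p) * (s powi m) ^ k * a powi m)"
    unfolding e1 by (simp add: field_simps)
  also have "s ^ N * s ^ N = 1" using s_power_square by (simp add: power2_eq_square)
  finally show "kappa False p m ^ k * kappa True p m = s ^ (N + 1) * kappa True (refl_degree p m) m"
    unfolding e2 by simp
qed

text \<open>The mixed cases are the two Serre relations. For \<open>False\<close> the operators E_1
  and F_1 trade places, which matches the sign change of the Cartan weight. For \<open>True\<close>
  the commutator of the two \<open>k\<close>-th root vectors is used, where
  \<open>comm_coeff_diag\<close> relates its two coefficients.\<close>

lemma reflected_relations:
  assumes x: "steinberg p m x"
  shows "refl_lowering i (refl_raising l x) =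
    (\<lambda>w. refl_raising l (refl_lowering i x) w + (if i = l then cartan_weight i (refl_degree p m) m else 0) * x w)"
proof -
  note h = steinberg_homog[OF x]
  have hE: "homog (p - 1) m (strip False x)" and hF: "homog (p + 1) m (raising False x)"
    using h by simp_all
  have hY: "homog (p + int k) (m + 1) (root_raising k x)" and hZ: "homog (p - int k) (m - 1) (root_lowering k x)"
    using h by simp_all
  \<comment> \<open>In the mixed cases the Serre coefficient \<open>a ^ k * s\<close> is compared
    with the factor \<open>inverse s\<close> that the twist picks up from E_1 or F_1; their equality
    turns skew commutation into commutation.\<close>
  have ask: "a ^ k * s = inverse s" using aks by (simp add: field_simps power2_eq_square)
  have K2Y: "twist (\<lambda>w. c * root_raising k x w) = (\<lambda>w. kappa True (p + int k) (m + 1) * (c * root_raising k x w))" for c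
    by (rule twist_homog) (intro homog_scale hY)
  have K2Z: "untwist (\<lambda>w. c * root_lowering k x w) =
      (\<lambda>w. inverse (kappa True (p - int k) (m - 1)) * (c * root_lowering k x w))" for c
    by (rule twist_homog) (intro homog_scale hZ)
  consider "\<not> i" "\<not> l" | "\<not> i" l | i "\<not> l" | i l by blast
  then show ?thesis
  proof cases
    case 1
    have "cartan_weight False (refl_degree p m) m = - cartan_weight False p m"
      unfolding cartan_weight_def[of False] kappa_refl_degree by (simp add: field_simps)
    then show ?thesis using 1 by (simp add: strip_raising[OF h])
  next
    case 2
    have "raising False (root_raising k x) w = a ^ k * s * root_raising k (raising False x) w" for w
      using serre_raising[OF h, of w] by simp
    then show ?thesis
      using 2 by (simp add: twist_homog[OF h] twist_homog[OF hF] root_raising_lin raising_lin kappa_shift ask)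
        (simp add: ac_simps)
  next
    case 3
    have "strip False (root_lowering k x) w = a ^ k * s * root_lowering k (strip False x) w" for w
      using fun_cong[OF serre_lowering[OF x], of w] by simp
    then show ?thesis
      using 3 by (simp add: twist_homog[OF h] twist_homog[OF hE] root_lowering_lin strip_linear kappa_shift ask
          divide_inverse del: times_divide_eq_left) (simp add: ac_simps)
  next
    case 4
    let ?u = "kappa False p m ^ k * kappa True p m" and ?v = "kappa True (refl_degree p m) m"
    have c: "comm_coeff k k = - (a ^ (k + 1)) * diag_coeff k" by (rule comm_coeff_diag)
    have REx: "refl_lowering True x = (\<lambda>w. (inverse refl_const * kappa True p m) * root_lowering k x w)"
      by (simp add: twist_homog[OF h] root_lowering_lin mult.assoc)
    have RFx: "refl_raising True x = (\<lambda>w. inverse (kappa True p m) * root_raising k x w)"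
      by (simp add: twist_homog[OF h] root_raising_lin)
    have "refl_lowering True (refl_raising True x) w = inverse refl_const * (kappa True (p + int k) (m + 1) *
        (inverse (kappa True p m) * root_lowering k (root_raising k x) w))" for w
      unfolding RFx refl_lowering.simps K2Y root_lowering_lin ..
    moreover have "refl_raising True (refl_lowering True x) w = inverse (kappa True (p - int k) (m - 1)) *
        ((inverse refl_const * kappa True p m) * root_raising k (root_lowering k x) w)" for w
      unfolding REx refl_raising.simps K2Z root_raising_lin ..
    ultimately have "refl_lowering True (refl_raising True x) w - refl_raising True (refl_lowering True x) w =
        inverse refl_const * (s ^ k * a) * (root_lowering k (root_raising k x) w - root_raising k (root_lowering k x) w)" for w
      unfolding kappa_shift kappa_shift_nat by (simp add: field_simps refl_const_nonzero)
    moreover have "root_lowering k (root_raising k x) w - root_raising k (root_lowering k x) w = diag_coeff k * (inverse ?u - a ^ (k + 1) * ?u) * x w" for w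
      by (simp add: root_lowering_root_raising[OF h, of k k] c algebra_simps)
    ultimately have "refl_lowering True (refl_raising True x) w - refl_raising True (refl_lowering True x) w =
        inverse refl_const * (s ^ k * a * diag_coeff k) * (inverse ?u - a ^ (k + 1) * ?u) * x w" for w
      by (simp add: mult.assoc)
    moreover have "inverse refl_const * (s ^ k * a * diag_coeff k) = s ^ (N + 1)"
      using refl_const_nonzero by (simp add: refl_const_def field_simps)
    moreover have "s ^ (N + 1) * (inverse ?u - a ^ (k + 1) * ?u) =
       inverse ?v - a * (a ^ k * (s ^ (N + 1) * s ^ (N + 1))) * ?v"
      unfolding kappa_refl_degree(2) by (simp add: field_simps)
    moreover have "\<dots> = cartan_weight True (refl_degree p m) m"
      unfolding s_power_square aks by (simp add: cartan_weight_def)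
    ultimately have "refl_lowering True (refl_raising True x) w - refl_raising True (refl_lowering True x) w = cartan_weight True (refl_degree p m) m * x w" for w
      by (simp only:)
    then show ?thesis using 4 by (simp add: fun_eq_iff algebra_simps del: refl_lowering.simps refl_raising.simps)
  qed
qed

text \<open>Inserting \<open>False\<close> into a power of \<open>False\<close> multiplies the value
  by a quantum integer, and the quantum integer of \<open>N\<close> is zero.\<close>

lemma steinberg_replicate: "steinberg p m f \<Longrightarrow> f (replicate N False) = 0"
proof (induction rule: steinberg.induct)
  case delta
  then show ?case using N2 by (cases N) (simp_all add: delta_def)
next
  case (ins p m f j)
  note h = steinberg_homog[OF ins.hyps]
  have 1: "raising True g (replicate t False) = 0" for t g
    by (induction t arbitrary: g) simp_all
  have c: "count_list (replicate t b) c = (if b = c then t else 0)" for t and b c :: bool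
    by (induction t) auto
  have 2: "raising False g (replicate (Suc t) False) =
      quantum_nat (Suc t) * (inverse (a ^ t) - a) * g (replicate t False)" for t g
  proof (induction t arbitrary: g)
    case 0
    show ?case by (simp add: quantum_nat_def cartan_weight_def kappa_def)
  next
    case (Suc t)
    have w: "cartan_weight False (int (Suc t)) 0 = inverse (a ^ Suc t) - a * a ^ Suc t"
      by (simp add: cartan_weight_def kappa_def del: of_nat_Suc power_Suc)
    have "raising False g (replicate (Suc (Suc t)) False) =
        (cartan_weight False (int (Suc t)) 0 + quantum_nat (Suc t) * (inverse (a ^ t) - a)) * g (replicate (Suc t) False)"
      using Suc[of "\<lambda>v. g (False # v)"] by (simp add: c algebra_simps)
    also have "cartan_weight False (int (Suc t)) 0 + quantum_nat (Suc t) * (inverse (a ^ t) - a) =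
        (1 + a * quantum_nat (Suc t)) * inverse (a ^ Suc t) - (quantum_nat (Suc t) + a ^ Suc t) * a"
      unfolding w by (simp add: field_simps)
    also have "\<dots> = quantum_nat (Suc (Suc t)) * (inverse (a ^ Suc t) - a)"
      unfolding quantum_nat_Suc[symmetric] quantum_nat_Suc'[symmetric] by (simp add: algebra_simps)
    finally show ?case .
  qed
  show ?case
  proof (cases j)
    case True
    then show ?thesis using 1 by simp
  next
    case False
    then show ?thesis using 2[of f "N - 1"] N2 quantum_nat_N by simp
  qed
qed simp_all

text \<open>The end of the F_1-string through \<open>delta\<close>, and the highest weight vector
  for the reflected operators.\<close>

definition lowest_vector :: "'k wfun" where
  "lowest_vector = (raising False ^^ (N - 1)) delta"

lemma steinberg_lowest_vector: "steinberg (int N - 1) 0 lowest_vector"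
proof -
  have "steinberg (int t) 0 ((raising False ^^ t) delta)" for t
  proof (induction t)
    case 0
    show ?case using steinberg.delta by simp
  next
    case (Suc t)
    from steinberg_raising(1)[OF this] show ?case by (simp add: algebra_simps)
  qed
  from this[of "N - 1"] show ?thesis using N2 by (simp add: lowest_vector_def of_nat_diff)
qed

text \<open>Stripping a letter from the \<open>t\<close>-th power multiplies by
  \<open>quantum_nat t * (a / a ^ t - a)\<close>, and neither factor vanishes for \<open>t\<close>
  between 1 and \<open>N - 1\<close>.\<close>

lemma lowest_vector_nonzero: "lowest_vector (replicate (N - 1) False) \<noteq> 0"
proof -
  have "t < N \<Longrightarrow> (raising False ^^ t) delta (replicate t False) \<noteq> 0" for t
  proof (induction t)
    case 0
    show ?case by (simp add: delta_def)
  next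
    case (Suc t)
    have h: "homog 0 0 (delta :: 'k wfun)" by (rule steinberg_homog[OF steinberg.delta])
    have "strip False ((raising False ^^ Suc t) delta) (replicate t False) =
        quantum_nat (Suc t) * (a / a ^ Suc t - a) * (raising False ^^ t) delta (replicate t False)"
      unfolding strip_raising_pow[OF h]
    proof -
      have "strip False delta = (\<lambda>w. 0 :: 'k)" by (simp add: strip_def[abs_def] delta_def)
      moreover have "(raising False ^^ n) (\<lambda>w. 0) = (\<lambda>w. 0)" for n
        by (induction n) (simp_all add: raising_zero)
      ultimately show "(raising False ^^ Suc t) (strip False delta) (replicate t False) + quantum_nat (Suc t) *
           (a / a ^ Suc t * inverse (kappa False 0 0) - a * kappa False 0 0) *
           (raising False ^^ (Suc t - 1)) delta (replicate t False) =
         quantum_nat (Suc t) * (a / a ^ Suc t - a) * (raising False ^^ t) delta (replicate t False)"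
        by (simp only:) (simp add: kappa_def)
    qed
    moreover have "a / a ^ Suc t - a \<noteq> 0"
    proof
      assume "a / a ^ Suc t - a = 0"
      then have "a ^ Suc t = 1" by (simp add: field_simps)
      then show False using a_prim[of "Suc t"] Suc.prems by simp
    qed
    ultimately show ?case using Suc quantum_nat_nonzero[of "Suc t"] by (simp add: strip_def)
  qed
  then show ?thesis using N2 by (simp add: lowest_vector_def)
qed

lemma refl_coeffs_homog: "steinberg p m x \<Longrightarrow> homog (refl_degree p m) m (refl_coeffs x)"
proof -
  have "steinberg p m x \<Longrightarrow> refl_coeffs x w \<noteq> 0 \<Longrightarrow>
    int (count_list w False) = refl_degree p m \<and> int (count_list w True) = m" for w
  proof (induction w arbitrary: p m x)
    case Nil
    have c: "count_list (replicate t b) c = (if b = c then t else 0)" for t and b c :: bool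
      by (induction t) auto
    show ?case using steinberg_homog[OF Nil(1)] Nil(2) N2 by (auto simp: homog_def c of_nat_diff)
  next
    case (Cons i w)
    from Cons.IH[OF steinberg_refl_lowering[OF Cons.prems(1), of i]] Cons.prems(2) show ?case
      by (cases i) (simp_all add: algebra_simps)
  qed
  then show "steinberg p m x \<Longrightarrow> homog (refl_degree p m) m (refl_coeffs x)" by (simp add: homog_def)
qed

text \<open>Both sides obey the same recursion in the first letter: one by
  \<open>reflected_relations\<close>, the other by the definition of \<open>insert_letter\<close>.
  What is left is that a raised vector has no component along \<open>lowest_vector\<close>.\<close>

lemma refl_coeffs_refl_raising: "steinberg p m x \<Longrightarrow> refl_coeffs (refl_raising l x) w = raising l (refl_coeffs x) w"
proof (induction w arbitrary: p m x)
  case Nil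
  show ?case
  proof (cases l)
    case True
    have c: "count_list (replicate t b) c = (if b = c then t else 0)" for t and b c :: bool
      by (induction t) auto
    have "homog (p + int k) (m + 1) (refl_raising True x)"
      using steinberg_homog[OF steinberg_refl_raising[OF Nil, of True]] by simp
    \<comment> \<open>Evaluation at a power of \<open>False\<close> sees only
      \<open>m + 1 = 0\<close>, and in that degree \<open>x\<close> is already zero.\<close>
    moreover have "refl_raising True x = (\<lambda>w. 0)" if "m < 0"
      using homog_neg[OF steinberg_homog[OF Nil]] that by (simp add: untwist_def[abs_def] root_raising_zero)
    ultimately show ?thesis using True by (fastforce simp: homog_def c)
  next
    case False
    have "False # replicate (N - 1) False = replicate N False"
      using N2 by (cases N) simp_all
    then show ?thesis using steinberg_replicate[OF Nil] False by (simp add: strip_def)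
  qed
next
  case (Cons i w)
  have "refl_coeffs (refl_raising l x) (i # w) = refl_coeffs (refl_raising l (refl_lowering i x)) w + (if i = l then cartan_weight i (refl_degree p m) m else 0) * refl_coeffs x w"
    unfolding refl_coeffs.simps reflected_relations[OF Cons.prems] refl_coeffs_lin ..
  also have "refl_coeffs (refl_raising l (refl_lowering i x)) w = raising l (refl_coeffs (refl_lowering i x)) w"
    by (rule Cons.IH[OF steinberg_refl_lowering[OF Cons.prems]])
  also have "(if i = l then cartan_weight i (refl_degree p m) m else 0) * refl_coeffs x w =
     (if i = l then cartan_weight l (int (count_list w False)) (int (count_list w True)) * refl_coeffs x w else 0)"
    using refl_coeffs_homog[OF Cons.prems] by (auto simp: homog_def)
  finally show ?case by simp
qed

text \<open>\<open>delta\<close> is reached from \<open>lowest_vector\<close>, and each raising step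
  lifts along the intertwining property. The constant is the coefficient of
  \<open>lowest_vector\<close> on the empty word; since it is nonzero, a nonzero \<open>f\<close>
  forces a nonzero \<open>x\<close>.\<close>

lemma steinberg_reflect:
  "steinberg p m f \<Longrightarrow> \<exists>x. steinberg (refl_degree p m) m x \<and>
     (\<forall>w. refl_coeffs x w = lowest_vector (replicate (N - 1) False) * f w)"
proof (induction rule: steinberg.induct)
  case delta
  have "refl_lowering i lowest_vector = (\<lambda>w. 0)" for i
  proof (cases i)
    case True
    then show ?thesis using homog_neg[OF steinberg_homog[OF steinberg_refl_lowering[OF steinberg_lowest_vector, of i]]] by simp
  next
    case False
    have h: "steinberg (int N) 0 (raising False lowest_vector)" using steinberg_raising(1)[OF steinberg_lowest_vector] by simp
    have "raising False lowest_vector w = 0" for w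
    proof (rule ccontr)
      assume nz: "raising False lowest_vector w \<noteq> 0"
      then have "int (count_list w False) = int N" "count_list w True = 0"
        using steinberg_homog[OF h] by (auto simp: homog_def)
      moreover have "count_list w True = 0 \<Longrightarrow> w = replicate (count_list w False) False"
        by (induction w) (auto split: if_splits)
      ultimately have "w = replicate N False" by simp
      then show False using nz steinberg_replicate[OF h] by simp
    qed
    then show ?thesis using False by (simp add: fun_eq_iff)
  qed
  then have "refl_coeffs lowest_vector w = lowest_vector (replicate (N - 1) False) * delta w" for w
    by (cases w) (simp_all add: delta_def refl_coeffs_zero)
  then show ?case using steinberg_lowest_vector by auto
next
  case (zero p m)
  then show ?case using steinberg.zero refl_coeffs_zero by (intro exI[of _ "\<lambda>w. 0"]) simp
next
  case (add p m f g)
  then obtain x y where "steinberg (refl_degree p m) m x" "\<forall>w. refl_coeffs x w = lowest_vector (replicate (N - 1) False) * f w"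
    "steinberg (refl_degree p m) m y" "\<forall>w. refl_coeffs y w = lowest_vector (replicate (N - 1) False) * g w" by blast
  then show ?case
    by (intro exI[of _ "\<lambda>w. x w + y w"]) (simp add: refl_coeffs_lin steinberg.add algebra_simps)
next
  case (scale p m f c)
  then obtain x where "steinberg (refl_degree p m) m x" "\<forall>w. refl_coeffs x w = lowest_vector (replicate (N - 1) False) * f w"
    by blast
  then show ?case
    by (intro exI[of _ "\<lambda>w. c * x w"]) (simp add: refl_coeffs_lin steinberg.scale)
next
  case (ins p m f j)
  then obtain x where x: "steinberg (refl_degree p m) m x"
    and refl_coeffs: "refl_coeffs x = (\<lambda>w. lowest_vector (replicate (N - 1) False) * f w)" by blast
  have "refl_coeffs (refl_raising j x) w = lowest_vector (replicate (N - 1) False) * raising j f w" for w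
    unfolding refl_coeffs_refl_raising[OF x] refl_coeffs raising_lin ..
  moreover have "steinberg (refl_degree (p + (if j then 0 else 1)) (m + (if j then 1 else 0)))
      (m + (if j then 1 else 0)) (refl_raising j x)"
    using steinberg_refl_raising[OF x, of j] by (cases j) (simp_all add: algebra_simps)
  ultimately show ?case by blast
qed

text \<open>For \<open>k \<ge> 2\<close> and \<open>p \<le> m\<close> the reflected degree is larger than \<open>(p, m)\<close>, so there is no
  largest degree.\<close>

theorem steinberg_unbounded:
  assumes "k \<ge> 2" and bound: "\<And>p m f w. steinberg p m f \<Longrightarrow> f w \<noteq> 0 \<Longrightarrow> length w < n"
  shows False
proof -
  define D where "D = {(p, m). \<exists>f w. steinberg p m f \<and> f w \<noteq> 0}"
  have len: "int (length w) = int (count_list w False) + int (count_list w True)" for w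
    by (induction w) auto
  have D_nonneg: "0 \<le> p \<and> 0 \<le> m \<and> p + m < int n" if d: "(p, m) \<in> D" for p m
  proof -
    obtain f w where f: "steinberg p m f" "f w \<noteq> 0" using d by (auto simp: D_def)
    have "int (count_list w False) = p" "int (count_list w True) = m"
      using steinberg_homog[OF f(1)] f(2) by (auto simp: homog_def)
    then show ?thesis using bound[OF f] len[of w] by simp
  qed
  have swap: "(m, p) \<in> D" if d: "(p, m) \<in> D" for p m
  proof -
    obtain f w where f: "steinberg p m f" "f w \<noteq> 0" using d by (auto simp: D_def)
    have "\<exists>v. f (map Not v) \<noteq> 0" using f(2) by (intro exI[of _ "map Not w"]) (simp add: comp_def)
    then show ?thesis using steinberg_swap[OF f(1)] by (auto simp: D_def)
  qed
  have refl: "(refl_degree p m, m) \<in> D" if d: "(p, m) \<in> D" for p m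
  proof -
    obtain f w where f: "steinberg p m f" "f w \<noteq> 0" using d by (auto simp: D_def)
    obtain x where x: "steinberg (refl_degree p m) m x" "\<forall>w. refl_coeffs x w = lowest_vector (replicate (N - 1) False) * f w"
      using steinberg_reflect[OF f(1)] by blast
    have "refl_coeffs x w \<noteq> 0" using x(2) f(2) lowest_vector_nonzero by simp
    then have "x \<noteq> (\<lambda>w. 0)" using refl_coeffs_zero by metis
    then obtain v where "x v \<noteq> 0" by auto
    then show ?thesis using x(1) by (auto simp: D_def)
  qed
  have "D \<subseteq> {0..int n} \<times> {0..int n}" using D_nonneg by force
  then have fin: "finite D" by (rule finite_subset) simp
  have "(0, 0) \<in> D" 
    unfolding D_def using steinberg.delta by (auto intro!: exI[of _ delta] exI[of _ "[]"] simp: delta_def)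
  define d where "d = Max ((\<lambda>(p, m). p + m) ` D)"
  have "d \<in> (\<lambda>(p, m). p + m) ` D" unfolding d_def using fin \<open>(0, 0) \<in> D\<close> by (intro Max_in) auto
  then obtain p m where pm: "(p, m) \<in> D" "p + m = d" by auto
  have max: "p' + m' \<le> d" if d: "(p', m') \<in> D" for p' m'
    unfolding d_def using fin d by (intro Max_ge) force+
  have "\<exists>p m. (p, m) \<in> D \<and> p + m = d \<and> p \<le> m"
    using pm swap[OF pm(1)] by (metis add.commute linear)
  then obtain p m where pm: "(p, m) \<in> D" "p + m = d" "p \<le> m" by blast
  \<comment> \<open>Maximality at the reflected degree gives
    \<open>N - 1 + k * m \<le> 2 * p\<close>, while \<open>2 * p \<le> 2 * m \<le> k * m\<close> and
    \<open>N\<close> is at least 2.\<close>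
  have "int N - 1 - p + int k * m + m \<le> p + m" using max[OF refl[OF pm(1)]] pm(2) by simp
  moreover have "2 * m \<le> int k * m" using D_nonneg[OF pm(1)] assms(1) by (intro mult_right_mono) auto
  ultimately show False using pm(3) N2 by linarith
qed

end

section \<open>Quantum shuffles and the quantum symmetrizer\<close>

context rank2_braiding
begin

text \<open>\<open>shuffle\<close> is multiplication by a letter in the quantum shuffle algebra. The
  variant with inverse weights is, up to scalars, multiplication on the other side, see
  \<open>shuffle_inv_word\<close>.\<close>

abbreviation shuffle_inv where "shuffle_inv \<equiv> insert_letter (\<lambda>i p m. inverse (kappa i p m))"
abbreviation shuffle where "shuffle \<equiv> insert_letter kappa"

definition braid_coeff :: "bool \<Rightarrow> bool \<Rightarrow> 'k" where
  "braid_coeff i j = (if i = j then a else s)"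

abbreviation word_kappa :: "bool \<Rightarrow> bool list \<Rightarrow> 'k" where
  "word_kappa i w \<equiv> kappa i (int (count_list w False)) (int (count_list w True))"

lemma braid_coeff_nonzero [simp]: "braid_coeff i j \<noteq> 0"
  by (simp add: braid_coeff_def)

lemma braid_coeff_sym: "braid_coeff i j = braid_coeff j i"
  by (auto simp: braid_coeff_def)

lemma word_kappa_Nil: "word_kappa i [] = 1"
  by (simp add: kappa_def)

lemma word_kappa_Cons: "word_kappa i (l # w) = braid_coeff i l * word_kappa i w"
  by (auto simp: braid_coeff_def kappa_def power_int_add)

lemma raising_split: "raising j f w = shuffle_inv j f w - a * shuffle j f w"
  by (induction w arbitrary: f) (auto simp: cartan_weight_def algebra_simps)

text \<open>The word at which the function is evaluated lacks one letter \<open>i\<close>, which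
  accounts for the division.\<close>

lemma insert_letter_kappa:
  "insert_letter W i (\<lambda>v. word_kappa j v * f v) w = word_kappa j w / braid_coeff i j * insert_letter W i f w"
proof (induction w arbitrary: f)
  case (Cons l w)
  have "insert_letter W i (\<lambda>v. word_kappa j (l # v) * f (l # v)) w =
      braid_coeff j l * insert_letter W i (\<lambda>v. word_kappa j v * f (l # v)) w"
    unfolding word_kappa_Cons mult.assoc insert_letter_scale ..
  then show ?case
    unfolding insert_letter.simps Cons[of "\<lambda>v. f (l # v)"] unfolding word_kappa_Cons
    by (cases "l = i") (simp_all add: braid_coeff_sym field_simps)
qed simp

lemma insert_letter_inverse_kappa:
  "insert_letter W i (\<lambda>v. inverse (word_kappa j v) * f v) w =
     braid_coeff i j * inverse (word_kappa j w) * insert_letter W i f w"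
proof (induction w arbitrary: f)
  case (Cons l w)
  have "insert_letter W i (\<lambda>v. inverse (word_kappa j (l # v)) * f (l # v)) w =
      inverse (braid_coeff j l) * insert_letter W i (\<lambda>v. inverse (word_kappa j v) * f (l # v)) w"
    unfolding word_kappa_Cons inverse_mult_distrib mult.assoc insert_letter_scale ..
  then show ?case
    unfolding insert_letter.simps Cons[of "\<lambda>v. f (l # v)"] unfolding word_kappa_Cons
    by (cases "l = i") (simp_all add: braid_coeff_sym field_simps)
qed simp

lemma insert_letter_if:
  "insert_letter W i (\<lambda>v. (if P then g v else 0) + h v) w =
     (if P then insert_letter W i g w else 0) + insert_letter W i h w"
  by (simp add: insert_letter_add insert_letter_zero)

text \<open>For any two positions exactly one order of deletion lets a weight see the other letter.
  An extra \<open>i\<close> multiplies \<open>kappa j\<close>, an extra \<open>j\<close> divides the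
  inverse of \<open>kappa i\<close>; either way the ratio is \<open>braid_coeff i j\<close>.\<close>

lemma shuffle_commute: "shuffle j (shuffle_inv i f) w = braid_coeff i j * shuffle_inv i (shuffle j f) w"
proof (induction w arbitrary: f)
  case (Cons l w)
  have 1: "shuffle_inv i (shuffle j f) (l # w) = (if l = i then inverse (word_kappa i w) * shuffle j f w else 0)
     + (if l = j then word_kappa j w / braid_coeff i j * shuffle_inv i f w else 0) + shuffle_inv i (shuffle j (\<lambda>v. f (l # v))) w"
    unfolding insert_letter.simps insert_letter_if insert_letter_kappa by simp
  have 2: "shuffle j (shuffle_inv i f) (l # w) = (if l = j then word_kappa j w * shuffle_inv i f w else 0)
     + (if l = i then braid_coeff j i * inverse (word_kappa i w) * shuffle j f w else 0)
     + shuffle j (shuffle_inv i (\<lambda>v. f (l # v))) w"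
    unfolding insert_letter.simps insert_letter_if insert_letter_inverse_kappa by simp
  show ?case unfolding 1 2 Cons by (simp add: braid_coeff_sym field_simps)
qed simp

lemma insert_letter_lin:
  "insert_letter W i (\<lambda>w. f w + g w) = (\<lambda>w. insert_letter W i f w + insert_letter W i g w)"
  "insert_letter W i (\<lambda>w. c * f w) = (\<lambda>w. c * insert_letter W i f w)"
  by (simp_all add: insert_letter_add insert_letter_scale fun_eq_iff)

lemma shuffle_inv_delta: "shuffle_inv j delta = shuffle j delta"
proof
  fix w
  show "shuffle_inv j delta w = shuffle j delta w"
  proof (cases w)
    case (Cons l v)
    have 0: "insert_letter W j (\<lambda>v. delta (l # v)) v = 0" for W :: "bool \<Rightarrow> int \<Rightarrow> int \<Rightarrow> 'k"
      by (simp add: delta_def insert_letter_zero)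
    show ?thesis
      unfolding Cons insert_letter.simps 0 by (cases "v = []") (simp_all add: delta_def kappa_def)
  qed simp
qed

text \<open>By \<open>symmetrizer_sum\<close>, on words of length \<open>n\<close> these functions
  span the image of the \<open>n\<close>-th quantum symmetrizer of the diagonal braiding.\<close>

inductive shuffle_span :: "nat \<Rightarrow> 'k wfun \<Rightarrow> bool" where
  word: "shuffle_span (length js) (foldr shuffle js delta)"
| add: "shuffle_span n f \<Longrightarrow> shuffle_span n g \<Longrightarrow> shuffle_span n (\<lambda>w. f w + g w)"
| scale: "shuffle_span n f \<Longrightarrow> shuffle_span n (\<lambda>w. c * f w)"

lemma shuffle_span_shuffle: "shuffle_span n f \<Longrightarrow> shuffle_span (Suc n) (shuffle j f)"
proof (induction rule: shuffle_span.induct)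
  case (word js)
  show ?case using shuffle_span.word[of "j # js"] by simp
qed (auto simp: insert_letter_lin intro: shuffle_span.intros)

text \<open>\<open>shuffle_inv j\<close> passes each \<open>shuffle i\<close> at the cost of a
  scalar. At \<open>delta\<close> both insertions agree, because the weights are 1 on the empty
  word, and so the letter ends up last.\<close>

lemma shuffle_inv_word: "\<exists>c. shuffle_inv j (foldr shuffle js delta) = (\<lambda>w. c * foldr shuffle (js @ [j]) delta w)"
proof (induction js)
  case Nil
  show ?case by (intro exI[of _ 1]) (simp add: shuffle_inv_delta)
next
  case (Cons i js)
  then obtain c where c: "shuffle_inv j (foldr shuffle js delta) = (\<lambda>w. c * foldr shuffle (js @ [j]) delta w)" by blast
  have "shuffle_inv j (shuffle i g) = (\<lambda>w. inverse (braid_coeff j i) * shuffle i (shuffle_inv j g) w)" for g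
    unfolding shuffle_commute by (simp add: fun_eq_iff)
  then have "shuffle_inv j (foldr shuffle (i # js) delta) = (\<lambda>w. inverse (braid_coeff j i) * shuffle i (shuffle_inv j (foldr shuffle js delta)) w)"
    by simp
  also have "\<dots> = (\<lambda>w. inverse (braid_coeff j i) * (c * foldr shuffle ((i # js) @ [j]) delta w))"
    unfolding c insert_letter_lin by simp
  finally show ?case unfolding mult.assoc[symmetric] by blast
qed

lemma shuffle_span_shuffle_inv: "shuffle_span n f \<Longrightarrow> shuffle_span (Suc n) (shuffle_inv j f)"
proof (induction rule: shuffle_span.induct)
  case (word js)
  obtain c where "shuffle_inv j (foldr shuffle js delta) = (\<lambda>w. c * foldr shuffle (js @ [j]) delta w)"
    using shuffle_inv_word by blast
  then show ?case using shuffle_span.scale[OF shuffle_span.word[of "js @ [j]"], of c] by simp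
qed (auto simp: insert_letter_lin intro: shuffle_span.intros)

lemma shuffle_span_raising:
  assumes "shuffle_span n f"
  shows "shuffle_span (Suc n) (raising j f)"
proof -
  have "raising j f = (\<lambda>w. shuffle_inv j f w + (- a) * shuffle j f w)" by (simp add: raising_split fun_eq_iff)
  then show ?thesis
    by (simp only:) (rule shuffle_span.add[OF shuffle_span_shuffle_inv[OF assms] shuffle_span.scale[OF shuffle_span_shuffle[OF assms]]])
qed

lemma shuffle_span_zero: "shuffle_span n (\<lambda>w. 0)"
  using shuffle_span.scale[OF shuffle_span.word[of "replicate n False"], of 0] by simp

lemma steinberg_shuffle_span: "steinberg p m f \<Longrightarrow> int n = p + m \<Longrightarrow> shuffle_span n f"
proof (induction arbitrary: n rule: steinberg.induct)
  case delta
  then show ?case using shuffle_span.word[of "[]"] by simp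
next
  case (ins p m f j)
  show ?case
  proof (cases n)
    case 0
    then have "p < 0 \<or> m < 0" using ins.prems by (cases j) auto
    then have "f = (\<lambda>w. 0)" by (rule homog_neg[OF steinberg_homog[OF ins.hyps]])
    then show ?thesis by (simp add: raising_zero shuffle_span_zero)
  next
    case (Suc n')
    have "int n' = p + m" using ins.prems Suc by (cases j) auto
    then show ?thesis using shuffle_span_raising[OF ins.IH] Suc by simp
  qed
qed (auto intro: shuffle_span.intros shuffle_span_zero)

end

text \<open>If the shuffle products of all long words vanished, the Steinberg module would have
  bounded degree, since it lies in their span.\<close>

theorem (in rank2_cartan) symmetrizer_nonzero:
  assumes "k \<ge> 2"
  shows "\<exists>js w. length js \<ge> n \<and> length w = length js \<and> foldr shuffle js delta w \<noteq> 0"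
proof (rule ccontr)
  assume neg: "\<not> ?thesis"
  have len: "int (length w) = int (count_list w False) + int (count_list w True)" for w
    by (induction w) auto
  have 0: "f w = 0" if "shuffle_span l f" "length w = l" "n \<le> l" for f w l
    using that neg by (induction rule: shuffle_span.induct) auto
  have "length w < n" if "steinberg p m f" "f w \<noteq> 0" for p m f w
  proof -
    have "int (length w) = p + m"
      using steinberg_homog[OF that(1)] that(2) by (auto simp: homog_def len)
    from steinberg_shuffle_span[OF that(1) this] show ?thesis using 0[of "length w" f w] that(2) by force
  qed
  from steinberg_unbounded[OF assms this] show False .
qed

text \<open>For \<open>a = 1\<close> the letter \<open>False\<close> braids trivially with itself,
  and its \<open>n\<close>-fold shuffle product counts all orders of insertion. In characteristic
  zero this is never zero: the polynomial ring case.\<close>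

lemma (in rank2_braiding) symmetrizer_nonzero_trivial:
  assumes "a = 1"
  shows "foldr shuffle (replicate n False) delta (replicate n False) = of_nat (fact n)"
proof -
  have step: "shuffle False f (replicate (Suc n) False) = of_nat (Suc n) * f (replicate n False)" for f n
  proof (induction n arbitrary: f)
    case 0
    then show ?case by (simp add: kappa_def)
  next
    case (Suc n)
    have c: "count_list (replicate t False) False = t" "count_list (replicate t False) True = 0"
      for t by (induction t) auto
    have "kappa False (int n) 0 = 1" for n using assms unfolding kappa_def by simp
    from this[of "Suc n"] show ?case
      using Suc[of "\<lambda>v. f (False # v)"] by (simp add: c algebra_simps)
  qed
  show ?thesis
  proof (induction n)
    case (Suc n)
    have "foldr shuffle (replicate (Suc n) False) delta = shuffle False (foldr shuffle (replicate n False) delta)"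
      by simp
    then show ?case unfolding step Suc.IH by (simp only: step Suc.IH) (simp add: algebra_simps)
  qed (simp add: delta_def)
qed

section \<open>Inversions, reduced expressions and braid words of a diagonal braiding\<close>

definition inversions :: "nat \<Rightarrow> (nat \<Rightarrow> nat) \<Rightarrow> (nat \<times> nat) set" where
  "inversions n p = {(x, y). x < y \<and> y < n \<and> p y < p x}"

text \<open>The scalar that a diagonal braiding collects along a reduced expression: one factor for
  each pair of strands that cross.\<close>

definition inv_weight :: "('a \<Rightarrow> 'a \<Rightarrow> 'k::comm_monoid_mult) \<Rightarrow> nat \<Rightarrow> (nat \<Rightarrow> nat) \<Rightarrow> (nat \<Rightarrow> 'a) \<Rightarrow> 'k" where
  "inv_weight q n p u = (\<Prod>(x, y)\<in>inversions n p. q (u x) (u y))"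

lemma finite_inversions [simp]: "finite (inversions n p)"
  by (rule finite_subset[of _ "{..<n} \<times> {..<n}"]) (auto simp: inversions_def)

abbreviation adj :: "nat \<Rightarrow> nat \<Rightarrow> nat" where
  "adj i \<equiv> Transposition.transpose i (i + 1)"

lemma adj_less: "x < y \<Longrightarrow> (x, y) \<noteq> (i, i + 1) \<Longrightarrow> adj i x < adj i y"
  by (auto simp: Transposition.transpose_def)

lemma adj_bound: "i + 1 < n \<Longrightarrow> x < n \<Longrightarrow> adj i x < n"
  by (auto simp: Transposition.transpose_def)

text \<open>An adjacent transposition reverses the order of the pair \<open>(i, i + 1)\<close> only;
  all other inversions are merely relabelled.\<close>

lemma inversions_adj_ascent:
  assumes "i + 1 < n" "p i < p (i + 1)"
  shows "inversions n (p \<circ> adj i) = insert (i, i + 1) (map_prod (adj i) (adj i) ` inversions n p)"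
    (is "?L = ?R")
proof
  show "?L \<subseteq> ?R"
  proof (rule subrelI)
    fix x y assume xy: "(x, y) \<in> ?L"
    show "(x, y) \<in> ?R"
    proof (cases "(x, y) = (i, i + 1)")
      case False
      then have "(adj i x, adj i y) \<in> inversions n p"
        using xy adj_less[of x y i] adj_bound[OF assms(1), of y] by (auto simp: inversions_def)
      then have "map_prod (adj i) (adj i) (adj i x, adj i y) \<in> map_prod (adj i) (adj i) ` inversions n p"
        by (rule imageI)
      then show ?thesis by simp
    qed simp
  qed
  show "?R \<subseteq> ?L"
  proof -
    have "(adj i x, adj i y) \<in> ?L" if xy: "(x, y) \<in> inversions n p" for x y
    proof -
      have "(x, y) \<noteq> (i, i + 1)" using xy assms by (auto simp: inversions_def)
      then show ?thesis
        using xy adj_less[of x y i] adj_bound[OF assms(1), of y] by (auto simp: inversions_def)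
    qed
    moreover have "(i, i + 1) \<in> ?L" using assms by (simp add: inversions_def)
    ultimately show ?thesis by auto
  qed
qed

lemma inj_adj: "inj (map_prod (adj i) (adj i))"
  by (intro prod.inj_map) auto

lemma card_inversions_ascent:
  assumes "i + 1 < n" "p i < p (i + 1)"
  shows "card (inversions n (p \<circ> adj i)) = Suc (card (inversions n p))"
proof -
  have "(i, i + 1) \<notin> map_prod (adj i) (adj i) ` inversions n p"
    by (auto simp: inversions_def Transposition.transpose_def split: if_splits)
  moreover have "card (map_prod (adj i) (adj i) ` inversions n p) = card (inversions n p)"
    by (rule card_image) (rule inj_on_subset[OF inj_adj], simp)
  ultimately show ?thesis unfolding inversions_adj_ascent[of i n p, OF assms] by simp
qed

lemma inv_weight_ascent:
  assumes "i + 1 < n" "p i < p (i + 1)"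
  shows "inv_weight q n (p \<circ> adj i) u = q (u i) (u (i + 1)) * inv_weight q n p (u \<circ> adj i)"
proof -
  have "(i, i + 1) \<notin> map_prod (adj i) (adj i) ` inversions n p"
    by (auto simp: inversions_def Transposition.transpose_def split: if_splits)
  moreover have "(\<Prod>(x, y)\<in>map_prod (adj i) (adj i) ` inversions n p. q (u x) (u y)) =
      inv_weight q n p (u \<circ> adj i)"
    unfolding inv_weight_def
    by (subst prod.reindex, rule inj_on_subset[OF inj_adj]) (auto intro: prod.cong simp: case_prod_beta)
  ultimately show ?thesis
    unfolding inv_weight_def[of q n "p \<circ> adj i"] inversions_adj_ascent[of i n p, OF assms] by simp
qed

lemma card_inversions_descent:
  assumes "i + 1 < n" "p (i + 1) < p i"
  shows "card (inversions n p) = Suc (card (inversions n (p \<circ> adj i)))"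
proof -
  have "(p \<circ> adj i) \<circ> adj i = p" by (simp add: comp_assoc)
  then show ?thesis using card_inversions_ascent[of i n "p \<circ> adj i"] assms by simp
qed

text \<open>The transposed action of a braid word, on functionals indexed by assignments
  \<open>u\<close> of letters to positions. With assignments as functions, permuting the tensor
  factors is composition.\<close>

definition braid_word :: "('a \<Rightarrow> 'a \<Rightarrow> 'k::comm_semiring_1) \<Rightarrow> nat list \<Rightarrow> ((nat \<Rightarrow> 'a) \<Rightarrow> 'k) \<Rightarrow> (nat \<Rightarrow> 'a) \<Rightarrow> 'k" where
  "braid_word q is = foldr (\<lambda>i \<psi> g u. q (u i) (u (i + 1)) * \<psi> g (u \<circ> adj i)) is (\<lambda>g. g)"

lemma braid_word_Cons:
  "braid_word q (i # is) g u = q (u i) (u (i + 1)) * braid_word q is g (u \<circ> adj i)"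
  by (simp add: braid_word_def)

lemma is_expression_Cons:
  "is_expression n \<sigma> (i # is) \<longleftrightarrow> i + 1 < n \<and> (\<exists>\<tau>. is_expression n \<tau> is \<and> \<sigma> = adj i \<circ> \<tau>)"
  by (auto simp: is_expression_def)

lemma is_expression_permutes: "is_expression n \<sigma> is \<Longrightarrow> \<sigma> permutes {..<n}"
proof (induction "is" arbitrary: \<sigma>)
  case Nil
  then have "\<sigma> = id" by (simp add: is_expression_def id_def)
  then show ?case by (simp only: permutes_id)
next
  case (Cons i "is")
  then obtain \<tau> where t: "i + 1 < n" "is_expression n \<tau> is" "\<sigma> = adj i \<circ> \<tau>"
    unfolding is_expression_Cons by blast
  show ?case unfolding t(3)
    by (rule permutes_compose[OF Cons.IH[OF t(2)] permutes_swap_id]) (use t(1) in auto)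
qed

text \<open>The notation \<open>inv\<close> is taken by the inverse of a group.\<close>

abbreviation pinv :: "(nat \<Rightarrow> nat) \<Rightarrow> nat \<Rightarrow> nat" where
  "pinv \<equiv> inv_into UNIV"

lemma inv_adj_comp: "bij \<tau> \<Longrightarrow> pinv (adj i \<circ> \<tau>) = pinv \<tau> \<circ> adj i"
  by (simp add: o_inv_distrib)

text \<open>Each letter of an expression either creates an inversion or destroys one. If the length
  equals the number of inversions, every letter creates one and contributes exactly its factor. The
  result depends only on the permutation, so no braid relations between reduced expressions
  enter.\<close>

lemma braid_word_reduced_aux:
  "is_expression n \<sigma> is \<Longrightarrow> card (inversions n (pinv \<sigma>)) \<le> length is \<and>
     (card (inversions n (pinv \<sigma>)) = length is \<longrightarrow>
        braid_word q is g u = inv_weight q n (pinv \<sigma>) u * g (u \<circ> \<sigma>))"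
proof (induction "is" arbitrary: \<sigma> u)
  case Nil
  have "\<sigma> = id" using Nil by (simp add: is_expression_def id_def)
  moreover have "inversions n (pinv id) = {}" by (auto simp: inversions_def)
  ultimately show ?case by (simp only: inv_weight_def) (simp add: braid_word_def comp_def)
next
  case (Cons i "is")
  then obtain \<tau> where t: "i + 1 < n" "is_expression n \<tau> is" "\<sigma> = adj i \<circ> \<tau>"
    unfolding is_expression_Cons by blast
  have bij: "bij \<tau>" using permutes_bij[OF is_expression_permutes[OF t(2)]] .
  have inv: "pinv \<sigma> = pinv \<tau> \<circ> adj i" unfolding t(3) by (rule inv_adj_comp[OF bij])
  have IH1: "card (inversions n (pinv \<tau>)) \<le> length is"
    by (rule conjunct1[OF Cons.IH[OF t(2)]])
  have IH2: "card (inversions n (pinv \<tau>)) = length is \<Longrightarrow>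
      braid_word q is g u = inv_weight q n (pinv \<tau>) u * g (u \<circ> \<tau>)" for u
    by (rule mp[OF conjunct2[OF Cons.IH[OF t(2)]]])
  have "pinv \<tau> i \<noteq> pinv \<tau> (i + 1)"
    using inj_eq[OF bij_is_inj[OF bij_imp_bij_inv[OF bij]]] by simp
  then consider "pinv \<tau> i < pinv \<tau> (i + 1)" | "pinv \<tau> (i + 1) < pinv \<tau> i" by linarith
  then show ?case
  proof cases
    case 1
    note c = card_inversions_ascent[of i n "pinv \<tau>", OF t(1) 1]
    show ?thesis
    proof (intro conjI impI)
      show "card (inversions n (pinv \<sigma>)) \<le> length (i # is)"
        unfolding inv c using IH1 by simp
      assume "card (inversions n (pinv \<sigma>)) = length (i # is)"
      then have "card (inversions n (pinv \<tau>)) = length is" unfolding inv c by simp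
      from IH2[OF this]
      show "braid_word q (i # is) g u = inv_weight q n (pinv \<sigma>) u * g (u \<circ> \<sigma>)"
        unfolding braid_word_Cons inv inv_weight_ascent[of i n "pinv \<tau>", OF t(1) 1]
        unfolding t(3) by (simp add: comp_assoc mult.assoc)
    qed
  next
    case 2
    have "card (inversions n (pinv \<sigma>)) < length (i # is)"
      unfolding inv using card_inversions_descent[of i n "pinv \<tau>", OF t(1) 2] IH1 by simp
    then show ?thesis by linarith
  qed
qed

text \<open>Sorting at the descents of the inverse removes one inversion at a time; a permutation
  without descents is the identity.\<close>

lemma expression_exists:
  "\<sigma> permutes {..<n} \<Longrightarrow> \<exists>is. is_expression n \<sigma> is \<and> length is = card (inversions n (pinv \<sigma>))"
proof (induction "card (inversions n (pinv \<sigma>))" arbitrary: \<sigma> rule: less_induct)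
  case (less \<sigma>)
  have p: "pinv \<sigma> permutes {..<n}" using less.prems by (rule permutes_inv)
  show ?case
  proof (cases "\<exists>i. i + 1 < n \<and> pinv \<sigma> (i + 1) < pinv \<sigma> i")
    case True
    then obtain i where i: "i + 1 < n" "pinv \<sigma> (i + 1) < pinv \<sigma> i" by blast
    have bij: "bij \<sigma>" using permutes_bij[OF less.prems] .
    have inv: "pinv (adj i \<circ> \<sigma>) = pinv \<sigma> \<circ> adj i" by (rule inv_adj_comp[OF bij])
    have c: "card (inversions n (pinv \<sigma>)) = Suc (card (inversions n (pinv (adj i \<circ> \<sigma>))))"
      unfolding inv by (rule card_inversions_descent[OF i])
    have "adj i \<circ> \<sigma> permutes {..<n}"
      by (rule permutes_compose[OF less.prems permutes_swap_id]) (use i(1) in auto)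
    then obtain "is" where e: "is_expression n (adj i \<circ> \<sigma>) is"
      "length is = card (inversions n (pinv (adj i \<circ> \<sigma>)))"
      using less.hyps[of "adj i \<circ> \<sigma>"] c by auto
    have "\<sigma> = adj i \<circ> (adj i \<circ> \<sigma>)" by (simp add: fun_eq_iff)
    then have "is_expression n \<sigma> (i # is)" 
      using e(1) i(1) unfolding is_expression_Cons by (intro conjI exI[of _ "adj i \<circ> \<sigma>"])
    then show ?thesis using e(2) c by (intro exI[of _ "i # is"]) simp
  next
    case False
    have "x < n \<Longrightarrow> x \<le> pinv \<sigma> x" for x
    proof (induction x)
      case (Suc x)
      have "pinv \<sigma> x \<noteq> pinv \<sigma> (x + 1)" using inj_eq[OF permutes_inj[OF p]] by simp
      then show ?case using Suc False by force
    qed simp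
    then have "pinv \<sigma> = id" using permutes_natset_ge[OF p] by auto
    moreover have "\<sigma> = pinv (pinv \<sigma>)" using permutes_bij[OF less.prems] by (simp add: inv_inv_eq)
    ultimately have "\<sigma> = id" using inv_id by metis
    moreover have "inversions n (\<lambda>x. x) = {}" by (auto simp: inversions_def)
    ultimately show ?thesis by (intro exI[of _ "[]"]) (simp add: is_expression_def id_def)
  qed
qed

lemma braid_word_reduced:
  assumes "\<sigma> permutes {..<n}" "is_reduced_expression n \<sigma> is"
  shows "braid_word q is g u = inv_weight q n (pinv \<sigma>) u * g (u \<circ> \<sigma>)"
proof -
  obtain js where js: "is_expression n \<sigma> js" "length js = card (inversions n (pinv \<sigma>))"
    using expression_exists[OF assms(1)] by blast
  have e: "is_expression n \<sigma> is" "length is \<le> length js"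
    using assms(2) js(1) unfolding is_reduced_expression_def by blast+
  show ?thesis using braid_word_reduced_aux[OF e(1), of q g u] e(2) js(2) by simp
qed

lemma reduced_expression_exists:
  assumes "\<sigma> permutes {..<n}"
  shows "\<exists>is. is_reduced_expression n \<sigma> is"
proof -
  obtain js where "is_expression n \<sigma> js" using expression_exists[OF assms] by blast
  then show ?thesis
    unfolding is_reduced_expression_def by (rule ex_has_least_nat)
qed

text \<open>The cycle \<open>t \<mapsto> t + 1 \<mapsto> \<dots> \<mapsto> n \<mapsto> t\<close>.  These are the shortest representatives of the cosets of
  the permutations of \<open>{..<n}\<close>.\<close>

definition skip_at :: "nat \<Rightarrow> nat \<Rightarrow> nat \<Rightarrow> nat" where
  "skip_at n t x = (if x < t then x else if x < n then x + 1 else if x = n then t else x)"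

lemma skip_at_permutes:
  assumes "t \<le> n"
  shows "skip_at n t permutes {..<Suc n}"
proof (rule bij_imp_permutes)
  have "skip_at n t ` {..<Suc n} \<subseteq> {..<Suc n}" using assms by (auto simp: skip_at_def)
  moreover have inj: "inj_on (skip_at n t) {..<Suc n}"
    using assms by (auto simp: inj_on_def skip_at_def split: if_splits)
  ultimately show "bij_betw (skip_at n t) {..<Suc n} {..<Suc n}"
    using endo_inj_surj[of "{..<Suc n}" "skip_at n t"] by (simp add: bij_betw_def)
  show "x \<notin> {..<Suc n} \<Longrightarrow> skip_at n t x = x" for x using assms by (auto simp: skip_at_def)
qed

text \<open>A permutation is determined by the image \<open>t\<close> of \<open>n\<close> and by
  what remains after the cycle that carries \<open>n\<close> to \<open>t\<close> is undone.\<close>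

lemma sum_permutations_skip_at:
  fixes h :: "(nat \<Rightarrow> nat) \<Rightarrow> 'k::comm_monoid_add"
  shows "(\<Sum>\<sigma> | \<sigma> permutes {..<Suc n}. h \<sigma>) =
    (\<Sum>t<Suc n. \<Sum>\<tau> | \<tau> permutes {..<n}. h (skip_at n t \<circ> \<tau>))"
proof -
  have "(\<Sum>t<Suc n. \<Sum>\<tau> | \<tau> permutes {..<n}. h (skip_at n t \<circ> \<tau>)) =
      (\<Sum>(t, \<tau>)\<in>{..<Suc n} \<times> {\<tau>. \<tau> permutes {..<n}}. h (skip_at n t \<circ> \<tau>))"
    by (rule sum.cartesian_product)
  also have "\<dots> = (\<Sum>\<sigma> | \<sigma> permutes {..<Suc n}. h \<sigma>)"
  proof (rule sum.reindex_bij_witness[where j = "\<lambda>(t, \<tau>). skip_at n t \<circ> \<tau>"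
        and i = "\<lambda>\<sigma>. (\<sigma> n, pinv (skip_at n (\<sigma> n)) \<circ> \<sigma>)"])
    fix x assume "x \<in> {..<Suc n} \<times> {\<tau>. \<tau> permutes {..<n}}"
    then obtain t \<tau> where x: "x = (t, \<tau>)" "t \<le> n" "\<tau> permutes {..<n}" by auto
    have "\<tau> n = n" using x(3) by (simp add: permutes_def)
    then have n: "(skip_at n t \<circ> \<tau>) n = t" using x(2) by (simp add: skip_at_def)
    have "inj (skip_at n t)" using skip_at_permutes[OF x(2)] by (rule permutes_inj)
    then show "(case case x of (t, \<tau>) \<Rightarrow> skip_at n t \<circ> \<tau> of \<sigma> \<Rightarrow>
        (\<sigma> n, pinv (skip_at n (\<sigma> n)) \<circ> \<sigma>)) = x"
      using n x(1) by (simp add: fun_eq_iff)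
    have "\<tau> permutes {..<Suc n}" by (rule permutes_subset[OF x(3)]) auto
    then show "(case x of (t, \<tau>) \<Rightarrow> skip_at n t \<circ> \<tau>) \<in> {\<sigma>. \<sigma> permutes {..<Suc n}}"
      using permutes_compose[OF _ skip_at_permutes[OF x(2)]] x(1) by simp
    show "h (case x of (t, \<tau>) \<Rightarrow> skip_at n t \<circ> \<tau>) = (case x of (t, \<tau>) \<Rightarrow> h (skip_at n t \<circ> \<tau>))"
      using x(1) by simp
  next
    fix \<sigma> assume "\<sigma> \<in> {\<sigma>. \<sigma> permutes {..<Suc n}}"
    then have s: "\<sigma> permutes {..<Suc n}" by simp
    have t: "\<sigma> n \<le> n" using permutes_in_image[OF s, of n] by simp
    have p: "skip_at n (\<sigma> n) permutes {..<Suc n}" by (rule skip_at_permutes[OF t])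
    show "(case (\<sigma> n, pinv (skip_at n (\<sigma> n)) \<circ> \<sigma>) of (t, \<tau>) \<Rightarrow> skip_at n t \<circ> \<tau>) = \<sigma>"
      using permutes_surj[OF p] by (simp add: fun_eq_iff surj_f_inv_f)
    have q: "pinv (skip_at n (\<sigma> n)) \<circ> \<sigma> permutes {..<Suc n}"
      by (rule permutes_compose[OF s permutes_inv[OF p]])
    have "skip_at n (\<sigma> n) n = \<sigma> n" using t by (simp add: skip_at_def)
    then have "(pinv (skip_at n (\<sigma> n)) \<circ> \<sigma>) n = n"
      using inv_f_f[OF permutes_inj[OF p], of n] by simp
    then have "pinv (skip_at n (\<sigma> n)) \<circ> \<sigma> permutes {..<n}"
      by (intro permutes_superset[OF q]) (auto simp: less_Suc_eq)
    then show "(\<sigma> n, pinv (skip_at n (\<sigma> n)) \<circ> \<sigma>) \<in> {..<Suc n} \<times> {\<tau>. \<tau> permutes {..<n}}"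
      using t by simp
  qed
  finally show ?thesis by simp
qed

text \<open>The inverse sends \<open>t\<close> to the last place, so \<open>t\<close> is inverted
  with everything beyond it. On the other positions \<open>skip_at n t\<close> is increasing and
  carries inversions to inversions.\<close>

lemma inversions_skip_at:
  assumes "t \<le> n" "\<tau> permutes {..<n}"
  shows "inversions (Suc n) (pinv (skip_at n t \<circ> \<tau>)) =
    (\<lambda>y. (t, y)) ` {t<..n} \<union> map_prod (skip_at n t) (skip_at n t) ` inversions n (pinv \<tau>)"
    (is "?L = ?R")
proof -
  let ?c = "skip_at n t"
  have c: "?c permutes {..<Suc n}" by (rule skip_at_permutes[OF assms(1)])
  have p: "pinv (?c \<circ> \<tau>) = pinv \<tau> \<circ> pinv ?c"
    by (rule o_inv_distrib[OF permutes_bij[OF c] permutes_bij[OF assms(2)]])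
  have ci: "pinv ?c (?c x) = x" for x using inv_f_f[OF permutes_inj[OF c]] .
  have tp: "pinv \<tau> permutes {..<n}" by (rule permutes_inv[OF assms(2)])
  have tn: "pinv \<tau> n = n" using tp by (simp add: permutes_def)
  have ct: "?c n = t" using assms(1) by (simp add: skip_at_def)
  have it: "pinv ?c t = n" using ci[of n] by (simp add: ct)
  have bound: "pinv \<tau> x < n" if "x < n" for x using permutes_in_image[OF tp, of x] that by simp
  have surj: "\<exists>x<n. y = ?c x" if "y < Suc n" "y \<noteq> t" for y
    using that assms(1)
    by (intro exI[of _ "if y < t then y else y - 1"]) (auto simp: skip_at_def)
  have mono: "?c x < ?c y \<longleftrightarrow> x < y" if "x < n" "y < n" for x y
    using that assms(1) by (auto simp: skip_at_def)
  have cb: "?c x < Suc n" "?c x \<noteq> t" if "x < n" for x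
    using that assms(1) by (auto simp: skip_at_def)
  have mem: "(x, y) \<in> ?L \<longleftrightarrow> x < y \<and> y < Suc n \<and> pinv \<tau> (pinv ?c y) < pinv \<tau> (pinv ?c x)" for x y
    unfolding p by (simp add: inversions_def)
  show ?thesis
  proof
    show "?L \<subseteq> ?R"
    proof (rule subrelI)
      fix x y assume xy: "(x, y) \<in> ?L"
      show "(x, y) \<in> ?R"
      proof (cases "x = t")
        case True
        then show ?thesis using xy unfolding mem by auto
      next
        case False
        then obtain x' where x': "x' < n" "x = ?c x'" using surj[of x] xy unfolding mem by auto
        have "y \<noteq> t"
        proof
          assume "y = t"
          then have "n < pinv \<tau> x'" using xy unfolding mem by (simp add: it tn x'(2) ci)
          then show False using bound[OF x'(1)] by simp
        qed
        then obtain y' where y': "y' < n" "y = ?c y'" using surj[of y] xy unfolding mem by auto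
        have "(x', y') \<in> inversions n (pinv \<tau>)"
          using xy mono[OF x'(1) y'(1)] y'(1) 
          unfolding mem x'(2) y'(2) ci by (simp add: inversions_def)
        then have "map_prod ?c ?c (x', y') \<in> map_prod ?c ?c ` inversions n (pinv \<tau>)" by (rule imageI)
        then show ?thesis using x'(2) y'(2) by simp
      qed
    qed
    show "?R \<subseteq> ?L"
    proof (rule Un_least)
      show "(\<lambda>y. (t, y)) ` {t<..n} \<subseteq> ?L"
      proof (rule image_subsetI)
        fix y assume y: "y \<in> {t<..n}"
        then obtain y' where y': "y' < n" "y = ?c y'" using surj[of y] by auto
        show "(t, y) \<in> ?L" unfolding mem it tn using y bound[OF y'(1)] by (simp add: y'(2) ci)
      qed
      show "map_prod ?c ?c ` inversions n (pinv \<tau>) \<subseteq> ?L"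
      proof (rule image_subsetI)
        fix z assume "z \<in> inversions n (pinv \<tau>)"
        then obtain x y where z: "z = (x, y)" "x < y" "y < n" "pinv \<tau> y < pinv \<tau> x"
          by (auto simp: inversions_def)
        have "(?c x, ?c y) \<in> ?L" unfolding mem ci using z mono[of x y] cb[of y] by simp
        then show "map_prod ?c ?c z \<in> ?L" using z(1) by simp
      qed
    qed
  qed
qed

lemma inv_weight_skip_at:
  assumes "t \<le> n" "\<tau> permutes {..<n}"
  shows "inv_weight q (Suc n) (pinv (skip_at n t \<circ> \<tau>)) u =
    (\<Prod>y\<in>{t<..n}. q (u t) (u y)) * inv_weight q n (pinv \<tau>) (u \<circ> skip_at n t)"
proof -
  let ?c = "skip_at n t"
  have inj: "inj (map_prod ?c ?c)"
    using permutes_inj[OF skip_at_permutes[OF assms(1)]] by (intro prod.inj_map)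
  have cb: "?c x \<noteq> t" if "x < n" for x
    using that assms(1) by (auto simp: skip_at_def)
  have disj: "(\<lambda>y. (t, y)) ` {t<..n} \<inter> map_prod ?c ?c ` inversions n (pinv \<tau>) = {}"
  proof -
    have "?c x \<noteq> t" if "(x, y) \<in> inversions n (pinv \<tau>)" for x y
      by (rule cb) (use that in \<open>auto simp: inversions_def\<close>)
    then show ?thesis by force
  qed
  have "(\<Prod>(x, y)\<in>(\<lambda>y. (t, y)) ` {t<..n}. q (u x) (u y)) = (\<Prod>y\<in>{t<..n}. q (u t) (u y))"
    by (subst prod.reindex) (auto simp: inj_on_def)
  moreover have "(\<Prod>(x, y)\<in>map_prod ?c ?c ` inversions n (pinv \<tau>). q (u x) (u y)) =
      inv_weight q n (pinv \<tau>) (u \<circ> ?c)"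
    unfolding inv_weight_def
    by (subst prod.reindex, rule inj_on_subset[OF inj]) (auto intro: prod.cong simp: case_prod_beta)
  ultimately show ?thesis
    unfolding inv_weight_def[of q "Suc n"] inversions_skip_at[OF assms]
    by (subst prod.union_disjoint) (use disj in auto)
qed

section \<open>Matrix coefficients of the quantum symmetrizer as shuffle products\<close>

lemma (in rank2_braiding) word_kappa_prod: "word_kappa j w = (\<Prod>y<length w. braid_coeff j (w ! y))"
proof (induction w)
  case Nil
  show ?case unfolding word_kappa_Nil by simp
next
  case (Cons l w)
  show ?case
    unfolding word_kappa_Cons Cons list.size(4) add_Suc_right add_0_right prod.lessThan_Suc_shift by simp
qed

lemma (in rank2_braiding) shuffle_sum:
  "shuffle j f u = (\<Sum>t<length u. if u ! t = j then word_kappa j (drop (Suc t) u) * f (take t u @ drop (Suc t) u) else 0)"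
proof (induction u arbitrary: f)
  case (Cons i u)
  show ?case
    unfolding insert_letter.simps Cons[of "\<lambda>v. f (i # v)"] list.size(4) add_Suc_right add_0_right
      sum.lessThan_Suc_shift by (simp cong: if_cong)
qed simp

text \<open>The symmetrizer factors over the cosets given by \<open>skip_at\<close>: the last letter
  of \<open>w\<close> goes to position \<open>t\<close> of \<open>u\<close> with the weight of the
  part to its right, which is one shuffle, and the rest is a smaller symmetrizer. The last letter is
  inserted outermost, hence \<open>rev\<close>.\<close>

lemma (in rank2_braiding) symmetrizer_sum:
  assumes "length u = length w"
  shows "(\<Sum>\<sigma> | \<sigma> permutes {..<length w}.
      if \<forall>x<length w. u ! \<sigma> x = w ! x then inv_weight braid_coeff (length w) (pinv \<sigma>) ((!) u) else 0)
    = foldr shuffle (rev w) delta u"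
  using assms
proof (induction w arbitrary: u rule: rev_induct)
  case Nil
  have "inversions 0 p = {}" for p by (auto simp: inversions_def)
  then show ?case using Nil by (simp add: delta_def inv_weight_def)
next
  case (snoc j w)
  define n where "n = length w"
  have lu: "length u = Suc n" using snoc.prems by (simp add: n_def)
  define del where "del t = take t u @ drop (Suc t) u" for t
  have ldel: "length (del t) = n" if "t < Suc n" for t using that lu by (simp add: del_def)
  have del: "del t ! x = u ! skip_at n t x" if "t < Suc n" "x < n" for t x
    using that lu by (auto simp: del_def nth_append skip_at_def)
  have cond: "(\<forall>x<Suc n. u ! (skip_at n t \<circ> \<tau>) x = (w @ [j]) ! x) \<longleftrightarrow>
      u ! t = j \<and> (\<forall>x<n. del t ! \<tau> x = w ! x)" if t: "t < Suc n" and \<tau>: "\<tau> permutes {..<n}" for t \<tau>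
  proof -
    have "\<tau> n = n" using \<tau> by (simp add: permutes_def)
    moreover have "\<tau> x < n" if "x < n" for x using permutes_in_image[OF \<tau>, of x] that by simp
    moreover have "skip_at n t n = t" using t by (simp add: skip_at_def)
    ultimately show ?thesis
      using del[OF t] by (auto simp: less_Suc_eq nth_append n_def)
  qed
  have weight: "inv_weight braid_coeff (Suc n) (pinv (skip_at n t \<circ> \<tau>)) ((!) u) =
      word_kappa (u ! t) (drop (Suc t) u) * inv_weight braid_coeff n (pinv \<tau>) ((!) (del t))"
    if t: "t < Suc n" and \<tau>: "\<tau> permutes {..<n}" for t \<tau>
  proof -
    have "(\<Prod>y\<in>{t<..n}. braid_coeff (u ! t) (u ! y)) = word_kappa (u ! t) (drop (Suc t) u)"
      unfolding word_kappa_prod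
      by (rule prod.reindex_bij_witness[where i = "\<lambda>y. y + Suc t" and j = "\<lambda>y. y - Suc t"])
        (use t lu in auto)
    moreover have "inv_weight braid_coeff n (pinv \<tau>) ((!) u \<circ> skip_at n t) = inv_weight braid_coeff n (pinv \<tau>) ((!) (del t))"
      unfolding inv_weight_def
      by (rule prod.cong) (auto simp: inversions_def del[OF t])
    ultimately show ?thesis using t by (simp add: inv_weight_skip_at[OF _ \<tau>])
  qed
  have "(\<Sum>\<sigma> | \<sigma> permutes {..<Suc n}.
      if \<forall>x<Suc n. u ! \<sigma> x = (w @ [j]) ! x then inv_weight braid_coeff (Suc n) (pinv \<sigma>) ((!) u) else 0)
    = (\<Sum>t<Suc n. \<Sum>\<tau> | \<tau> permutes {..<n}. (if u ! t = j then word_kappa j (drop (Suc t) u) *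
        (if \<forall>x<n. del t ! \<tau> x = w ! x then inv_weight braid_coeff n (pinv \<tau>) ((!) (del t)) else 0) else 0))"
    unfolding sum_permutations_skip_at
    by (intro sum.cong refl) (auto simp: cond weight simp del: o_apply)
  also have "\<dots> = (\<Sum>t<Suc n. if u ! t = j then word_kappa j (drop (Suc t) u) *
      (\<Sum>\<tau> | \<tau> permutes {..<n}. if \<forall>x<n. del t ! \<tau> x = w ! x
         then inv_weight braid_coeff n (pinv \<tau>) ((!) (del t)) else 0) else 0)"
    by (intro sum.cong refl) (simp add: sum_distrib_left)
  also have "\<dots> = (\<Sum>t<Suc n. if u ! t = j then word_kappa j (drop (Suc t) u) * foldr shuffle (rev w) delta (del t) else 0)"
    using snoc.IH[OF ldel[unfolded n_def]] by (intro sum.cong refl) (simp add: n_def cong: if_cong)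
  also have "\<dots> = shuffle j (foldr shuffle (rev w) delta) u"
    unfolding shuffle_sum lu del_def ..
  moreover have "length (w @ [j]) = Suc n" by (simp add: n_def)
  ultimately show ?case by (simp only:) simp
qed

section \<open>Coordinates on the induced module\<close>

definition pair :: "('a \<Rightarrow> 'k) \<Rightarrow> ('a \<Rightarrow>\<^sub>0 'k::field) \<Rightarrow> 'k" where
  "pair \<mu> f = (\<Sum>x\<in>Poly_Mapping.keys f. Poly_Mapping.lookup f x * \<mu> x)"

lemma pair_superset:
  assumes "finite S" "Poly_Mapping.keys f \<subseteq> S"
  shows "pair \<mu> f = (\<Sum>x\<in>S. Poly_Mapping.lookup f x * \<mu> x)"
  unfolding pair_def using assms
  by (intro sum.mono_neutral_left) (auto simp: in_keys_iff)

lemma pair_add: "pair \<mu> (f + g) = pair \<mu> f + pair \<mu> g"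
proof -
  let ?S = "Poly_Mapping.keys f \<union> Poly_Mapping.keys g"
  have "Poly_Mapping.keys (f + g) \<subseteq> ?S" by (rule Poly_Mapping.keys_add)
  then show ?thesis
    by (simp add: pair_superset[of ?S] lookup_add distrib_right sum.distrib)
qed

lemma pair_scale: "pair \<mu> (free_scale c f) = c * pair \<mu> f"
proof -
  have "Poly_Mapping.keys (free_scale c f) \<subseteq> Poly_Mapping.keys f"
    by (auto simp: in_keys_iff)
  then show ?thesis
    by (simp add: pair_superset[of "Poly_Mapping.keys f"] sum_distrib_left mult.assoc)
qed

lemma pair_zero [simp]: "pair \<mu> 0 = 0"
  by (simp add: pair_def)

lemma pair_diff: "pair \<mu> (f - g) = pair \<mu> f - pair \<mu> g"
  using pair_add[of \<mu> "f - g" g] by simp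

lemma pair_sum: "pair \<mu> (\<Sum>i\<in>I. h i) = (\<Sum>i\<in>I. pair \<mu> (h i))"
  by (induction I rule: infinite_finite_induct) (simp_all add: pair_add)

lemma pair_basis [simp]: "pair \<mu> (basis_vec x) = \<mu> x"
  by (simp add: pair_def)

lemma pair_free_extend: "pair \<mu> (free_extend \<phi> f) = pair (\<lambda>x. pair \<mu> (\<phi> x)) f"
  unfolding free_extend_def pair_sum pair_scale by (simp add: pair_def)

lemma pair_cong:
  "(\<And>x. x \<in> Poly_Mapping.keys f \<Longrightarrow> \<mu> x = \<nu> x) \<Longrightarrow> pair \<mu> f = pair \<nu> f"
  unfolding pair_def by (intro sum.cong) auto

lemma pair_mult_left: "pair (\<lambda>x. c * \<mu> x) f = c * pair \<mu> f"
  unfolding pair_def by (simp add: sum_distrib_left mult.left_commute)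

text \<open>Coefficients are pairings too, so identities between linear extensions reduce to the
  linearity of \<open>pair\<close>.\<close>

lemma lookup_pair: "Poly_Mapping.lookup f x = pair (\<lambda>y. if y = x then 1 else 0) f"
  by (simp add: pair_def in_keys_iff if_distrib cong: if_cong)

lemma free_extend_add: "free_extend \<phi> (f + g) = free_extend \<phi> f + free_extend \<phi> g"
  by (rule poly_mapping_eqI) (simp add: lookup_pair pair_add pair_free_extend)

lemma free_extend_scale: "free_extend \<phi> (free_scale c f) = free_scale c (free_extend \<phi> f)"
  by (rule poly_mapping_eqI) (simp add: lookup_pair[of "free_extend _ _"] lookup_pair[of "free_scale _ (free_extend _ _)"]
      pair_scale pair_free_extend del: lookup_free_scale)

lemma free_extend_zero [simp]: "free_extend \<phi> 0 = 0"
  by (simp add: free_extend_def)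

lemma free_extend_diff: "free_extend \<phi> (f - g) = free_extend \<phi> f - free_extend \<phi> g"
  using free_extend_add[of \<phi> "f - g" g] by simp

lemma free_extend_basis [simp]: "free_extend \<phi> (basis_vec x) = \<phi> x"
  by (rule poly_mapping_eqI) (simp add: lookup_pair[of "free_extend _ _"] lookup_pair[of "\<phi> x"] pair_free_extend)

lemma pair_span_eq_0:
  assumes "f \<in> free_vs.span S" "\<And>x. x \<in> S \<Longrightarrow> pair \<mu> x = 0"
  shows "pair \<mu> f = 0"
  using assms(1)
proof (induction rule: free_vs.span_induct)
  case (step x)
  then show ?case using assms(2) by simp
next
  case base
  show ?case by (auto simp: free_vs.subspace_def pair_add pair_scale)
qed

lemma free_extend_span:
  assumes "f \<in> free_vs.span S" "\<And>x. x \<in> S \<Longrightarrow> free_extend \<phi> x \<in> free_vs.span T"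
  shows "free_extend \<phi> f \<in> free_vs.span T"
  using assms(1)
proof (induction rule: free_vs.span_induct)
  case (step x)
  then show ?case using assms(2) by simp
next
  case base
  show ?case
    by (auto simp: free_vs.subspace_def free_extend_add free_extend_scale
        intro: free_vs.span_add free_vs.span_scale free_vs.span_zero)
qed

lemma keys_free_extend:
  "Poly_Mapping.keys (free_extend \<phi> f) \<subseteq> (\<Union>x\<in>Poly_Mapping.keys f. Poly_Mapping.keys (\<phi> x))"
proof
  fix z assume "z \<in> Poly_Mapping.keys (free_extend \<phi> f)"
  then have "pair (\<lambda>x. Poly_Mapping.lookup (\<phi> x) z) f \<noteq> 0"
    by (simp add: in_keys_iff lookup_pair pair_free_extend)
  then show "z \<in> (\<Union>x\<in>Poly_Mapping.keys f. Poly_Mapping.keys (\<phi> x))"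
    using pair_cong[of f "\<lambda>x. Poly_Mapping.lookup (\<phi> x) z" "\<lambda>x. 0"]
    by (auto simp: in_keys_iff) (metis (no_types, lifting) mult_zero_right pair_def sum.neutral)
qed

section \<open>The induced module and its coordinates at two commuting conjugates\<close>

locale induced_braiding = group G for G :: "('g, 'b) monoid_scheme" (structure) +
  fixes g :: 'g and ch :: "'g \<Rightarrow> 'k::field" and y t :: "bool \<Rightarrow> 'g" and q :: "bool \<Rightarrow> bool \<Rightarrow> 'k"
  assumes fin: "finite (carrier G)" and g: "g \<in> carrier G"
    and ch: "ch \<in> characters G (centralizer G g)"
    and y: "y b \<in> carrier G" and t: "t b = y b \<otimes> g \<otimes> inv (y b)"
    and t_neq: "t True \<noteq> t False"
    and comm: "inv (y c) \<otimes> t b \<otimes> y c \<in> centralizer G g"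
    and q: "q b c = ch (inv (y c) \<otimes> t b \<otimes> y c)"
begin

abbreviation Zg where "Zg \<equiv> centralizer G g"
abbreviation R where "R \<equiv> induced_relations G g ch"
abbreviation V where "V \<equiv> induced_module G g ch"

lemma Z_carrier: "z \<in> Zg \<Longrightarrow> z \<in> carrier G"
  by (simp add: centralizer_def)

lemma t_carrier: "t b \<in> carrier G"
  using t y g by simp

lemma Z_subgroup: "subgroup Zg G"
proof (rule subgroupI)
  show "Zg \<subseteq> carrier G" by (auto simp: centralizer_def)
  show "Zg \<noteq> {}" using g by (auto simp: centralizer_def)
  show "inv a \<in> Zg" if "a \<in> Zg" for a
  proof -
    have a: "a \<in> carrier G" "a \<otimes> g = g \<otimes> a" using that by (auto simp: centralizer_def)
    have "inv a \<otimes> g = inv a \<otimes> (g \<otimes> a) \<otimes> inv a" using a(1) g by (simp add: m_assoc)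
    also have "\<dots> = g \<otimes> inv a" unfolding a(2)[symmetric] using a(1) g by (simp add: m_assoc[symmetric])
    finally show ?thesis using a by (simp add: centralizer_def)
  qed
  show "a \<otimes> b \<in> Zg" if "a \<in> Zg" "b \<in> Zg" for a b
    using that g by (auto simp: centralizer_def m_assoc) (metis m_assoc)
qed

lemma ch_mult: "a \<in> Zg \<Longrightarrow> b \<in> Zg \<Longrightarrow> ch (a \<otimes> b) = ch a * ch b"
  using ch by (auto simp: characters_def hom_def mult_group_of_field_def)

lemma ch_one: "ch \<one> = 1"
proof -
  have one: "\<one> \<in> Zg" using g by (simp add: centralizer_def)
  then have "ch \<one> \<noteq> 0" using ch by (auto simp: characters_def hom_def mult_group_of_field_def)
  moreover have "ch \<one> = ch \<one> * ch \<one>" using ch_mult[OF one one] by simp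
  ultimately show ?thesis by simp
qed

text \<open>The functional dual to \<open>y b\<close>, extended by the character along the coset of
  \<open>y b\<close> and by zero elsewhere. This extension is compatible with the relations of the
  induced module.\<close>

definition coord :: "bool \<Rightarrow> 'g \<Rightarrow> 'k" where
  "coord b h = (if h \<in> carrier G \<and> inv (y b) \<otimes> h \<in> Zg then ch (inv (y b) \<otimes> h) else 0)"

lemma Z_mult_cancel_right:
  assumes "z \<in> Zg" "h \<in> carrier G"
  shows "h \<otimes> z \<in> Zg \<longleftrightarrow> h \<in> Zg"
proof
  assume "h \<otimes> z \<in> Zg"
  then have "(h \<otimes> z) \<otimes> inv z \<in> Zg"
    using assms(1) Z_subgroup by (blast intro: subgroup.m_closed subgroup.m_inv_closed)
  then show "h \<in> Zg" using assms Z_carrier by (simp add: m_assoc)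
qed (use assms(1) Z_subgroup in \<open>blast intro: subgroup.m_closed\<close>)

lemma Z_mult_cancel_left:
  assumes "z \<in> Zg" "h \<in> carrier G"
  shows "z \<otimes> h \<in> Zg \<longleftrightarrow> h \<in> Zg"
proof
  assume "z \<otimes> h \<in> Zg"
  then have "inv z \<otimes> (z \<otimes> h) \<in> Zg"
    using assms(1) Z_subgroup by (blast intro: subgroup.m_closed subgroup.m_inv_closed)
  then show "h \<in> Zg" using assms Z_carrier by (simp add: m_assoc[symmetric])
qed (use assms(1) Z_subgroup in \<open>blast intro: subgroup.m_closed\<close>)

lemma coord_right:
  assumes "h \<in> carrier G" "z \<in> Zg"
  shows "coord b (h \<otimes> z) = ch z * coord b h"
proof -
  have z: "z \<in> carrier G" using assms(2) by (rule Z_carrier)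
  have "inv (y b) \<otimes> (h \<otimes> z) = (inv (y b) \<otimes> h) \<otimes> z" using assms(1) z y by (simp add: m_assoc)
  moreover have "(inv (y b) \<otimes> h) \<otimes> z \<in> Zg \<longleftrightarrow> inv (y b) \<otimes> h \<in> Zg"
    by (rule Z_mult_cancel_right[OF assms(2)]) (use assms(1) y in simp)
  ultimately show ?thesis
    using assms z by (auto simp: coord_def ch_mult)
qed

text \<open>Moving \<open>t c\<close> past \<open>y b\<close> produces the centralizer element
  \<open>inv (y b) \<otimes> t c \<otimes> y b\<close>; so \<open>q c b\<close> is the scalar by
  which \<open>t c\<close> acts at \<open>y b\<close>.\<close>

lemma coord_left:
  assumes "h \<in> carrier G"
  shows "coord b (t c \<otimes> h) = q c b * coord b h"
proof -
  let ?z = "inv (y b) \<otimes> t c \<otimes> y b"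
  have e: "inv (y b) \<otimes> (t c \<otimes> h) = ?z \<otimes> (inv (y b) \<otimes> h)"
  proof -
    have "y b \<otimes> (inv (y b) \<otimes> h) = h" using assms y by (simp add: m_assoc[symmetric])
    then show ?thesis using assms y t_carrier by (simp add: m_assoc)
  qed
  have "?z \<otimes> (inv (y b) \<otimes> h) \<in> Zg \<longleftrightarrow> inv (y b) \<otimes> h \<in> Zg"
    by (rule Z_mult_cancel_left[OF comm]) (use assms y in simp)
  then show ?thesis
    unfolding coord_def e using assms t_carrier comm by (auto simp: ch_mult q)
qed

text \<open>The support of \<open>coord b\<close> lies in the coset of \<open>y b\<close>, on which
  conjugating \<open>g\<close> always gives \<open>t b\<close>.\<close>

lemma coord_degree:
  assumes "coord b h \<noteq> 0"
  shows "h \<otimes> g \<otimes> inv h = t b"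
proof -
  let ?z = "inv (y b) \<otimes> h"
  have h: "h \<in> carrier G" "?z \<in> Zg" using assms by (auto simp: coord_def split: if_splits)
  have z: "?z \<in> carrier G" "?z \<otimes> g = g \<otimes> ?z" using h(2) by (auto simp: centralizer_def)
  have hz: "h = y b \<otimes> ?z" using h(1) y by (simp add: m_assoc[symmetric])
  have "h \<otimes> g \<otimes> inv h = y b \<otimes> ?z \<otimes> g \<otimes> inv (y b \<otimes> ?z)" using hz by simp
  also have "\<dots> = y b \<otimes> (?z \<otimes> g) \<otimes> inv ?z \<otimes> inv (y b)"
    using y g z(1) by (simp add: m_assoc inv_mult_group del: inv_inv)
  also have "\<dots> = y b \<otimes> g \<otimes> (?z \<otimes> inv ?z) \<otimes> inv (y b)"
    unfolding z(2) using y g z(1) by (simp add: m_assoc del: r_inv)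
  also have "\<dots> = t b" using y g z(1) by (simp add: t)
  finally show ?thesis .
qed

lemma coord_y: "coord b (y c) = (if b = c then 1 else 0)"
proof (cases "b = c")
  case True
  then show ?thesis using y ch_one g by (simp add: coord_def centralizer_def)
next
  case False
  have "coord b (y c) = 0"
  proof (rule ccontr)
    assume "coord b (y c) \<noteq> 0"
    from coord_degree[OF this] have "t c = t b" using t[of c] by simp
    then show False using t_neq False by (cases b; cases c) auto
  qed
  then show ?thesis using False by simp
qed

lemma coord_relations: "r \<in> R \<Longrightarrow> pair (coord b) r = 0"
  unfolding induced_relations_def
  by (erule pair_span_eq_0) (auto simp: pair_diff pair_scale coord_right)

lemma carrier_V: "carrier V = {coset_of R f |f. Poly_Mapping.keys f \<subseteq> carrier G}"
  by (simp add: induced_module_def Let_def)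

text \<open>The coordinate of an element of the induced module at \<open>y\<^sub>b \<otimes> 1\<close>.\<close>

definition ell :: "bool \<Rightarrow> ('g \<Rightarrow>\<^sub>0 'k) set \<Rightarrow> 'k" where
  "ell b C = pair (coord b) (SOME f. f \<in> C)"

lemma ell_eq:
  assumes "f \<in> C" "\<And>f'. f' \<in> C \<Longrightarrow> pair (coord b) f' = pair (coord b) f"
  shows "ell b C = pair (coord b) f"
  unfolding ell_def using assms by (metis someI_ex)

text \<open>The choice of a representative does not matter, because \<open>coord b\<close> vanishes
  on the relations.\<close>

lemma ell_coset: "ell b (coset_of R f) = pair (coord b) f"
proof (rule ell_eq)
  have "0 \<in> R" unfolding induced_relations_def by (rule free_vs.span_zero)
  then show "f \<in> coset_of R f" unfolding coset_of_def by force
qed (auto simp: coset_of_def pair_add coord_relations)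

lemma R_add: "r \<in> R \<Longrightarrow> r' \<in> R \<Longrightarrow> r + r' \<in> R"
  unfolding induced_relations_def by (rule free_vs.span_add)

lemma R_scale: "r \<in> R \<Longrightarrow> free_scale c r \<in> R"
  unfolding induced_relations_def by (rule free_vs.span_scale)

lemma R_zero: "0 \<in> R"
  unfolding induced_relations_def by (rule free_vs.span_zero)

lemma coset_map_coset:
  assumes "\<And>f f'. \<phi> (f + f') = \<phi> f + \<phi> f'" "\<And>r. r \<in> R \<Longrightarrow> \<phi> r \<in> R"
  shows "coset_map R \<phi> (coset_of R f) = coset_of R (\<phi> f)"
proof
  show "coset_map R \<phi> (coset_of R f) \<subseteq> coset_of R (\<phi> f)"
    unfolding coset_map_def coset_of_def using assms by (auto simp: add.assoc intro!: R_add)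
  show "coset_of R (\<phi> f) \<subseteq> coset_map R \<phi> (coset_of R f)"
  proof
    fix z assume "z \<in> coset_of R (\<phi> f)"
    then obtain r where "z = \<phi> f + r" "r \<in> R" unfolding coset_of_def by blast
    moreover have "f \<in> coset_of R f" unfolding coset_of_def using R_zero by force
    ultimately show "z \<in> coset_map R \<phi> (coset_of R f)" unfolding coset_map_def by blast
  qed
qed

lemma add_coset: "coset_of R f \<oplus>\<^bsub>V\<^esub> coset_of R f' = coset_of R (f + f')"
proof -
  have "coset_of R f \<oplus>\<^bsub>V\<^esub> coset_of R f' = {c + d |c d. c \<in> coset_of R f \<and> d \<in> coset_of R f'}"
    by (simp add: induced_module_def Let_def)
  also have "\<dots> = coset_of R (f + f')"
  proof (intro equalityI subsetI)
    fix z assume "z \<in> {c + d |c d. c \<in> coset_of R f \<and> d \<in> coset_of R f'}"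
    then obtain r r' where "z = (f + r) + (f' + r')" "r \<in> R" "r' \<in> R"
      unfolding coset_of_def by blast
    then have "z = (f + f') + (r + r')" "r + r' \<in> R" by (simp_all add: algebra_simps R_add)
    then show "z \<in> coset_of R (f + f')" unfolding coset_of_def by blast
  next
    fix z assume "z \<in> coset_of R (f + f')"
    then obtain r where r: "z = (f + 0) + (f' + r)" "r \<in> R"
      unfolding coset_of_def by (auto simp: algebra_simps)
    then show "z \<in> {c + d |c d. c \<in> coset_of R f \<and> d \<in> coset_of R f'}"
      unfolding coset_of_def using R_zero by blast
  qed
  finally show ?thesis .
qed

lemma smult_coset: "c \<odot>\<^bsub>V\<^esub> coset_of R f = coset_of R (free_scale c f)"
proof -
  have "c \<odot>\<^bsub>V\<^esub> coset_of R f = coset_map R (free_scale c) (coset_of R f)"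
    by (simp add: induced_module_def Let_def)
  then show ?thesis
    by (simp add: coset_map_coset free_vs.scale_right_distrib R_scale)
qed

lemma action_coset:
  assumes "h \<in> carrier G"
  shows "action V h (coset_of R f) = coset_of R (free_extend (\<lambda>x. basis_vec (h \<otimes> x)) f)"
proof -
  have "action V h (coset_of R f) = coset_map R (free_extend (\<lambda>x. basis_vec (h \<otimes> x))) (coset_of R f)"
    by (simp add: induced_module_def Let_def)
  moreover have "free_extend (\<lambda>x. basis_vec (h \<otimes> x)) r \<in> R" if "r \<in> R" for r
    using that unfolding induced_relations_def
  proof (rule free_extend_span)
    fix x assume "x \<in> {basis_vec (h \<otimes> z) - free_scale (ch z) (basis_vec h) |h z. h \<in> carrier G \<and> z \<in> Zg}"
    then obtain k z where x: "x = basis_vec (k \<otimes> z) - free_scale (ch z) (basis_vec k)"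
      "k \<in> carrier G" "z \<in> Zg" by blast
    have "free_extend (\<lambda>x. basis_vec (h \<otimes> x)) x =
        basis_vec ((h \<otimes> k) \<otimes> z) - free_scale (ch z) (basis_vec (h \<otimes> k))"
      using x assms Z_carrier by (simp add: free_extend_diff free_extend_scale m_assoc)
    then show "free_extend (\<lambda>x. basis_vec (h \<otimes> x)) x \<in> free_vs.span
        {basis_vec (h \<otimes> z) - free_scale (ch z) (basis_vec h) |h z. h \<in> carrier G \<and> z \<in> Zg}"
      using x assms by (intro free_vs.span_base) blast
  qed
  ultimately show ?thesis by (simp add: coset_map_coset free_extend_add)
qed

lemma component_coset:
  "component V d (coset_of R f) =
     coset_of R (free_extend (\<lambda>h. if h \<otimes> g \<otimes> inv h = d then basis_vec h else 0) f)"
proof -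
  let ?\<phi> = "\<lambda>h. if h \<otimes> g \<otimes> inv h = d then basis_vec h else 0 :: 'g \<Rightarrow>\<^sub>0 'k"
  have "component V d (coset_of R f) = coset_map R (free_extend ?\<phi>) (coset_of R f)"
    by (simp add: induced_module_def Let_def)
  moreover have "free_extend ?\<phi> r \<in> R" if "r \<in> R" for r
    using that unfolding induced_relations_def
  proof (rule free_extend_span)
    fix x assume x': "x \<in> {basis_vec (h \<otimes> z) - free_scale (ch z) (basis_vec h) |h z. h \<in> carrier G \<and> z \<in> Zg}"
    then obtain k z where x: "x = basis_vec (k \<otimes> z) - free_scale (ch z) (basis_vec k)"
      "k \<in> carrier G" "z \<in> Zg" by blast
    have z: "z \<in> carrier G" "z \<otimes> g = g \<otimes> z" using x(3) by (auto simp: centralizer_def)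
    have "(k \<otimes> z) \<otimes> g \<otimes> inv (k \<otimes> z) = k \<otimes> (z \<otimes> g) \<otimes> inv z \<otimes> inv k"
      using x(2) z(1) g by (simp add: m_assoc inv_mult_group)
    also have "\<dots> = k \<otimes> g \<otimes> (z \<otimes> inv z) \<otimes> inv k"
      unfolding z(2) using x(2) z(1) g by (simp add: m_assoc del: r_inv)
    also have "\<dots> = k \<otimes> g \<otimes> inv k" using x(2) z(1) g by simp
    finally have "free_extend ?\<phi> x = (if k \<otimes> g \<otimes> inv k = d then x else 0)"
      unfolding x(1) by (simp add: free_extend_diff free_extend_scale)
    then show "free_extend ?\<phi> x \<in> free_vs.span
        {basis_vec (h \<otimes> z) - free_scale (ch z) (basis_vec h) |h z. h \<in> carrier G \<and> z \<in> Zg}"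
      using x' by (auto intro: free_vs.span_base free_vs.span_zero)
  qed
  ultimately show ?thesis by (simp add: coset_map_coset free_extend_add)
qed

lemma action_carrier:
  assumes "h \<in> carrier G" "C \<in> carrier V"
  shows "action V h C \<in> carrier V"
proof -
  obtain f where f: "C = coset_of R f" "Poly_Mapping.keys f \<subseteq> carrier G"
    using assms(2) by (auto simp: carrier_V)
  have "Poly_Mapping.keys (free_extend (\<lambda>x. basis_vec (h \<otimes> x) :: 'g \<Rightarrow>\<^sub>0 'k) f) \<subseteq> carrier G"
    using keys_free_extend[of "\<lambda>x. basis_vec (h \<otimes> x)" f] f(2) assms(1) by fastforce
  then show ?thesis unfolding f(1) action_coset[OF assms(1)] carrier_V by blast
qed

lemma component_carrier:
  assumes "C \<in> carrier V"
  shows "component V d C \<in> carrier V"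
proof -
  obtain f where f: "C = coset_of R f" "Poly_Mapping.keys f \<subseteq> carrier G"
    using assms by (auto simp: carrier_V)
  have "Poly_Mapping.keys (free_extend (\<lambda>h. if h \<otimes> g \<otimes> inv h = d then basis_vec h else 0 :: 'g \<Rightarrow>\<^sub>0 'k) f)
      \<subseteq> carrier G"
    using keys_free_extend[of "\<lambda>h. if h \<otimes> g \<otimes> inv h = d then basis_vec h else 0" f] f(2)
    by (fastforce split: if_splits)
  then show ?thesis unfolding f(1) component_coset carrier_V by blast
qed

lemma ell_action:
  assumes "C \<in> carrier V"
  shows "ell b (action V (t c) C) = q c b * ell b C"
proof -
  obtain f where f: "C = coset_of R f" "Poly_Mapping.keys f \<subseteq> carrier G"
    using assms by (auto simp: carrier_V)
  have "ell b (action V (t c) C) = pair (\<lambda>x. coord b (t c \<otimes> x)) f"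
    unfolding f(1) action_coset[OF t_carrier] ell_coset pair_free_extend by simp
  also have "\<dots> = pair (\<lambda>x. q c b * coord b x) f"
    by (rule pair_cong) (use f(2) in \<open>auto simp: coord_left\<close>)
  finally show ?thesis unfolding f(1) ell_coset pair_mult_left .
qed

lemma ell_component:
  assumes "C \<in> carrier V"
  shows "ell b (component V d C) = (if d = t b then ell b C else 0)"
proof -
  obtain f where f: "C = coset_of R f" "Poly_Mapping.keys f \<subseteq> carrier G"
    using assms by (auto simp: carrier_V)
  have "ell b (component V d C) = pair (\<lambda>x. if x \<otimes> g \<otimes> inv x = d then coord b x else 0) f"
    unfolding f(1) component_coset ell_coset pair_free_extend
    by (rule pair_cong) simp
  also have "\<dots> = pair (\<lambda>x. (if d = t b then 1 else 0) * coord b x) f"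
    by (rule pair_cong) (auto dest: coord_degree)
  finally show ?thesis unfolding f(1) ell_coset pair_mult_left by simp
qed

lemma ell_add:
  "C \<in> carrier V \<Longrightarrow> D \<in> carrier V \<Longrightarrow> ell b (C \<oplus>\<^bsub>V\<^esub> D) = ell b C + ell b D"
  by (auto simp: carrier_V add_coset ell_coset pair_add)

lemma ell_smult: "C \<in> carrier V \<Longrightarrow> ell b (c \<odot>\<^bsub>V\<^esub> C) = c * ell b C"
  by (auto simp: carrier_V smult_coset ell_coset pair_scale)

end

section \<open>Diagonal braidings inside the Nichols algebra\<close>

context induced_braiding
begin

text \<open>It is easier to evaluate tensors on products of coordinate functionals than to restrict the
  braiding: the functionals for \<open>y\<^sub>b \<otimes> 1\<close> see only one summand of the braiding of any two vectors.\<close>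

fun word_pairing :: "bool list \<Rightarrow> ('g \<Rightarrow>\<^sub>0 'k) set list \<Rightarrow> 'k" where
  "word_pairing [] [] = 1"
| "word_pairing (b # u) (x # w) = ell b x * word_pairing u w"
| "word_pairing _ _ = 0"

lemma word_pairing_append:
  "word_pairing u (us @ ws) = word_pairing (take (length us) u) us * word_pairing (drop (length us) u) ws"
proof (induction us arbitrary: u)
  case (Cons x us)
  then show ?case by (cases u) (simp_all add: mult.assoc)
qed simp

lemma word_pairing_append_eq:
  "length u = length us \<Longrightarrow> word_pairing (u @ v) (us @ ws) = word_pairing u us * word_pairing v ws"
  unfolding word_pairing_append by simp

text \<open>Products of coordinates are multilinear, so they are well defined on the tensor
  algebra.\<close>

lemma tensor_relations_pairing:
  assumes "f \<in> tensor_relations V"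
  shows "pair (word_pairing u) f = 0"
  using assms unfolding tensor_relations_def
proof (rule pair_span_eq_0)
  fix x
  assume x: "x \<in> {basis_vec (us @ [v \<oplus>\<^bsub>V\<^esub> w] @ ws) - basis_vec (us @ [v] @ ws) - basis_vec (us @ [w] @ ws) |us v w ws.
        us \<in> lists (carrier V) \<and> v \<in> carrier V \<and> w \<in> carrier V \<and> ws \<in> lists (carrier V)} \<union>
     {basis_vec (us @ [a \<odot>\<^bsub>V\<^esub> v] @ ws) - free_scale a (basis_vec (us @ [v] @ ws)) |us a v ws.
        us \<in> lists (carrier V) \<and> v \<in> carrier V \<and> ws \<in> lists (carrier V)}"
  have add: "word_pairing u (us @ [v \<oplus>\<^bsub>V\<^esub> w] @ ws) =
      word_pairing u (us @ [v] @ ws) + word_pairing u (us @ [w] @ ws)"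
    if "v \<in> carrier V" "w \<in> carrier V" for us v w ws
    unfolding word_pairing_append[of u us]
    by (cases "drop (length us) u") (simp_all add: ell_add[OF that] algebra_simps)
  have smult: "word_pairing u (us @ [c \<odot>\<^bsub>V\<^esub> v] @ ws) = c * word_pairing u (us @ [v] @ ws)"
    if "v \<in> carrier V" for us c v ws
    unfolding word_pairing_append[of u us]
    by (cases "drop (length us) u") (simp_all add: ell_smult[OF that] algebra_simps)
  from x show "pair (word_pairing u) x = 0"
  proof
    assume "x \<in> {basis_vec (us @ [v \<oplus>\<^bsub>V\<^esub> w] @ ws) - basis_vec (us @ [v] @ ws) - basis_vec (us @ [w] @ ws) |us v w ws.
        us \<in> lists (carrier V) \<and> v \<in> carrier V \<and> w \<in> carrier V \<and> ws \<in> lists (carrier V)}"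
    then obtain us v w ws where
      e: "x = basis_vec (us @ [v \<oplus>\<^bsub>V\<^esub> w] @ ws) - basis_vec (us @ [v] @ ws) - basis_vec (us @ [w] @ ws)"
      "v \<in> carrier V" "w \<in> carrier V" by blast
    show ?thesis unfolding e(1) pair_diff pair_basis add[OF e(2,3)] by simp
  next
    assume "x \<in> {basis_vec (us @ [a \<odot>\<^bsub>V\<^esub> v] @ ws) - free_scale a (basis_vec (us @ [v] @ ws)) |us a v ws.
        us \<in> lists (carrier V) \<and> v \<in> carrier V \<and> ws \<in> lists (carrier V)}"
    then obtain us c v ws where
      e: "x = basis_vec (us @ [c \<odot>\<^bsub>V\<^esub> v] @ ws) - free_scale c (basis_vec (us @ [v] @ ws))"
      "v \<in> carrier V" by blast
    show ?thesis unfolding e(1) pair_diff pair_scale pair_basis smult[OF e(2)] by simp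
  qed
qed

abbreviation brd where "brd \<equiv> yd_braiding G V"

definition homog_words :: "nat \<Rightarrow> (('g \<Rightarrow>\<^sub>0 'k) set list \<Rightarrow>\<^sub>0 'k) set" where
  "homog_words n = {f. Poly_Mapping.keys f \<subseteq> {w \<in> lists (carrier V). length w = n}}"

lemma braid_at_homog_words:
  assumes "f \<in> homog_words n" "i + 1 < n"
  shows "braid_at brd i f \<in> homog_words n"
proof -
  have "z \<in> lists (carrier V) \<and> length z = n"
    if z: "z \<in> Poly_Mapping.keys (braid_at brd i f)" for z
  proof -
    obtain w where w: "w \<in> Poly_Mapping.keys f" "z \<in> Poly_Mapping.keys (free_extend
        (\<lambda>p. basis_vec (take i w @ p @ drop (i + 2) w) :: _ \<Rightarrow>\<^sub>0 'k) (brd (w ! i) (w ! (i + 1))))"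
      using z keys_free_extend unfolding braid_at_def by fast
    have wl: "w \<in> lists (carrier V)" "length w = n" using assms(1) w(1) by (auto simp: homog_words_def)
    have wi: "w ! i \<in> carrier V" "w ! (i + 1) \<in> carrier V"
      using wl assms(2) by (auto simp: in_lists_conv_set)
    obtain p where p: "p \<in> Poly_Mapping.keys (brd (w ! i) (w ! (i + 1)))"
      "z \<in> Poly_Mapping.keys (basis_vec (take i w @ p @ drop (i + 2) w) :: _ \<Rightarrow>\<^sub>0 'k)"
      using w(2) keys_free_extend by fast
    have zp: "z = take i w @ p @ drop (i + 2) w" using p(2) by simp
    have "Poly_Mapping.keys (\<Sum>h\<in>S. basis_vec [action V h (w ! (i + 1)), component V h (w ! i)] :: _ \<Rightarrow>\<^sub>0 'k)
        \<subseteq> {[action V h (w ! (i + 1)), component V h (w ! i)] |h. h \<in> S}" for S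
    proof (induction S rule: infinite_finite_induct)
      case (insert h S)
      then show ?case
        using Poly_Mapping.keys_add[of "basis_vec [action V h (w ! (i + 1)), component V h (w ! i)] :: _ \<Rightarrow>\<^sub>0 'k"
          "\<Sum>h\<in>S. basis_vec [action V h (w ! (i + 1)), component V h (w ! i)]"] by fastforce
    qed simp_all
    then obtain h where h: "h \<in> carrier G" "p = [action V h (w ! (i + 1)), component V h (w ! i)]"
      using p(1) unfolding yd_braiding_def by blast
    have "p \<in> lists (carrier V)" "length p = 2"
      using h wi by (simp_all add: action_carrier component_carrier)
    then show ?thesis
      unfolding zp using wl assms(2) by (auto simp: in_lists_conv_set dest: in_set_takeD in_set_dropD)
  qed
  then show ?thesis by (auto simp: homog_words_def)
qed

lemma upt_split: "i + 1 < n \<Longrightarrow> [0..<n] = [0..<i] @ [i, i + 1] @ [i + 2..<n]"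
  using upt_add_eq_append[of 0 i "n - i"] by (simp add: upt_conv_Cons)

text \<open>After braiding, the homogeneous component stands at position \<open>i + 1\<close>, and
  the coordinate there sees only the degree \<open>t (u (i + 1))\<close>. One summand of the
  braiding survives, and its action is the scalar \<open>q (u (i + 1)) (u i)\<close>; this order of
  the indices explains the swapped arguments of \<open>q\<close> in what follows.\<close>

lemma pair_braid_at:
  assumes "f \<in> homog_words n" "i + 1 < n"
  shows "pair (word_pairing (map u [0..<n])) (braid_at brd i f) =
    q (u (i + 1)) (u i) * pair (word_pairing (map (u \<circ> adj i) [0..<n])) f"
  unfolding braid_at_def pair_free_extend pair_mult_left[symmetric]
proof (rule pair_cong)
  fix w assume "w \<in> Poly_Mapping.keys f"
  then have w: "w \<in> lists (carrier V)" "length w = n" using assms(1) by (auto simp: homog_words_def)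
  let ?U = "map u [0..<i]" and ?W = "map u [i + 2..<n]"
  let ?x = "w ! i" and ?z = "w ! (i + 1)"
  have xz: "?x \<in> carrier V" "?z \<in> carrier V"
    using w assms(2) by (auto simp: in_lists_conv_set)
  have m1: "map u [0..<n] = ?U @ [u i, u (i + 1)] @ ?W"
    unfolding upt_split[OF assms(2)] by simp
  have m2: "map (u \<circ> adj i) [0..<n] = ?U @ [u (i + 1), u i] @ ?W"
    unfolding upt_split[OF assms(2)] by (simp add: Transposition.transpose_def)
  have ws: "w = take i w @ [?x, ?z] @ drop (i + 2) w"
    using w(2) assms(2) by (simp add: Cons_nth_drop_Suc)
  have len: "length ?U = length (take i w)" using w(2) assms(2) by simp
  have "word_pairing (map u [0..<n]) (take i w @ [action V h ?z, component V h ?x] @ drop (i + 2) w) =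
     word_pairing ?U (take i w) * word_pairing ?W (drop (i + 2) w) *
       (if h = t (u (i + 1)) then ell (u i) (action V h ?z) * ell (u (i + 1)) ?x else 0)" for h
    unfolding m1 word_pairing_append_eq[OF len] using xz by (simp add: ell_component)
  then have "(\<Sum>h\<in>carrier G. word_pairing (map u [0..<n])
        (take i w @ [action V h ?z, component V h ?x] @ drop (i + 2) w)) =
     (\<Sum>h\<in>carrier G. if h = t (u (i + 1)) then word_pairing ?U (take i w) * word_pairing ?W (drop (i + 2) w) *
       (ell (u i) (action V h ?z) * ell (u (i + 1)) ?x) else 0)"
    by (intro sum.cong) auto
  also have "\<dots> = word_pairing ?U (take i w) * word_pairing ?W (drop (i + 2) w) *
       (q (u (i + 1)) (u i) * ell (u i) ?z * ell (u (i + 1)) ?x)"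
    using fin t_carrier xz(2) by (simp add: ell_action)
  also have "\<dots> = q (u (i + 1)) (u i) * word_pairing (map (u \<circ> adj i) [0..<n]) w"
    by (subst (2) ws) (simp only: m2 word_pairing_append_eq[OF len], simp)
  finally show "pair (\<lambda>p. pair (word_pairing (map u [0..<n])) (basis_vec (take i w @ p @ drop (i + 2) w)))
      (brd ?x ?z) = q (u (i + 1)) (u i) * word_pairing (map (u \<circ> adj i) [0..<n]) w"
    unfolding yd_braiding_def pair_sum pair_basis .
qed

lemma pair_braid_word:
  assumes "f \<in> homog_words n" "\<forall>i\<in>set is. i + 1 < n"
  shows "foldr (\<lambda>i \<psi>. braid_at brd i \<circ> \<psi>) is id f \<in> homog_words n \<and>
    (\<forall>u. pair (word_pairing (map u [0..<n])) (foldr (\<lambda>i \<psi>. braid_at brd i \<circ> \<psi>) is id f) =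
      braid_word (\<lambda>x y. q y x) is (\<lambda>u. pair (word_pairing (map u [0..<n])) f) u)"
  using assms(2)
proof (induction "is")
  case Nil
  show ?case using assms(1) by (simp add: braid_word_def)
next
  case (Cons i "is")
  let ?f = "foldr (\<lambda>i \<psi>. braid_at brd i \<circ> \<psi>) is id f"
  have i: "i + 1 < n" using Cons.prems by simp
  have "\<forall>i\<in>set is. i + 1 < n" using Cons.prems by simp
  note IH = Cons.IH[OF this]
  note IH1 = conjunct1[OF IH] and IH2 = spec[OF conjunct2[OF IH]]
  have e: "foldr (\<lambda>i \<psi>. braid_at brd i \<circ> \<psi>) (i # is) id f = braid_at brd i ?f" by simp
  show ?case
    unfolding e braid_word_Cons pair_braid_at[OF IH1 i] IH2
    using braid_at_homog_words[OF IH1 i] by blast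
qed

lemma pair_braid_perm:
  assumes "f \<in> homog_words n" "\<sigma> permutes {..<n}"
  shows "pair (word_pairing (map u [0..<n])) (braid_perm brd n \<sigma> f) =
    inv_weight (\<lambda>x y. q y x) n (pinv \<sigma>) u * pair (word_pairing (map (u \<circ> \<sigma>) [0..<n])) f"
proof -
  define "is" where "is = (SOME is. is_reduced_expression n \<sigma> is)"
  have r: "is_reduced_expression n \<sigma> is"
    unfolding is_def by (rule someI_ex) (rule reduced_expression_exists[OF assms(2)])
  then have "\<forall>i\<in>set is. i + 1 < n"
    unfolding is_reduced_expression_def is_expression_def by blast
  from pair_braid_word[OF assms(1) this] show ?thesis
    unfolding braid_perm_def is_def[symmetric] braid_word_reduced[OF assms(2) r] by blast
qed

lemma braid_word_linear:
  "foldr (\<lambda>i \<psi>. braid_at c i \<circ> \<psi>) is id (f + f') =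
     foldr (\<lambda>i \<psi>. braid_at c i \<circ> \<psi>) is id f + foldr (\<lambda>i \<psi>. braid_at c i \<circ> \<psi>) is id f'"
  "foldr (\<lambda>i \<psi>. braid_at c i \<circ> \<psi>) is id (free_scale d f) =
     free_scale d (foldr (\<lambda>i \<psi>. braid_at c i \<circ> \<psi>) is id f)"
  by (induction "is") (simp_all add: braid_at_def free_extend_add free_extend_scale)

lemma pair_quantum_symmetrizer_linear:
  "pair \<mu> (quantum_symmetrizer c n (f + f')) =
     pair \<mu> (quantum_symmetrizer c n f) + pair \<mu> (quantum_symmetrizer c n f')"
  "pair \<mu> (quantum_symmetrizer c n (free_scale d f)) = d * pair \<mu> (quantum_symmetrizer c n f)"
  unfolding quantum_symmetrizer_def pair_sum braid_perm_def braid_word_linear pair_add pair_scale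
  by (simp_all add: sum.distrib sum_distrib_left)

lemma tensor_component_eq:
  assumes "\<And>w. w \<in> Poly_Mapping.keys f \<Longrightarrow> length w \<noteq> n"
  shows "tensor_component n f = 0"
proof (rule poly_mapping_eqI)
  fix w
  have "Poly_Mapping.lookup (tensor_component n f) w =
      pair (\<lambda>v. pair (\<lambda>z. if z = w then 1 else 0) (if length v = n then basis_vec v else 0)) f"
    unfolding lookup_pair tensor_component_def pair_free_extend ..
  also have "\<dots> = pair (\<lambda>v. 0) f" by (rule pair_cong) (use assms in auto)
  finally show "Poly_Mapping.lookup (tensor_component n f) w = Poly_Mapping.lookup 0 w"
    by (simp add: pair_def)
qed

abbreviation vec where "vec b \<equiv> coset_of R (basis_vec (y b) :: 'g \<Rightarrow>\<^sub>0 'k)"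

lemma vec_carrier: "vec b \<in> carrier V"
  unfolding carrier_V using y by fastforce

lemma word_pairing_vec:
  "length u = length w \<Longrightarrow> word_pairing u (map vec w) = (if u = w then 1 else 0)"
  by (induction u w rule: list_induct2) (auto simp: ell_coset coord_y)

text \<open>Projecting to degree \<open>n\<close>, symmetrizing and pairing gives a functional that
  kills the relations and, beyond the lengths of words in the spanning set, that set as well. It is
  therefore zero, and its values on words in the vectors \<open>vec\<close> are the matrix
  coefficients.\<close>

lemma nichols_symmetrizer_vanish:
  assumes "nichols_finite_dim V brd"
  shows "\<exists>n0. \<forall>n\<ge>n0. \<forall>u w. length u = n \<longrightarrow> length w = n \<longrightarrow>
    (\<Sum>\<sigma> | \<sigma> permutes {..<n}. if \<forall>x<n. u ! \<sigma> x = w ! x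
       then inv_weight (\<lambda>x y. q y x) n (pinv \<sigma>) ((!) u) else 0) = 0"
proof -
  obtain S where S: "finite S" "S \<subseteq> tensor_words V"
    "tensor_words V \<subseteq> free_vs.span (S \<union> nichols_relations V brd)"
    using assms unfolding nichols_finite_dim_def by blast
  have "finite (\<Union>f\<in>S. length ` Poly_Mapping.keys f)" using S(1) by simp
  then obtain m where m: "\<And>f w. f \<in> S \<Longrightarrow> w \<in> Poly_Mapping.keys f \<Longrightarrow> length w < m"
    unfolding finite_nat_set_iff_bounded by blast
  show ?thesis
  proof (intro exI allI impI)
    fix n :: nat and u w :: "bool list"
    \<comment> \<open>The ideal is described by symmetrizers from degree 2 on, hence the 2.\<close>
    assume n: "max m 2 \<le> n" and u: "length u = n" and w: "length w = n"
    define Q where "Q f = pair (word_pairing u) (quantum_symmetrizer brd n (tensor_component n f))"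
      for f :: "('g \<Rightarrow>\<^sub>0 'k) set list \<Rightarrow>\<^sub>0 'k"
    have Q0: "pair (word_pairing u) (quantum_symmetrizer brd n 0) = 0"
      using pair_quantum_symmetrizer_linear(2)[of "word_pairing u" brd n 0 0] by simp
    have "Q f = 0" if "f \<in> free_vs.span (S \<union> nichols_relations V brd)" for f
      using that
    proof (induction rule: free_vs.span_induct)
      case base
      show ?case
        by (auto simp: free_vs.subspace_def Q_def tensor_component_def free_extend_add
            free_extend_scale pair_quantum_symmetrizer_linear Q0)
    next
      case (step f)
      then show ?case
      proof
        assume "f \<in> S"
        then have "tensor_component n f = 0"
          using m n by (intro tensor_component_eq) fastforce
        then show ?thesis by (simp add: Q_def Q0)
      next
        assume "f \<in> nichols_relations V brd"
        then have "quantum_symmetrizer brd n (tensor_component n f) \<in> tensor_relations V"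
          using n unfolding nichols_relations_def by simp
        then show ?thesis unfolding Q_def by (rule tensor_relations_pairing)
      qed
    qed
    moreover have "basis_vec (map vec w) \<in> tensor_words V"
      using vec_carrier by (auto simp: tensor_words_def in_lists_conv_set)
    ultimately have "Q (basis_vec (map vec w)) = 0" using S(3) by blast
    then have 0: "(\<Sum>\<sigma> | \<sigma> permutes {..<n}. pair (word_pairing u)
        (braid_perm brd n \<sigma> (basis_vec (map vec w)))) = 0"
      using w by (simp add: Q_def tensor_component_def quantum_symmetrizer_def pair_sum)
    have hw: "basis_vec (map vec w) \<in> homog_words n"
      using vec_carrier w by (auto simp: homog_words_def in_lists_conv_set)
    have um: "map ((!) u) [0..<n] = u" using u map_nth[of u] by simp
    have "pair (word_pairing u) (braid_perm brd n \<sigma> (basis_vec (map vec w))) =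
        (if \<forall>x<n. u ! \<sigma> x = w ! x then inv_weight (\<lambda>x y. q y x) n (pinv \<sigma>) ((!) u) else 0)"
      if "\<sigma> permutes {..<n}" for \<sigma>
    proof -
      have "map ((!) u \<circ> \<sigma>) [0..<n] = w \<longleftrightarrow> (\<forall>x<n. u ! \<sigma> x = w ! x)"
        using w by (auto simp: list_eq_iff_nth_eq)
      moreover have mult_if: "c * (if P then 1 else 0) = (if P then c else 0)" for c :: 'k and P
        by simp
      moreover have "word_pairing (map ((!) u \<circ> \<sigma>) [0..<n]) (map vec w) =
          (if map ((!) u \<circ> \<sigma>) [0..<n] = w then 1 else 0)"
        by (rule word_pairing_vec) (simp add: w)
      ultimately show ?thesis
        using pair_braid_perm[OF hw that, of "(!) u"] unfolding um pair_basis
        by (simp only: mult_if)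
    qed
    then have "(\<Sum>\<sigma> | \<sigma> permutes {..<n}. if \<forall>x<n. u ! \<sigma> x = w ! x
       then inv_weight (\<lambda>x y. q y x) n (pinv \<sigma>) ((!) u) else 0) =
      (\<Sum>\<sigma> | \<sigma> permutes {..<n}. pair (word_pairing u) (braid_perm brd n \<sigma> (basis_vec (map vec w))))"
      by (intro sum.cong) auto
    then show "(\<Sum>\<sigma> | \<sigma> permutes {..<n}. if \<forall>x<n. u ! \<sigma> x = w ! x
       then inv_weight (\<lambda>x y. q y x) n (pinv \<sigma>) ((!) u) else 0) = 0" using 0 by simp
  qed
qed

end

theorem nichols_finite_dim_parameters:
  fixes a s :: "'k::{field_char_0}"
  assumes "induced_braiding G g ch y t (\<lambda>b c. if b = c then a else s)"
    and nfd: "nichols_finite_dim (induced_module G g ch) (yd_braiding G (induced_module G g ch))"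
    and "a \<noteq> 0" "s \<noteq> 0" and N: "N > 0" "a ^ N = 1" and k: "a ^ k * s ^ 2 = 1"
  shows "a \<noteq> 1 \<and> (s ^ 2 = 1 \<or> a * s ^ 2 = 1)"
proof -
  interpret rank2_braiding a s using assms by unfold_locales
  interpret ib: induced_braiding G g ch y t "\<lambda>b c. if b = c then a else s" by fact
  have q: "(\<lambda>x y. if y = x then a else s) = braid_coeff" by (auto simp: braid_coeff_def fun_eq_iff)
  obtain n0 where n0: "\<And>n u w. n \<ge> n0 \<Longrightarrow> length u = n \<Longrightarrow> length w = n \<Longrightarrow>
    (\<Sum>\<sigma> | \<sigma> permutes {..<n}. if \<forall>x<n. u ! \<sigma> x = w ! x
       then inv_weight braid_coeff n (pinv \<sigma>) ((!) u) else 0) = 0"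
    using ib.nichols_symmetrizer_vanish[OF nfd] unfolding q by blast
  have van: "foldr shuffle js delta u = 0" if "length js \<ge> n0" "length u = length js" for js u
    using n0[of "length js" u "rev js"] symmetrizer_sum[of u "rev js", unfolded length_rev rev_rev_ident] that by simp
  have a1: "a \<noteq> 1"
  proof
    assume "a = 1"
    from symmetrizer_nonzero_trivial[OF this, of n0] van[of "replicate n0 False" "replicate n0 False"]
    show False by simp
  qed
  \<comment> \<open>The given \<open>k\<close> matters only modulo the exact order of
    \<open>a\<close>; its residue is the exponent that the Cartan locale asks for.\<close>
  define M where "M = (LEAST m. 0 < m \<and> a ^ m = 1)"
  have M: "0 < M" "a ^ M = 1" using LeastI[of "\<lambda>m. 0 < m \<and> a ^ m = 1" N] N by (auto simp: M_def)
  have M_min: "a ^ m \<noteq> 1" if "0 < m" "m < M" for m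
    using not_less_Least[of m "\<lambda>m. 0 < m \<and> a ^ m = 1"] that by (auto simp: M_def)
  have "a ^ k = a ^ (k mod M)"
    by (metis M(2) mod_mult_div_eq mult.commute mult_1 power_add power_mult power_one)
  then have k': "a ^ (k mod M) * s ^ 2 = 1" using k by simp
  have "k mod M < 2"
  proof (rule ccontr)
    assume nk: "\<not> k mod M < 2"
    have "M \<ge> 2" using M a1 by (cases "M = 1") auto
    then interpret rank2_cartan a s M "k mod M"
      using M M_min k' by unfold_locales auto
    show False using symmetrizer_nonzero[of n0] nk van by (metis leI)
  qed
  then have "k mod M = 0 \<or> k mod M = 1" by linarith
  then show ?thesis using k' a1 by auto
qed

section \<open>Matrices over finite fields\<close>

text \<open>Lagrange's theorem in the multiplicative group.\<close>

lemma power_card_finite_field: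
  fixes z :: "'a::{field,finite}"
  shows "z ^ CARD('a) = z"
proof (cases "z = 0")
  case True
  then show ?thesis by simp
next
  case False
  let ?G = "mult_group_of_field :: 'a monoid"
  interpret G: group ?G
  proof (rule groupI)
    show "\<exists>y\<in>carrier ?G. y \<otimes>\<^bsub>?G\<^esub> x = \<one>\<^bsub>?G\<^esub>" if "x \<in> carrier ?G" for x
      using that by (intro bexI[of _ "inverse x"]) (auto simp: mult_group_of_field_def)
  qed (auto simp: mult_group_of_field_def)
  have pow: "z [^]\<^bsub>?G\<^esub> n = z ^ n" for n :: nat
    by (induction n) (simp_all add: mult_group_of_field_def mult.commute)
  have "order ?G = CARD('a) - 1"
    by (simp add: order_def mult_group_of_field_def Compl_eq_Diff_UNIV card_Diff_singleton)
  moreover have "z [^]\<^bsub>?G\<^esub> order ?G = \<one>\<^bsub>?G\<^esub>"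
    using False by (intro G.pow_order_eq_1) (simp add: mult_group_of_field_def)
  moreover have "\<one>\<^bsub>?G\<^esub> = 1" by (simp add: mult_group_of_field_def)
  ultimately have "z ^ (CARD('a) - 1) = 1" unfolding pow by (simp only:)
  moreover have "CARD('a) = Suc (CARD('a) - 1)" using finite_UNIV_card_ge_0[where 'a = 'a] by simp
  ultimately show ?thesis by (metis mult.right_neutral power_Suc)
qed

lemma field_embedding_hom:
  assumes "field_embedding \<iota>"
  shows "\<iota> 0 = 0" "\<iota> 1 = 1" "\<iota> (a + b) = \<iota> a + \<iota> b" "\<iota> (a * b) = \<iota> a * \<iota> b"
    "\<iota> (- a) = - \<iota> a" "\<iota> (a - b) = \<iota> a - \<iota> b" "\<iota> (a ^ n) = \<iota> a ^ n" "inj \<iota>"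
proof -
  show one: "\<iota> 1 = 1" and add: "\<iota> (a + b) = \<iota> a + \<iota> b" and mult: "\<iota> (a * b) = \<iota> a * \<iota> b" for a b
    using assms by (auto simp: field_embedding_def)
  have "\<iota> 0 + \<iota> 0 = \<iota> 0 + 0" using add[of 0 0] by (simp only: add_0_left add_0_right)
  then show zero: "\<iota> 0 = 0" by (simp only: add_left_cancel)
  show neg: "\<iota> (- a) = - \<iota> a" for a using add[of a "- a"] zero by (simp add: eq_neg_iff_add_eq_0 add.commute)
  show diff: "\<iota> (a - b) = \<iota> a - \<iota> b" for a b using add[of a "- b"] neg by simp
  show "\<iota> (a ^ n) = \<iota> a ^ n" by (induction n) (simp_all add: one mult)
  show "inj \<iota>"
  proof (rule injI)
    fix a b assume "\<iota> a = \<iota> b"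
    then have "\<iota> (a - b) = 0" by (simp add: diff)
    then show "a = b" using mult[of "a - b" "inverse (a - b)"] one by (cases "a = b") auto
  qed
qed

text \<open>The polynomial X^q - X has at most q roots, and the image of the embedding already
  supplies q of them.\<close>

lemma mem_range_embedding:
  fixes \<iota> :: "'f::{field,finite} \<Rightarrow> 'e::{field,finite}"
  assumes "field_embedding \<iota>" "z ^ CARD('f) = z"
  shows "z \<in> range \<iota>"
proof -
  let ?q = "CARD('f)" and ?S = "{z :: 'e. z ^ CARD('f) = z}"
  have q: "1 < ?q" using card_mono[of "UNIV :: 'f set" "{0, 1}"] by simp
  define p :: "'e poly" where "p = Polynomial.monom 1 ?q - [:0, 1:]"
  have cp: "Polynomial.coeff p ?q = 1" using q by (simp add: p_def coeff_pCons split: nat.splits)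
  then have p0: "p \<noteq> 0" by auto
  have "Polynomial.degree p \<le> ?q" unfolding p_def using q by (intro degree_diff_le) (auto simp: degree_monom_le)
  moreover have "{z. poly p z = 0} = ?S" by (simp add: p_def poly_monom)
  ultimately have "card ?S \<le> ?q" using card_poly_roots_bound[OF p0] by simp
  moreover have "range \<iota> \<subseteq> ?S"
    using power_card_finite_field[where 'a = 'f] field_embedding_hom(7)[OF assms(1)] by (metis (mono_tags, lifting) image_subsetI mem_Collect_eq)
  moreover have "card (range \<iota>) = ?q" by (rule card_image[OF field_embedding_hom(8)[OF assms(1)]])
  ultimately have "range \<iota> = ?S" by (intro card_seteq) auto
  then show ?thesis using assms(2) by simp
qed

text \<open>The characteristic divides the cardinality, so it is the prime of which \<open>q\<close>
  is a power.\<close>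

lemma frobenius_add:
  fixes u v :: "'e::{field,finite}"
  assumes "primepow q" "CARD('e) = q ^ 2"
  shows "(u + v) ^ q = u ^ q + v ^ q"
proof -
  have "CHAR('e) > 0" by (rule finite_imp_CHAR_pos) simp
  then have pr: "prime CHAR('e)" by (rule prime_CHAR_semidom)
  obtain r n where r: "prime r" "q = r ^ n" using assms(1) by (auto simp: primepow_def)
  have "CHAR('e) dvd q ^ 2" using CHAR_dvd_CARD[where 'a = 'e] assms(2) by simp
  then have "CHAR('e) dvd r" using pr r(2) by (metis prime_dvd_power)
  then have "CHAR('e) = r" using pr r(1) by (simp add: primes_dvd_imp_eq)
  then show ?thesis using freshmans_dream'[OF pr, of q n u v] r(2) by simp
qed

section \<open>Two-by-two matrices and the evaluation of the braiding matrix\<close>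

lemma mat2_nth [simp]:
  "mat2 a b c d $ 1 $ 1 = a" "mat2 a b c d $ 1 $ 2 = b" "mat2 a b c d $ 2 $ 1 = c" "mat2 a b c d $ 2 $ 2 = d"
  by (simp_all add: mat2_def)

lemma mat2_mult:
  "mat2 a b c d ** mat2 a' b' c' d' =
     (mat2 (a * a' + b * c') (a * b' + b * d') (c * a' + d * c') (c * b' + d * d') :: 'f::field ^ 2 ^ 2)"
  by (simp add: vec_eq_iff forall_2 matrix_matrix_mult_def sum_2)

lemma mat2_mat: "mat c = (mat2 c 0 0 c :: 'f::field ^ 2 ^ 2)"
  by (simp add: vec_eq_iff forall_2 mat_def)

lemma group_GL: "group (GL :: ('f::field ^ 'n ^ 'n) monoid)"
proof (rule groupI)
  show "\<exists>y\<in>carrier GL. y \<otimes>\<^bsub>GL\<^esub> x = \<one>\<^bsub>GL\<^esub>" if "x \<in> carrier (GL :: ('f ^ 'n ^ 'n) monoid)" for x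
    using that unfolding GL_def invertible_def by auto
  show "\<one>\<^bsub>GL\<^esub> \<in> carrier (GL :: ('f ^ 'n ^ 'n) monoid)"
    by (simp add: GL_def invertible_def)
qed (auto simp: GL_def invertible_mult matrix_mul_assoc)

theorem proposition4p3:
  fixes \<iota> :: "'f::{field,finite} \<Rightarrow> 'e::{field,finite}"
    and q :: nat
    and x :: 'e
    and g :: "'f ^ 2 ^ 2"
    and ch :: "'f ^ 2 ^ 2 \<Rightarrow> 'k::{alg_closed_field,field_char_0}"
    and t y :: "('f ^ 2 ^ 2) ^ 2"
  assumes "primepow q" and "q > 2"
    and "CARD('f) = q" and "CARD('e) = q ^ 2"
    and "field_embedding \<iota>"
    and "x \<notin> range \<iota>"
    and "g = c4 \<iota> x"
    and "ch \<in> characters GL (centralizer GL g)"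
    and "t = vector [c4 \<iota> x, mat2 (conj_sum \<iota> x) (conj_prod \<iota> x) (- 1) 0]"
    and "\<forall>i. y $ i \<in> carrier GL \<and> t $ i = y $ i \<otimes>\<^bsub>GL\<^esub> g \<otimes>\<^bsub>GL\<^esub> inv\<^bsub>GL\<^esub> (y $ i)"
    and "nichols_finite_dim (induced_module GL g ch) (yd_braiding GL (induced_module GL g ch))"
  shows "braiding_matrix GL ch t y = mat2 (- 1) (- 1) (- 1) (- 1) \<or>
    (\<exists>\<omega>. primitive_root_of_unity 3 \<omega> \<and> braiding_matrix GL ch t y = mat2 \<omega> \<omega> \<omega> \<omega>)"
proof -
  note emb = field_embedding_hom[OF assms(5)]
  interpret G: group "GL :: ('f ^ 2 ^ 2) monoid" by (rule group_GL)
  define T D where "T = conj_sum \<iota> x" and "D = conj_prod \<iota> x"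
  define h where "h = mat2 T D (- 1) 0"
  \<comment> \<open>\<open>\<F>\<^sub>q[g]\<close> is a copy of \<open>\<F>\<^sub>q\<^sub>2\<close>, in which \<open>h\<close>, the conjugate of \<open>g\<close>, is \<open>g ^ q\<close>.\<close>
  have xqq: "(x ^ q) ^ q = x"
    using power_card_finite_field[of x] assms(4) by (simp add: power2_eq_square power_mult)
  have "(x + x ^ q) ^ q = x + x ^ q"
    by (simp add: frobenius_add[OF assms(1,4)] xqq add.commute)
  then have "x + x ^ q \<in> range \<iota>"
    by (intro mem_range_embedding[OF assms(5)]) (simp only: assms(3))
  from f_the_inv_into_f[OF emb(8) this] have T: "\<iota> T = x + x ^ q"
    unfolding T_def conj_sum_def assms(3) .
  have "(x * x ^ q) ^ q = x * x ^ q" by (simp add: power_mult_distrib xqq mult.commute)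
  then have "x * x ^ q \<in> range \<iota>"
    by (intro mem_range_embedding[OF assms(5)]) (simp only: assms(3))
  from f_the_inv_into_f[OF emb(8) this] have D: "\<iota> D = x * x ^ q"
    unfolding D_def conj_prod_def assms(3) .
  have x0: "x \<noteq> 0" using assms(6) emb(1) by (metis rangeI)
  then have D0: "D \<noteq> 0" using D emb(1) by auto
  have g: "g = mat2 0 (- D) 1 T" unfolding assms(7) c4_def T_def D_def ..
  \<comment> \<open>Over the small field 1 and \<open>x\<close> are linearly independent; this
    permits comparing the coordinates of powers of \<open>x\<close>.\<close>
  have independent: "r = 0 \<and> c = 0" if "\<iota> r + \<iota> c * x = 0" for r c
  proof (cases "c = 0")
    case True
    then have "\<iota> r = \<iota> 0" using that emb(1) by simp
    then show ?thesis using True inj_eq[OF emb(8)] by simp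
  next
    case False
    have 1: "\<iota> c * \<iota> (inverse c) = 1"
      using emb(4)[of c "inverse c"] emb(2) False by simp
    have 2: "\<iota> c * x = - \<iota> r" using that by (simp add: add_eq_0_iff)
    have "x = x * (\<iota> c * \<iota> (inverse c))" by (simp only: 1 mult_1_right)
    also have "\<dots> = (\<iota> c * x) * \<iota> (inverse c)" by (simp only: mult.assoc mult.left_commute)
    also have "\<dots> = \<iota> (- r * inverse c)" unfolding 2 emb(4) emb(5) ..
    finally have "x = \<iota> (- r * inverse c)" .
    then show ?thesis using assms(6) by blast
  qed
  \<comment> \<open>By Cayley-Hamilton the inverse of \<open>g\<close> is
    \<open>(T - g) / D\<close>.\<close>
  have g_inv: "g \<in> carrier GL"
    unfolding GL_def
    by (simp add: g invertible_def)
      (intro exI[of _ "mat2 (T / D) 1 (- 1 / D) 0"], use D0 in \<open>simp add: mat2_mult mat2_mat\<close>)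
  have h_eq: "h = mat T - g" and g_eq: "g = mat T - h"
    by (simp_all add: g h_def mat2_mat vec_eq_iff forall_2)
  have t1: "t $ 1 = g" and t2: "t $ 2 = h"
    by (simp_all add: assms(9) assms(7) h_def T_def D_def)
  have yc: "y $ i \<in> carrier GL" and ty: "t $ i = y $ i \<otimes>\<^bsub>GL\<^esub> g \<otimes>\<^bsub>GL\<^esub> inv\<^bsub>GL\<^esub> (y $ i)" for i
    using assms(10) by blast+
  have conj_t: "inv\<^bsub>GL\<^esub> (y $ i) \<otimes>\<^bsub>GL\<^esub> t $ i \<otimes>\<^bsub>GL\<^esub> y $ i = g" for i
  proof -
    have "inv\<^bsub>GL\<^esub> (y $ i) \<otimes>\<^bsub>GL\<^esub> (y $ i \<otimes>\<^bsub>GL\<^esub> g) = g"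
      using yc[of i] g_inv by (simp add: G.m_assoc[symmetric])
    then show ?thesis unfolding ty[of i] using yc[of i] g_inv by (simp add: G.m_assoc)
  qed
  \<comment> \<open>Scalar matrices are fixed by conjugation. Since \<open>g\<close> and
    \<open>h\<close> add up to the scalar \<open>T\<close>, a conjugation taking \<open>h\<close> to
    \<open>g\<close> takes \<open>g\<close> to \<open>h\<close>.\<close>
  have conj_adj: "inv\<^bsub>GL\<^esub> (y $ i) \<otimes>\<^bsub>GL\<^esub> (mat T - X) \<otimes>\<^bsub>GL\<^esub> y $ i =
      mat T - inv\<^bsub>GL\<^esub> (y $ i) \<otimes>\<^bsub>GL\<^esub> X \<otimes>\<^bsub>GL\<^esub> y $ i" for i X
  proof -
    have 1: "inv\<^bsub>GL\<^esub> (y $ i) ** y $ i = mat 1" using G.l_inv[OF yc[of i]] by (simp add: GL_def)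
    have 2: "mat T ** Y = Y ** mat T" for Y :: "'f ^ 2 ^ 2"
      by (simp add: vec_eq_iff forall_2 matrix_matrix_mult_def sum_2 mat_def)
    have 3: "A ** (mat T - X) ** B = A ** mat T ** B - A ** X ** B" for A B :: "'f ^ 2 ^ 2"
      by (simp add: vec_eq_iff forall_2 matrix_matrix_mult_def sum_2 algebra_simps)
    have "inv\<^bsub>GL\<^esub> (y $ i) ** mat T ** y $ i = mat T ** (inv\<^bsub>GL\<^esub> (y $ i) ** y $ i)"
      by (simp only: 2[symmetric] matrix_mul_assoc)
    then show ?thesis by (simp add: GL_def 3[unfolded GL_def] 1[unfolded GL_def])
  qed
  have conj_12: "inv\<^bsub>GL\<^esub> (y $ 2) \<otimes>\<^bsub>GL\<^esub> t $ 1 \<otimes>\<^bsub>GL\<^esub> y $ 2 = h"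
    using conj_adj[of 2 h] conj_t[of 2] by (simp add: t1 t2 flip: g_eq h_eq)
  have conj_21: "inv\<^bsub>GL\<^esub> (y $ 1) \<otimes>\<^bsub>GL\<^esub> t $ 2 \<otimes>\<^bsub>GL\<^esub> y $ 1 = h"
    using conj_adj[of 1 g] conj_t[of 1] by (simp add: t1 t2 flip: g_eq h_eq)
  have gh: "h \<otimes>\<^bsub>GL\<^esub> g = g \<otimes>\<^bsub>GL\<^esub> h"
    by (simp add: GL_def g h_def mat2_mult)
  have h_inv: "h \<in> carrier GL" using yc g_inv ty[of 2] by (simp add: t2)
  have gZ: "g \<in> centralizer GL g" and hZ: "h \<in> centralizer GL g"
    using g_inv h_inv gh by (simp_all add: centralizer_def)
  define a s where "a = ch g" and "s = ch h"
  define y' t' where "y' b = y $ (if b then 2 else 1)" and "t' b = t $ (if b then 2 else 1)" for b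
  \<comment> \<open>Equality would force trace zero and characteristic two, and then
    \<open>x\<close> would be fixed by Frobenius and lie in the small field.\<close>
  have g_neq_h: "g \<noteq> h"
  proof
    assume "g = h"
    then have "(0 :: 'f) = T" "(1 :: 'f) = - 1" unfolding g h_def by (metis mat2_nth)+
    then have "x + x ^ q = 0" "(1 :: 'e) = - 1" using T emb(1,2,5) by (metis)+
    then have "x ^ CARD('f) = x" unfolding assms(3)
      by (metis add_eq_0_iff mult_1 mult_minus_left)
    then show False using mem_range_embedding[OF assms(5)] assms(6) by blast
  qed
  have ib: "induced_braiding GL g ch y' t' (\<lambda>b c. if b = c then a else s)"
  proof unfold_locales
    show "inv\<^bsub>GL\<^esub> (y' c) \<otimes>\<^bsub>GL\<^esub> t' b \<otimes>\<^bsub>GL\<^esub> y' c \<in> centralizer GL g" for b c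
      using gZ hZ by (auto simp: y'_def t'_def conj_t conj_12 conj_21)
    show "(if b = c then a else s) = ch (inv\<^bsub>GL\<^esub> (y' c) \<otimes>\<^bsub>GL\<^esub> t' b \<otimes>\<^bsub>GL\<^esub> y' c)" for b c
      by (auto simp: y'_def t'_def conj_t conj_12 conj_21 a_def s_def)
    show "t' True \<noteq> t' False" using g_neq_h by (simp add: t'_def t1 t2)
  qed (use g_inv assms(8) yc ty in \<open>auto simp: y'_def t'_def\<close>)
  interpret ib: induced_braiding GL g ch y' t' "\<lambda>b c. if b = c then a else s" by (rule ib)
  \<comment> \<open>\<open>P\<close> is the \<open>n\<close>-th power of \<open>g\<close>, written
    as \<open>r + c g\<close>. By Cayley-Hamilton its coordinates follow the same recursion as those
    of \<open>x ^ n\<close>, so both can be computed in the field.\<close>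
  have powers: "\<exists>P r c. P \<in> centralizer GL g \<and> ch P = a ^ n \<and>
      P = mat2 r (- D * c) c (r + T * c) \<and> x ^ n = \<iota> r + \<iota> c * x" for n
  proof (induction n)
    case 0
    show ?case
      by (intro exI[of _ "\<one>\<^bsub>GL\<^esub>"] exI[of _ 1] exI[of _ 0])
        (use g_inv in \<open>auto simp: centralizer_def ib.ch_one emb\<close>, simp add: GL_def mat2_mat)
  next
    case (Suc n)
    then obtain P r c where P: "P \<in> centralizer GL g" "ch P = a ^ n"
      "P = mat2 r (- D * c) c (r + T * c)" "x ^ n = \<iota> r + \<iota> c * x" by blast
    show ?case
    proof (intro exI conjI)
      show "P \<otimes>\<^bsub>GL\<^esub> g \<in> centralizer GL g"
        by (rule subgroup.m_closed[OF ib.Z_subgroup P(1) gZ])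
      show "ch (P \<otimes>\<^bsub>GL\<^esub> g) = a ^ Suc n"
        by (simp add: ib.ch_mult[OF P(1) gZ] P(2) a_def)
      show "P \<otimes>\<^bsub>GL\<^esub> g = mat2 (- D * c) (- D * (r + T * c)) (r + T * c) (- D * c + T * (r + T * c))"
        by (simp add: GL_def P(3) g mat2_mult algebra_simps)
      have xx: "x * x = \<iota> T * x - \<iota> D" by (simp add: T D algebra_simps)
      have "x ^ Suc n = \<iota> r * x + \<iota> c * (x * x)" by (simp add: P(4) algebra_simps)
      also have "\<dots> = - \<iota> D * \<iota> c + (\<iota> r + \<iota> T * \<iota> c) * x"
        unfolding xx by (simp add: algebra_simps)
      also have "\<dots> = \<iota> (- D * c) + \<iota> (r + T * c) * x" by (simp only: emb(3) emb(4) emb(5))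
      finally show "x ^ Suc n = \<iota> (- D * c) + \<iota> (r + T * c) * x" .
    qed
  qed
  have sa: "s = a ^ q"
  proof -
    obtain P r c where P: "ch P = a ^ q" "P = mat2 r (- D * c) c (r + T * c)"
      "x ^ q = \<iota> r + \<iota> c * x" using powers[of q] by blast
    \<comment> \<open>From \<open>x ^ q = T - x\<close> the coordinates are \<open>T\<close> and -1,
      which are those of \<open>h\<close>.\<close>
    have "\<iota> (r - T) + \<iota> (c + 1) * x = 0" using P(3) T by (simp add: emb algebra_simps)
    from independent[OF this] have "r = T" "c = - 1" by (simp_all add: eq_neg_iff_add_eq_0)
    then have "P = h" by (simp add: P(2) h_def)
    then show ?thesis using P(1) by (simp add: s_def)
  qed
  have as: "a = s ^ q"
  proof -
    obtain P r c where P: "ch P = a ^ (q * q)" "P = mat2 r (- D * c) c (r + T * c)"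
      "x ^ (q * q) = \<iota> r + \<iota> c * x" using powers[of "q * q"] by blast
    have "\<iota> r + \<iota> (c - 1) * x = 0" using P(3) xqq by (simp add: emb power_mult algebra_simps)
    from independent[OF this] have "r = 0" "c = 1" by simp_all
    then have "P = g" by (simp add: P(2) g)
    then show ?thesis using P(1) by (simp add: a_def sa power_mult)
  qed
  have a0: "a \<noteq> 0"
    using assms(8) gZ by (auto simp: a_def characters_def hom_def mult_group_of_field_def)
  define N where "N = q * q - 1"
  have "4 \<le> q * q" using mult_le_mono[of 2 q 2 q] assms(2) by simp
  then have N: "N > 0" "Suc N = q * q" by (simp_all add: N_def)
  have "a ^ Suc N = a" unfolding N(2) power_mult using as sa by simp
  then have aN: "a ^ N = 1" using a0 by simp
  \<comment> \<open>The exponent \<open>2 * q * (N - 1)\<close> represents \<open>- 2 * q\<close>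
    modulo \<open>N\<close>, and \<open>s ^ 2 = a ^ (2 * q)\<close>.\<close>
  have "2 * q + 2 * q * (N - 1) = N * (2 * q)" using N(1) by (cases N) simp_all
  then have "a ^ (2 * q * (N - 1)) * s ^ 2 = (a ^ N) ^ (2 * q)"
    unfolding sa power_mult[symmetric] power_add[symmetric] by (simp add: mult.commute add.commute)
  then have "a ^ (2 * q * (N - 1)) * s ^ 2 = 1" by (simp add: aN)
  from nichols_finite_dim_parameters[OF ib assms(11) a0 _ N(1) aN this]
  have main: "a \<noteq> 1" "s ^ 2 = 1 \<or> a * s ^ 2 = 1" using a0 sa by auto
  have matrix: "braiding_matrix GL ch t y = mat2 a s s a"
    by (simp add: vec_eq_iff forall_2 braiding_matrix_def conj_t conj_12 conj_21 a_def s_def)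
  have sq: "(s ^ 2) ^ q = a ^ 2" by (subst as) (simp add: power_mult[symmetric] mult.commute)
  from main(2) show ?thesis
  proof
    assume s2: "s ^ 2 = 1"
    have "s \<noteq> 1" using as main(1) by auto
    then have s1: "s = - 1" using s2 by (simp add: power2_eq_1_iff)
    have "a = - 1" using sq s2 main(1) by (simp add: power2_eq_1_iff)
    then show ?thesis using s1 matrix by simp
  next
    assume as2: "a * s ^ 2 = 1"
    \<comment> \<open>Raising to the power \<open>q\<close> exchanges \<open>a\<close> and
      \<open>s\<close>, so the relation has a mirror image.\<close>
    have "s * a ^ 2 = (a * s ^ 2) ^ q"
      unfolding power_mult_distrib sa[symmetric] sq ..
    then have sa2: "s * a ^ 2 = 1" using as2 by simp
    \<comment> \<open>Multiplying by the square of the mirror relation lets \<open>a * s ^ 2\<close>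
      split off, which leaves \<open>a = a ^ 4\<close>.\<close>
    have "a = a * (s * a ^ 2) ^ 2" by (simp add: sa2)
    also have "\<dots> = (a * s ^ 2) * a ^ 4" by (simp add: power_mult_distrib power_mult[symmetric] algebra_simps)
    finally have "a * a ^ 3 = a * 1" using as2 by (simp add: power_Suc[symmetric] del: power_Suc)
    then have a3: "a ^ 3 = 1" using a0 by simp
    then have "s * a ^ 2 = a * a ^ 2" using sa2 by (simp add: power3_eq_cube power2_eq_square mult.assoc)
    then have "s = a" using a0 by simp
    moreover have "primitive_root_of_unity 3 a"
    proof -
      have "a ^ 2 \<noteq> 1" using a3 main(1) by (auto simp: power3_eq_cube power2_eq_square)
      then have "a ^ m \<noteq> 1" if "0 < m" "m < 3" for m
      proof -
        have "m = 1 \<or> m = 2" using that by linarith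
        then show ?thesis using \<open>a ^ 2 \<noteq> 1\<close> main(1) by auto
      qed
      then show ?thesis using a3 by (simp add: primitive_root_of_unity_def)
    qed
    ultimately show ?thesis using matrix by auto
  qed
qed

end
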